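(* Assume condition (A) holds, and that $L^{-s},\,L^{\frac{q}{q-p}},\,|K|^{\frac{q}{q-p}}\in L^1(A_{R_1}^{R_1+2\epsilon})$ for some $\epsilon\in(0,\frac{R_2-R_1}{2})$, some $s\in(\frac Np,\infty)\cap[\frac1{p-1},\infty)$ and some $q\in[p,p_s^\ast)$. Then for every (weak) solution $u$ of problem (1.1) (with any $\lambda>0$) we have $u\in L^q(A_{R_1}^{R_1+2\epsilon})\cap L^\infty(A_{R_1}^{R_1+\epsilon})$, and there exist constants $C>0$, $\mu>0$ independent of $u$ such that $$\|u\|_{L^\infty(A_{R_1}^{R_1+\epsilon})}\le C\Big[1+\Big(\int_{A_{R_1}^{R_1+2\epsilon}}|u|^q dx\Big)^{\mu}\Big].$$
   Context: Let $N\ge 2$, $1<p<\infty$, $p'=p/(p-1)$, $0<R_1<R_2\le\infty$, $A_{a}^{b}=\{x\in\mathbb R^N:a<|x|<b\}$. $L$ is measurable and positive a.e. in $A_{R_1}^{R_2}$ with $L\in L^1_{\mathrm{loc}}$; $K$ is measurable with $|\{K>0\}|>0$. Condition (A): there exist $v,w$ measurable and positive a.e. in $(R_1,R_2)$, $v^{-1/(p-1)},w\in L^1_{\mathrm{loc}}(R_1,R_2)$, such that with $\rho(r)=r^{N-1}v(r)$, $\sigma(r)=r^{N-1}w(r)$, $P(r):=\min\{(\int_{R_1}^r\rho^{1-p'})^{p-1},(\int_r^{R_2}\rho^{1-p'})^{p-1}\}$: $P(r)<\infty$ for all $r$, $\int_{R_1}^{R_2}P\sigma\,dr<\infty$, and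 $L(x)\ge v(|x|)$, $|K(x)|\le w(|x|)$ a.e. $\mathcal D_0^{1,p}(A_{R_1}^{R_2};L)$: completion of $C_c^1(A_{R_1}^{R_2})$ in the norm $(\int L|\nabla u|^p)^{1/p}$. Problem (1.1): $-\operatorname{div}(L|\nabla u|^{p-2}\nabla u)=\lambda K|u|^{p-2}u$ in $A_{R_1}^{R_2}$, $u=0$ on the boundary; a weak solution is $u\in\mathcal D_0^{1,p}(A_{R_1}^{R_2};L)$ with $\int L|\nabla u|^{p-2}\nabla u\cdot\nabla\phi=\lambda\int K|u|^{p-2}u\phi$ for all $\phi$ in that space. Notation: $p_s=\frac{ps}{s+1}$; for $\alpha>0$, $\alpha^\ast=\frac{N\alpha}{N-\alpha}$ if $\alpha<N$ and $\alpha^\ast=\infty$ if $\alpha\ge N$; convention $\frac{\alpha}{0}=\infty$ (so for $q=p$ the condition $f^{q/(q-p)}\in L^1$ means $f\in L^\infty$). *)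

theory Defs
  imports "HOL-Analysis.Analysis"
begin

definition annulus :: "real \<Rightarrow> ereal \<Rightarrow> 'a::real_normed_vector set" where
  "annulus a b = {x. a < norm x \<and> ereal (norm x) < b}"

definition rint :: "real \<Rightarrow> ereal \<Rightarrow> real set" where
  "rint a b = {r. a < r \<and> ereal r < b}"

definition C1c :: "'a::euclidean_space set \<Rightarrow> ('a \<Rightarrow> real) \<Rightarrow> ('a \<Rightarrow> 'a) \<Rightarrow> bool" where
  "C1c A phi dphi \<longleftrightarrow>
     (\<forall>x. (phi has_derivative (\<lambda>h. dphi x \<bullet> h)) (at x)) \<and> continuous_on UNIV dphi \<and>
     (\<exists>S. compact S \<and> S \<subseteq> A \<and> (\<forall>x. x \<notin> S \<longrightarrow> phi x = 0))"

text \<open>u (with weak gradient g) belongs to D_0^{1,p}(A;L): it is the limit of C_c^1(A)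
  functions phi_n whose gradients converge to g in the weighted norm (int L |.|^p)^(1/p),
  the phi_n converging to u in L^1_loc(A) (which identifies the abstract completion
  element with a function, using condition (A)).\<close>
definition inD0 :: "real \<Rightarrow> ('a::euclidean_space \<Rightarrow> real) \<Rightarrow> 'a set \<Rightarrow> ('a \<Rightarrow> real) \<Rightarrow> ('a \<Rightarrow> 'a) \<Rightarrow> bool" where
  "inD0 p L A u g \<longleftrightarrow>
     u \<in> borel_measurable lebesgue \<and> g \<in> borel_measurable lebesgue \<and>
     (\<exists>phi dphi. (\<forall>n. C1c A (phi n) (dphi n)) \<and>
        ((\<lambda>n. \<integral>\<^sup>+x\<in>A. ennreal (L x * norm (dphi n x - g x) powr p) \<partial>lebesgue) \<longlonglongrightarrow> 0) \<and>
        (\<forall>S. compact S \<and> S \<subseteq> A \<longrightarrow>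
           ((\<lambda>n. \<integral>\<^sup>+x\<in>S. ennreal \<bar>phi n x - u x\<bar> \<partial>lebesgue) \<longlonglongrightarrow> 0)))"

text \<open>Weak solution of -div(L |grad u|^(p-2) grad u) = lam K |u|^(p-2) u in A, u = 0 on the boundary.\<close>
definition weak_solution :: "real \<Rightarrow> ('a::euclidean_space \<Rightarrow> real) \<Rightarrow> ('a \<Rightarrow> real) \<Rightarrow> 'a set \<Rightarrow> real \<Rightarrow> ('a \<Rightarrow> real) \<Rightarrow> bool" where
  "weak_solution p L K A lam u \<longleftrightarrow>
     (\<exists>g. inD0 p L A u g \<and>
        (\<forall>phi h. inD0 p L A phi h \<longrightarrow>
           (\<integral>x\<in>A. L x * norm (g x) powr (p - 2) * (g x \<bullet> h x) \<partial>lebesgue)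
             = lam * (\<integral>x\<in>A. K x * \<bar>u x\<bar> powr (p - 2) * u x * phi x \<partial>lebesgue)))"

text \<open>x^a for extended nonnegative x and a > 0 (infinity stays infinity).\<close>
definition epow :: "ennreal \<Rightarrow> real \<Rightarrow> ennreal" where
  "epow x a = (if x = \<infinity> then \<infinity> else ennreal (enn2real x powr a))"

definition condA :: "real \<Rightarrow> real \<Rightarrow> ereal \<Rightarrow> ('a::euclidean_space \<Rightarrow> real) \<Rightarrow> ('a \<Rightarrow> real) \<Rightarrow> bool" where
  "condA p R1 R2 L K \<longleftrightarrow>
     (\<exists>v w :: real \<Rightarrow> real.
        v \<in> borel_measurable lebesgue \<and> w \<in> borel_measurable lebesgue \<and>
        (AE r in lebesgue. r \<in> rint R1 R2 \<longrightarrow> 0 < v r \<and> 0 < w r) \<and>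
        (\<forall>a b. R1 < a \<and> a \<le> b \<and> ereal b < R2 \<longrightarrow>
           set_integrable lebesgue {a..b} (\<lambda>r. v r powr (-1 / (p - 1))) \<and>
           set_integrable lebesgue {a..b} w) \<and>
        (let rho = (\<lambda>r. r ^ (DIM('a) - 1) * v r);
             sigma = (\<lambda>r. r ^ (DIM('a) - 1) * w r);
             P = (\<lambda>r. min
                   (epow (\<integral>\<^sup>+t\<in>{R1<..<r}. ennreal (rho t powr (1 - p / (p - 1))) \<partial>lebesgue) (p - 1))
                   (epow (\<integral>\<^sup>+t\<in>rint r R2. ennreal (rho t powr (1 - p / (p - 1))) \<partial>lebesgue) (p - 1)))
         in (\<forall>r\<in>rint R1 R2. P r < \<infinity>) \<and>
            (\<integral>\<^sup>+r\<in>rint R1 R2. P r * ennreal (sigma r) \<partial>lebesgue) < \<infinity>) \<and>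
        (AE x in lebesgue. x \<in> annulus R1 R2 \<longrightarrow> v (norm x) \<le> L x \<and> \<bar>K x\<bar> \<le> w (norm x)))"

definition sob_conj :: "nat \<Rightarrow> real \<Rightarrow> ereal" where
  "sob_conj N a = (if a < real N then ereal (real N * a / (real N - a)) else \<infinity>)"

text \<open>f^(q/(q-p)) in L^1(A), with the convention that for q = p this means f in L^infinity(A).\<close>
definition exp_int :: "real \<Rightarrow> real \<Rightarrow> 'a::euclidean_space set \<Rightarrow> ('a \<Rightarrow> real) \<Rightarrow> bool" where
  "exp_int p q A f \<longleftrightarrow>
     (if q = p then f \<in> borel_measurable lebesgue \<and> (\<exists>M. AE x in lebesgue. x \<in> A \<longrightarrow> \<bar>f x\<bar> \<le> M)
      else set_integrable lebesgue A (\<lambda>x. \<bar>f x\<bar> powr (q / (q - p))))"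

end

theory Submission
  imports Defs
begin

text \<open>
  De Giorgi iteration. A function vanishing on the ball of radius R1 is represented by averaging
  the integral of its gradient over the segments to that ball; a linear change of variables on the
  slices of constant segment parameter t bounds their averages by powers of t, and Hoelder's
  inequality in t gives every subcritical Sobolev inequality on the larger ball. Combined with the
  integrability of \<open>L powr (- s)\<close> this controls the \<open>r\<close>-norm near the inner sphere by the weighted
  energy, for some r strictly above q. Testing the equation with a cutoff times a smoothed positive
  part of u - k bounds that energy by the q-norm of a lower truncation, so the truncated q-norms at
  increasing levels and decreasing radii satisfy a superlinear recursion and tend to zero. The
  outcome is the homogeneous bound with exponent mu = 1 / q.
\<close>

section \<open>Subcritical Sobolev inequality\<close>

text \<open>The obstacle is the weight. It is controlled only through integrability of
  \<open>L powr (- s)\<close>, so Hoelder's inequality recovers the gradient merely in the power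
  \<open>a = p * s / (s + 1)\<close>, which is below \<open>p\<close>. What is lost there has to be
  regained by the Sobolev gain from \<open>a\<close> to \<open>r\<close>; the strict inequality
  between \<open>q\<close> and the Sobolev conjugate of \<open>a\<close> leaves room for
  \<open>r > q\<close>, and since \<open>r\<close> stays below that conjugate no endpoint estimate
  enters. The annulus is not convex, but the approximating functions extend by zero into the inner
  ball, and the ball of radius \<open>R\<close> is convex; the inner ball also supplies a set of
  zeros of positive measure, which every point can be joined to. Integrability of
  \<open>\<bar>L\<bar> powr (q / (q - p))\<close> serves twice: it puts the truncated test function
  into the space, and it bounds the term in which the cutoff is differentiated. The condition on
  \<open>K\<close> bounds the right-hand side. Both errors are of order
  \<open>Y powr (p / q)\<close> in the given integral \<open>Y\<close>, and the Sobolev inequality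
  turns this into \<open>Y powr (r / q)\<close>. All estimates scale alike under multiplication of
  \<open>u\<close> by a positive constant, so one smallness threshold serves all solutions.\<close>

lemma nn_integral_Holder:
  fixes f g :: "'b \<Rightarrow> real"
  assumes [measurable]: "f \<in> borel_measurable M" "g \<in> borel_measurable M"
    and nonneg: "\<And>x. 0 \<le> f x" "\<And>x. 0 \<le> g x"
    and t: "0 \<le> t" "t \<le> 1" and pos: "0 < X" "0 < Y"
    and X: "(\<integral>\<^sup>+x. ennreal (f x) \<partial>M) \<le> ennreal X"
    and Y: "(\<integral>\<^sup>+x. ennreal (g x) \<partial>M) \<le> ennreal Y"
  shows "(\<integral>\<^sup>+x. ennreal (f x powr t * g x powr (1 - t)) \<partial>M) \<le> ennreal (X powr t * Y powr (1 - t))"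
proof -
  \<comment> \<open>Dividing \<open>f\<close> by \<open>X\<close> and \<open>g\<close> by
    \<open>Y\<close> normalises both integrals; the weighted arithmetic-geometric mean inequality,
    multiplied by \<open>Z\<close>, then integrates to \<open>Z\<close>. Positive real majorants
    keep real powers out of \<open>ennreal\<close> and allow the integrals themselves to
    vanish.\<close>
  define Z where "Z = X powr t * Y powr (1 - t)"
  have Z: "0 < Z" using pos by (simp add: Z_def)
  have le: "f x powr t * g x powr (1 - t) \<le> (Z * t / X) * f x + (Z * (1 - t) / Y) * g x" for x
  proof (cases "f x = 0 \<or> g x = 0")
    case True
    then show ?thesis using nonneg[of x] t Z pos by auto
  next
    case False
    then have "0 < f x" "0 < g x" using nonneg[of x] by auto
    then have "(f x / X) powr t * (g x / Y) powr (1 - t) \<le> t * (f x / X) + (1 - t) * (g x / Y)"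
      using t pos by (intro Youngs_inequality_0) auto
    then have "Z * ((f x / X) powr t * (g x / Y) powr (1 - t)) \<le> Z * (t * (f x / X) + (1 - t) * (g x / Y))"
      using Z by (intro mult_left_mono) auto
    moreover have "Z * ((f x / X) powr t * (g x / Y) powr (1 - t)) = f x powr t * g x powr (1 - t)"
      using \<open>0 < f x\<close> \<open>0 < g x\<close> pos by (simp add: Z_def powr_divide)
    ultimately show ?thesis by (simp add: algebra_simps)
  qed
  have "(\<integral>\<^sup>+x. ennreal (f x powr t * g x powr (1 - t)) \<partial>M)
      \<le> (\<integral>\<^sup>+x. ennreal (Z * t / X) * ennreal (f x) + ennreal (Z * (1 - t) / Y) * ennreal (g x) \<partial>M)"
    using le nonneg t Z pos
    by (intro nn_integral_mono) (simp flip: ennreal_mult' ennreal_plus add: ennreal_leI)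
  also have "\<dots> = ennreal (Z * t / X) * (\<integral>\<^sup>+x. ennreal (f x) \<partial>M) + ennreal (Z * (1 - t) / Y) * (\<integral>\<^sup>+x. ennreal (g x) \<partial>M)"
    by (simp add: nn_integral_add nn_integral_cmult)
  also have "\<dots> \<le> ennreal (Z * t / X) * ennreal X + ennreal (Z * (1 - t) / Y) * ennreal Y"
    by (intro add_mono mult_left_mono X Y) auto
  also have "\<dots> = ennreal (Z * t / X * X + Z * (1 - t) / Y * Y)"
    using t Z pos by (simp flip: ennreal_mult' ennreal_plus)
  also have "Z * t / X * X + Z * (1 - t) / Y * Y = Z"
    using pos by (simp add: field_simps)
  finally show ?thesis by (simp add: Z_def)
qed

section \<open>Scaling of integrals and integration along a segment\<close>

lemma nn_integral_lborel_affine: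
  fixes f :: "'a::euclidean_space \<Rightarrow> ennreal"
  assumes [measurable]: "f \<in> borel_measurable borel" and "0 < c"
  shows "(\<integral>\<^sup>+x. f (t + c *\<^sub>R x) \<partial>lborel) = ennreal (c powr (- real DIM('a))) * (\<integral>\<^sup>+x. f x \<partial>lborel)"
proof -
  have "(\<integral>\<^sup>+x. f x \<partial>lborel) = ennreal (c ^ DIM('a)) * (\<integral>\<^sup>+x. f (t + c *\<^sub>R x) \<partial>lborel)"
    using assms(2) by (subst lborel_affine[of c t])
      (simp_all add: nn_integral_density nn_integral_distr nn_integral_cmult)
  then have "ennreal (c powr (- real DIM('a))) * (\<integral>\<^sup>+x. f x \<partial>lborel)
    = ennreal (c powr (- real DIM('a)) * c ^ DIM('a)) * (\<integral>\<^sup>+x. f (t + c *\<^sub>R x) \<partial>lborel)"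
    using assms(2) by (simp add: ennreal_mult' mult.assoc)
  also have "c powr (- real DIM('a)) * c ^ DIM('a) = 1"
    using assms(2) by (simp add: powr_minus powr_realpow)
  finally show ?thesis by simp
qed

lemma nn_integral_powr_01:
  assumes "-1 < (c::real)"
  shows "(\<integral>\<^sup>+t. ennreal (indicator {0<..<1} t * t powr c) \<partial>lborel) \<le> ennreal (1 / (c + 1))"
proof -
  have "((\<lambda>x. x powr c) has_integral (1 powr (c+1) / (c+1))) {0..1}"
    using assms by (intro has_integral_powr_from_0) auto
  from nn_integral_has_integral_lebesgue[OF _ this]
  have "(\<integral>\<^sup>+x. ennreal (indicator {0..1} x * x powr c) \<partial>lborel) = ennreal (1 powr (c+1) / (c+1))"
    by simp
  moreover have "(\<integral>\<^sup>+t. ennreal (indicator {0<..<1} t * t powr c) \<partial>lborel)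
       \<le> (\<integral>\<^sup>+x. ennreal (indicator {0..1} x * x powr c) \<partial>lborel)"
    by (intro nn_integral_mono) (auto simp: indicator_def)
  ultimately show ?thesis by simp
qed

text \<open>Fundamental theorem of calculus along the segment from \<open>x\<close> to the zero
  \<open>y\<close>. The parameter is 0 at \<open>x\<close>, so a change of variables in
  \<open>y\<close> costs a negative power of \<open>t\<close>, singular only where the segment
  leaves \<open>x\<close>.\<close>

lemma C1_segment_bound:
  fixes \<phi> :: "'a::euclidean_space \<Rightarrow> real"
  assumes d: "\<And>x. (\<phi> has_derivative (\<lambda>h. d\<phi> x \<bullet> h)) (at x)" and c: "continuous_on UNIV d\<phi>"
    and "\<phi> y = 0" and "norm (x - y) \<le> \<rho>"
  shows "ennreal \<bar>\<phi> x\<bar> \<le> ennreal \<rho> * (\<integral>\<^sup>+t. ennreal (indicator {0<..<1} t * norm (d\<phi> ((1 - t) *\<^sub>R x + t *\<^sub>R y))) \<partial>lborel)"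
proof -
  define G where "G t = d\<phi> ((1 - t) *\<^sub>R x + t *\<^sub>R y) \<bullet> (y - x)" for t :: real
  have cG: "continuous_on UNIV G"
    unfolding G_def by (intro continuous_intros continuous_on_compose2[OF c]) auto
  have D: "((\<lambda>t. \<phi> ((1 - t) *\<^sub>R x + t *\<^sub>R y)) has_vector_derivative G t) (at t within S)" for t S
  proof -
    have "((\<lambda>t. \<phi> ((1 - t) *\<^sub>R x + t *\<^sub>R y)) has_derivative (\<lambda>h. d\<phi> ((1 - t) *\<^sub>R x + t *\<^sub>R y) \<bullet> (h *\<^sub>R (y - x)))) (at t)"
      by (rule has_derivative_compose[where g = \<phi>, OF _ d])
         (auto intro!: derivative_eq_intros simp: algebra_simps)
    then show ?thesis
      by (auto simp: has_vector_derivative_def G_def mult.commute intro: has_derivative_at_withinI)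
  qed
  have "(\<integral>t. indicator {0..1} t *\<^sub>R G t \<partial>lborel) = \<phi> ((1 - 1) *\<^sub>R x + 1 *\<^sub>R y) - \<phi> ((1 - 0) *\<^sub>R x + 0 *\<^sub>R y)"
    by (rule integral_FTC_atLeastAtMost) (auto intro: D continuous_on_subset[OF cG])
  then have eq: "(\<integral>t. indicator {0..1} t *\<^sub>R G t \<partial>lborel) = - \<phi> x" using \<open>\<phi> y = 0\<close> by simp
  have int: "integrable lborel (\<lambda>t. indicator {0..1} t *\<^sub>R G t)"
    using borel_integrable_compact[of "{0..1}" G] continuous_on_subset[OF cG] by auto
  have "ennreal \<bar>\<phi> x\<bar> \<le> (\<integral>\<^sup>+t. ennreal (norm (indicator {0..1} t *\<^sub>R G t)) \<partial>lborel)"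
    using integral_norm_bound_ennreal[OF int] eq by simp
  \<comment> \<open>The endpoints form a null set; on the open interval both \<open>t\<close> and
    \<open>1 - t\<close> are positive and can serve as scaling factors.\<close>
  also have "\<dots> = (\<integral>\<^sup>+t. ennreal (norm (indicator {0<..<1} t *\<^sub>R G t)) \<partial>lborel)"
  proof (rule nn_integral_cong_AE)
    have "AE t in lborel. t \<noteq> (0::real)" "AE t in lborel. t \<noteq> (1::real)" by (auto intro: AE_lborel_singleton)
    then show "AE t in lborel. ennreal (norm (indicator {0..1} t *\<^sub>R G t)) = ennreal (norm (indicator {0<..<1} t *\<^sub>R G t))"
      by eventually_elim (auto simp: indicator_def)
  qed
  also have "\<dots> \<le> (\<integral>\<^sup>+t. ennreal \<rho> * ennreal (indicator {0<..<1} t * norm (d\<phi> ((1 - t) *\<^sub>R x + t *\<^sub>R y))) \<partial>lborel)"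
  proof (rule nn_integral_mono)
    fix t :: real
    have "\<bar>G t\<bar> \<le> norm (d\<phi> ((1 - t) *\<^sub>R x + t *\<^sub>R y)) * norm (y - x)"
      unfolding G_def by (rule Cauchy_Schwarz_ineq2)
    also have "\<dots> \<le> norm (d\<phi> ((1 - t) *\<^sub>R x + t *\<^sub>R y)) * \<rho>"
      using assms(4) by (intro mult_left_mono) (auto simp: norm_minus_commute)
    finally show "ennreal (norm (indicator {0<..<1} t *\<^sub>R G t))
        \<le> ennreal \<rho> * ennreal (indicator {0<..<1} t * norm (d\<phi> ((1 - t) *\<^sub>R x + t *\<^sub>R y)))"
      by (subst ennreal_mult''[symmetric])
         (auto simp: indicator_def mult.commute intro!: ennreal_leI)
  qed
  also have "\<dots> = ennreal \<rho> * (\<integral>\<^sup>+t. ennreal (indicator {0<..<1} t * norm (d\<phi> ((1 - t) *\<^sub>R x + t *\<^sub>R y))) \<partial>lborel)"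
  proof (rule nn_integral_cmult)
    have "continuous_on UNIV (\<lambda>t. d\<phi> ((1 - t) *\<^sub>R x + t *\<^sub>R y))"
      by (intro continuous_intros continuous_on_compose2[OF c]) auto
    from borel_measurable_continuous_onI[OF this]
    have [measurable]: "(\<lambda>t. d\<phi> ((1 - t) *\<^sub>R x + t *\<^sub>R y)) \<in> borel_measurable borel" .
    show "(\<lambda>t. ennreal (indicator {0<..<1} t * norm (d\<phi> ((1 - t) *\<^sub>R x + t *\<^sub>R y)))) \<in> borel_measurable lborel"
      by measurable
  qed
  finally show ?thesis .
qed

section \<open>Averages over segments joining two sets\<close>

lemma powr_le_two_powr:
  assumes "1 / 2 \<le> (c::real)"
  shows "c powr (- real n) \<le> 2 powr real n"
proof -
  have "c powr (- real n) \<le> (1/2) powr (- real n)"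
    using assms by (intro powr_mono2') auto
  then show ?thesis by (simp add: powr_minus_divide powr_divide)
qed

text \<open>One of \<open>t\<close> and \<open>1 - t\<close> is at least 1/2. Substituting in the
  variable that carries this coefficient costs at most \<open>2 powr real DIM('a)\<close>, and the
  other variable contributes only the measure of its set. When both endpoints are integrated there
  is thus no singularity in \<open>t\<close>.\<close>

lemma segment_average_L1:
  fixes H :: "'a::euclidean_space \<Rightarrow> ennreal"
  assumes [measurable]: "H \<in> borel_measurable borel" "A \<in> sets borel" "B \<in> sets borel"
    and t: "0 < t" "t < 1"
  shows "(\<integral>\<^sup>+x. \<integral>\<^sup>+y. indicator A x * indicator B y * H ((1 - t) *\<^sub>R x + t *\<^sub>R y) \<partial>lborel \<partial>lborel)
      \<le> ennreal (2 powr real DIM('a)) * (emeasure lborel A + emeasure lborel B) * (\<integral>\<^sup>+x. H x \<partial>lborel)"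
proof (cases "1 / 2 \<le> t")
  case True
  have "(\<integral>\<^sup>+x. \<integral>\<^sup>+y. indicator A x * indicator B y * H ((1 - t) *\<^sub>R x + t *\<^sub>R y) \<partial>lborel \<partial>lborel)
      \<le> (\<integral>\<^sup>+x. \<integral>\<^sup>+y. indicator A x * H ((1 - t) *\<^sub>R x + t *\<^sub>R y) \<partial>lborel \<partial>lborel)"
    by (intro nn_integral_mono) (auto simp: indicator_def)
  also have "\<dots> = (\<integral>\<^sup>+x. indicator A x * (ennreal (t powr (- real DIM('a))) * (\<integral>\<^sup>+x. H x \<partial>lborel)) \<partial>lborel)"
    using t by (simp add: nn_integral_cmult nn_integral_lborel_affine)
  also have "\<dots> = emeasure lborel A * (ennreal (t powr (- real DIM('a))) * (\<integral>\<^sup>+x. H x \<partial>lborel))"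
    by (simp add: nn_integral_multc)
  also have "\<dots> \<le> (emeasure lborel A + emeasure lborel B) * (ennreal (2 powr real DIM('a)) * (\<integral>\<^sup>+x. H x \<partial>lborel))"
    using powr_le_two_powr[OF True] by (intro mult_mono order.refl ennreal_leI) auto
  finally show ?thesis by (simp add: mult_ac)
next
  case False
  have "(\<integral>\<^sup>+x. \<integral>\<^sup>+y. indicator A x * indicator B y * H ((1 - t) *\<^sub>R x + t *\<^sub>R y) \<partial>lborel \<partial>lborel)
     = (\<integral>\<^sup>+y. \<integral>\<^sup>+x. indicator A x * indicator B y * H ((1 - t) *\<^sub>R x + t *\<^sub>R y) \<partial>lborel \<partial>lborel)"
    by (rule lborel_pair.Fubini'[symmetric]) measurable
  also have "\<dots> \<le> (\<integral>\<^sup>+y. \<integral>\<^sup>+x. indicator B y * H (t *\<^sub>R y + (1 - t) *\<^sub>R x) \<partial>lborel \<partial>lborel)"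
    by (intro nn_integral_mono) (auto simp: indicator_def add.commute)
  also have "\<dots> = (\<integral>\<^sup>+x. indicator B x * (ennreal ((1 - t) powr (- real DIM('a))) * (\<integral>\<^sup>+x. H x \<partial>lborel)) \<partial>lborel)"
    using t by (simp add: nn_integral_cmult nn_integral_lborel_affine)
  also have "\<dots> = emeasure lborel B * (ennreal ((1 - t) powr (- real DIM('a))) * (\<integral>\<^sup>+x. H x \<partial>lborel))"
    by (simp add: nn_integral_multc)
  also have "\<dots> \<le> (emeasure lborel A + emeasure lborel B) * (ennreal (2 powr real DIM('a)) * (\<integral>\<^sup>+x. H x \<partial>lborel))"
    using powr_le_two_powr[of "1 - t"] False by (intro mult_mono order.refl ennreal_leI) auto
  finally show ?thesis by (simp add: mult_ac)
qed

text \<open>Here the centre \<open>c\<close> is fixed, so only \<open>y\<close> can absorb the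
  change of variables, at the price of \<open>t powr (- real DIM('a))\<close>. Lowering the power
  from \<open>a\<close> to \<open>e\<close> on the set \<open>B\<close> of finite measure raises
  this price to the power \<open>e / a\<close>, which makes it affordable in the later integration
  over \<open>t\<close>.\<close>

lemma segment_average_powr:
  fixes F :: "'a::euclidean_space \<Rightarrow> real"
  assumes [measurable]: "F \<in> borel_measurable borel" "B \<in> sets borel"
    and fin: "emeasure lborel B \<noteq> \<infinity>"
    and F: "\<And>x. 0 \<le> F x" and t: "0 < t" and e: "0 \<le> e" "e \<le> a" and a: "0 < a" and X: "0 < X"
    and le: "(\<integral>\<^sup>+x. ennreal (F x powr a) \<partial>lborel) \<le> ennreal X"
  shows "(\<integral>\<^sup>+y. indicator B y * ennreal (F (c + t *\<^sub>R y) powr e) \<partial>lborel)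
     \<le> ennreal ((measure lborel B + 1) * X powr (e / a) * t powr (- real DIM('a) * e / a))"
proof -
  \<comment> \<open>T is the level that balances the two terms of \<open>pw\<close> after integration.\<close>
  define T where "T = (t powr (- real DIM('a)) * X) powr (1 / a)"
  have T: "0 < T" using t X by (simp add: T_def)
  have Ta: "T powr a = t powr (- real DIM('a)) * X" using t X a by (simp add: T_def powr_powr)
  have Te: "T powr e = X powr (e / a) * t powr (- real DIM('a) * e / a)"
    using t X a by (simp add: T_def powr_powr powr_mult mult.commute)
  have pw: "F z powr e \<le> T powr e + T powr (e - a) * F z powr a" for z
  proof (cases "F z \<le> T")
    case True
    then have "F z powr e \<le> T powr e" using F e by (intro powr_mono2) auto
    then show ?thesis by (simp add: add_increasing2)
  next
    case False
    then have "F z powr (e - a) \<le> T powr (e - a)" using T e by (intro powr_mono2') auto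
    then have "F z powr (e - a) * F z powr a \<le> T powr (e - a) * F z powr a" by (intro mult_right_mono) auto
    also have "F z powr (e - a) * F z powr a = F z powr e" by (simp flip: powr_add)
    finally show ?thesis by (simp add: add_increasing)
  qed
  have "(\<integral>\<^sup>+y. indicator B y * ennreal (F (c + t *\<^sub>R y) powr e) \<partial>lborel)
     \<le> (\<integral>\<^sup>+y. ennreal (T powr e) * indicator B y + ennreal (T powr (e - a)) * ennreal (F (c + t *\<^sub>R y) powr a) \<partial>lborel)"
    using pw by (intro nn_integral_mono)
      (auto simp: indicator_def simp flip: ennreal_mult' ennreal_plus intro: ennreal_leI)
  also have "\<dots> = ennreal (T powr e) * emeasure lborel B + ennreal (T powr (e - a)) *
       (ennreal (t powr (- real DIM('a))) * (\<integral>\<^sup>+x. ennreal (F x powr a) \<partial>lborel))"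
    using t nn_integral_lborel_affine[of "\<lambda>x. ennreal (F x powr a)" t c]
    by (simp add: nn_integral_add nn_integral_cmult)
  also have "\<dots> \<le> ennreal (T powr e) * ennreal (measure lborel B) + ennreal (T powr (e - a)) *
       (ennreal (t powr (- real DIM('a))) * ennreal X)"
    using fin by (intro add_mono mult_left_mono le) (auto simp: emeasure_eq_ennreal_measure)
  also have "\<dots> = ennreal (T powr e * measure lborel B + T powr (e - a) * T powr a)"
    using X by (simp add: Ta ennreal_mult ennreal_plus)
  also have "T powr (e - a) * T powr a = T powr e" by (simp flip: powr_add)
  finally show ?thesis by (simp add: Te algebra_simps)
qed

text \<open>The slice bound integrated against \<open>t powr g\<close>; the last hypothesis says
  that the resulting power of \<open>t\<close> is integrable at 0. The bound does not depend on
  \<open>x\<close>, as a Schur test requires of one of its two factors.\<close>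

lemma segment_average_kernel:
  fixes F :: "'a::euclidean_space \<Rightarrow> real"
  assumes [measurable]: "F \<in> borel_measurable borel" "B \<in> sets borel"
    and fin: "emeasure lborel B \<noteq> \<infinity>"
    and F: "\<And>x. 0 \<le> F x" and e: "0 \<le> e" "e \<le> a" and a: "0 < a" and X: "0 < X"
    and le: "(\<integral>\<^sup>+x. ennreal (F x powr a) \<partial>lborel) \<le> ennreal X"
    and g: "-1 < g - real DIM('a) * e / a"
  shows "(\<integral>\<^sup>+(t,y). ennreal (indicator {0<..<1} t * indicator B y * t powr g * F ((1 - t) *\<^sub>R x + t *\<^sub>R y) powr e) \<partial>(lborel \<Otimes>\<^sub>M lborel))
     \<le> ennreal ((measure lborel B + 1) / (g - real DIM('a) * e / a + 1) * X powr (e / a))"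
proof -
  define V where "V = (measure lborel B + 1) * X powr (e / a)"
  have V: "0 \<le> V" by (simp add: V_def)
  have "(\<integral>\<^sup>+(t,y). ennreal (indicator {0<..<1} t * indicator B y * t powr g * F ((1 - t) *\<^sub>R x + t *\<^sub>R y) powr e) \<partial>(lborel \<Otimes>\<^sub>M lborel))
    = (\<integral>\<^sup>+t. \<integral>\<^sup>+y. ennreal (indicator {0<..<1} t * indicator B y * t powr g * F ((1 - t) *\<^sub>R x + t *\<^sub>R y) powr e) \<partial>lborel \<partial>lborel)"
    by (simp add: lborel.nn_integral_fst[symmetric])
  also have "\<dots> \<le> (\<integral>\<^sup>+t. ennreal V * ennreal (indicator {0<..<1} t * t powr (g - real DIM('a) * e / a)) \<partial>lborel)"
  proof (rule nn_integral_mono)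
    fix t :: real
    show "(\<integral>\<^sup>+y. ennreal (indicator {0<..<1} t * indicator B y * t powr g * F ((1 - t) *\<^sub>R x + t *\<^sub>R y) powr e) \<partial>lborel)
      \<le> ennreal V * ennreal (indicator {0<..<1} t * t powr (g - real DIM('a) * e / a))"
    proof (cases "t \<in> {0<..<1}")
      case True
      then have t: "0 < t" by auto
      have "(\<integral>\<^sup>+y. ennreal (indicator {0<..<1} t * indicator B y * t powr g * F ((1 - t) *\<^sub>R x + t *\<^sub>R y) powr e) \<partial>lborel)
        = (\<integral>\<^sup>+y. ennreal (t powr g) * (indicator B y * ennreal (F ((1 - t) *\<^sub>R x + t *\<^sub>R y) powr e)) \<partial>lborel)"
        using True by (intro nn_integral_cong) (auto simp: indicator_def ennreal_mult')
      also have "\<dots> = ennreal (t powr g) * (\<integral>\<^sup>+y. indicator B y * ennreal (F ((1 - t) *\<^sub>R x + t *\<^sub>R y) powr e) \<partial>lborel)"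
        by (intro nn_integral_cmult) measurable
      also have "\<dots> \<le> ennreal (t powr g) * ennreal ((measure lborel B + 1) * X powr (e / a) * t powr (- real DIM('a) * e / a))"
        by (intro mult_left_mono segment_average_powr assms t) auto
      also have "\<dots> = ennreal V * ennreal (t powr (g - real DIM('a) * e / a))"
      proof -
        have eq: "t powr g * t powr (- real DIM('a) * e / a) = t powr (g - real DIM('a) * e / a)"
          by (simp flip: powr_add)
        have "t powr g * ((measure lborel B + 1) * X powr (e / a) * t powr (- real DIM('a) * e / a)) = V * t powr (g - real DIM('a) * e / a)"
          unfolding eq[symmetric] by (simp only: V_def mult_ac)
        then show ?thesis using V X by (subst (1 2) ennreal_mult'[symmetric]) (auto simp only: powr_ge_zero)
      qed
      finally show ?thesis using True by simp
    qed simp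
  qed
  also have "\<dots> = ennreal V * (\<integral>\<^sup>+t. ennreal (indicator {0<..<1} t * t powr (g - real DIM('a) * e / a)) \<partial>lborel)"
    by (intro nn_integral_cmult) measurable
  also have "\<dots> \<le> ennreal V * ennreal (1 / (g - real DIM('a) * e / a + 1))"
    by (intro mult_left_mono nn_integral_powr_01 g) auto
  also have "\<dots> = ennreal ((measure lborel B + 1) / (g - real DIM('a) * e / a + 1) * X powr (e / a))"
    using V by (simp flip: ennreal_mult' add: V_def)
  finally show ?thesis .
qed

text \<open>The second factor of the Schur test. As \<open>x\<close> is integrated too, the slices
  are bounded uniformly in \<open>t\<close>, so the weight itself only has to be integrable.\<close>

lemma segment_average_integral:
  fixes F :: "'a::euclidean_space \<Rightarrow> real"
  assumes [measurable]: "F \<in> borel_measurable borel" "A \<in> sets borel" "B \<in> sets borel"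
    and fin: "emeasure lborel A \<noteq> \<infinity>" "emeasure lborel B \<noteq> \<infinity>"
    and X: "0 < X" and le: "(\<integral>\<^sup>+x. ennreal (F x powr a) \<partial>lborel) \<le> ennreal X"
    and g: "-1 < g"
  shows "(\<integral>\<^sup>+x. indicator A x * (\<integral>\<^sup>+(t,y). ennreal (indicator {0<..<1} t * indicator B y * t powr g * F ((1 - t) *\<^sub>R x + t *\<^sub>R y) powr a) \<partial>(lborel \<Otimes>\<^sub>M lborel)) \<partial>lborel)
     \<le> ennreal (2 powr real DIM('a) * (measure lborel A + measure lborel B) / (g + 1) * X)"
proof -
  define V where "V = 2 powr real DIM('a) * (measure lborel A + measure lborel B) * X"
  have V: "0 \<le> V" using X by (simp add: V_def)
  have "(\<integral>\<^sup>+x. indicator A x * (\<integral>\<^sup>+(t,y). ennreal (indicator {0<..<1} t * indicator B y * t powr g * F ((1 - t) *\<^sub>R x + t *\<^sub>R y) powr a) \<partial>(lborel \<Otimes>\<^sub>M lborel)) \<partial>lborel)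
    = (\<integral>\<^sup>+x. \<integral>\<^sup>+t. \<integral>\<^sup>+y. indicator A x * ennreal (indicator {0<..<1} t * indicator B y * t powr g * F ((1 - t) *\<^sub>R x + t *\<^sub>R y) powr a) \<partial>lborel \<partial>lborel \<partial>lborel)"
    by (subst lborel.nn_integral_fst[symmetric]) (measurable, simp add: nn_integral_cmult)
  also have "\<dots> = (\<integral>\<^sup>+t. \<integral>\<^sup>+x. \<integral>\<^sup>+y. indicator A x * ennreal (indicator {0<..<1} t * indicator B y * t powr g * F ((1 - t) *\<^sub>R x + t *\<^sub>R y) powr a) \<partial>lborel \<partial>lborel \<partial>lborel)"
    by (rule lborel_pair.Fubini'[symmetric]) measurable
  also have "\<dots> \<le> (\<integral>\<^sup>+t. ennreal V * ennreal (indicator {0<..<1} t * t powr g) \<partial>lborel)"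
  proof (rule nn_integral_mono)
    fix t :: real
    show "(\<integral>\<^sup>+x. \<integral>\<^sup>+y. indicator A x * ennreal (indicator {0<..<1} t * indicator B y * t powr g * F ((1 - t) *\<^sub>R x + t *\<^sub>R y) powr a) \<partial>lborel \<partial>lborel)
      \<le> ennreal V * ennreal (indicator {0<..<1} t * t powr g)"
    proof (cases "t \<in> {0<..<1}")
      case True
      then have t: "0 < t" "t < 1" by auto
      have "(\<integral>\<^sup>+x. \<integral>\<^sup>+y. indicator A x * ennreal (indicator {0<..<1} t * indicator B y * t powr g * F ((1 - t) *\<^sub>R x + t *\<^sub>R y) powr a) \<partial>lborel \<partial>lborel)
        = (\<integral>\<^sup>+x. \<integral>\<^sup>+y. ennreal (t powr g) * (indicator A x * indicator B y * ennreal (F ((1 - t) *\<^sub>R x + t *\<^sub>R y) powr a)) \<partial>lborel \<partial>lborel)"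
        using True by (intro nn_integral_cong) (auto simp: indicator_def ennreal_mult')
      also have "\<dots> = ennreal (t powr g) * (\<integral>\<^sup>+x. \<integral>\<^sup>+y. indicator A x * indicator B y * ennreal (F ((1 - t) *\<^sub>R x + t *\<^sub>R y) powr a) \<partial>lborel \<partial>lborel)"
        by (simp add: nn_integral_cmult)
      also have "\<dots> \<le> ennreal (t powr g) * (ennreal (2 powr real DIM('a)) * (emeasure lborel A + emeasure lborel B) * (\<integral>\<^sup>+x. ennreal (F x powr a) \<partial>lborel))"
        using t by (intro mult_left_mono segment_average_L1[of "\<lambda>x. ennreal (F x powr a)"]) auto
      also have "\<dots> \<le> ennreal (t powr g) * (ennreal (2 powr real DIM('a)) * (emeasure lborel A + emeasure lborel B) * ennreal X)"
        by (intro mult_left_mono le) auto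
      also have "\<dots> = ennreal V * ennreal (t powr g)"
        using fin X by (simp add: emeasure_eq_ennreal_measure V_def ennreal_mult ennreal_plus mult_ac flip: ennreal_plus)
      finally show ?thesis using True by simp
    qed simp
  qed
  also have "\<dots> = ennreal V * (\<integral>\<^sup>+t. ennreal (indicator {0<..<1} t * t powr g) \<partial>lborel)"
    by (intro nn_integral_cmult) measurable
  also have "\<dots> \<le> ennreal V * ennreal (1 / (g + 1))"
    by (intro mult_left_mono nn_integral_powr_01 g) auto
  also have "\<dots> = ennreal (2 powr real DIM('a) * (measure lborel A + measure lborel B) / (g + 1) * X)"
    using V by (simp flip: ennreal_mult' add: V_def)
  finally show ?thesis .
qed

text \<open>Hoelder's inequality with exponents \<open>r\<close> and \<open>r / (r - 1)\<close>,
  solved for the \<open>r\<close>-th power of a lower bound \<open>c\<close>. In this form the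
  integral of \<open>f\<close> may be infinite and can afterwards be integrated in a further
  variable.\<close>

lemma nn_integral_Holder_le:
  fixes f g :: "'b \<Rightarrow> real"
  assumes [measurable]: "f \<in> borel_measurable M" "g \<in> borel_measurable M"
    and nonneg: "\<And>x. 0 \<le> f x" "\<And>x. 0 \<le> g x"
    and r: "1 < r" and c: "0 \<le> c" and Y: "0 < Y"
    and le: "ennreal c \<le> (\<integral>\<^sup>+x. ennreal (f x powr (1 / r) * g x powr (1 - 1 / r)) \<partial>M)"
    and g: "(\<integral>\<^sup>+x. ennreal (g x) \<partial>M) \<le> ennreal Y"
  shows "ennreal (c powr r) \<le> ennreal (Y powr (r - 1)) * (\<integral>\<^sup>+x. ennreal (f x) \<partial>M)"
proof (cases "(\<integral>\<^sup>+x. ennreal (f x) \<partial>M)")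
  case top
  then show ?thesis using Y by (simp add: ennreal_mult_top)
next
  case (real X)
  \<comment> \<open>The integral \<open>X\<close> may be 0, whereas a positive majorant is wanted.
    It is enlarged by \<open>d\<close>, chosen so that the enlargement contributes exactly
    \<open>z\<close> to the final bound.\<close>
  have "c powr r \<le> Y powr (r - 1) * X + z" if z: "0 < z" for z
  proof -
    define d where "d = z / Y powr (r - 1)"
    have d: "0 < d" using z Y by (simp add: d_def)
    have "(\<integral>\<^sup>+x. ennreal (f x powr (1 / r) * g x powr (1 - 1 / r)) \<partial>M)
        \<le> ennreal ((X + d) powr (1 / r) * Y powr (1 - 1 / r))"
      using real r Y d by (intro nn_integral_Holder nonneg g) (auto intro!: ennreal_leI)
    with le have "ennreal c \<le> ennreal ((X + d) powr (1 / r) * Y powr (1 - 1 / r))" by (rule order.trans)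
    then have "c \<le> (X + d) powr (1 / r) * Y powr (1 - 1 / r)" by (subst (asm) ennreal_le_iff) auto
    then have "c powr r \<le> ((X + d) powr (1 / r) * Y powr (1 - 1 / r)) powr r"
      using c r by (intro powr_mono2) auto
    also have "\<dots> = (X + d) * Y powr (r - 1)"
      using r real d Y by (simp add: powr_mult powr_powr algebra_simps)
    also have "\<dots> = Y powr (r - 1) * X + z" using Y by (simp add: d_def field_simps)
    finally show ?thesis .
  qed
  then have "c powr r \<le> Y powr (r - 1) * X" by (rule field_le_epsilon)
  then show ?thesis using real by (simp flip: ennreal_mult' add: ennreal_leI)
qed

text \<open>A Schur test over the pairs \<open>(t, y)\<close>. The function \<open>u\<close> is only
  assumed to be dominated by the averages, so the measurability of the averages in \<open>x\<close>
  does not enter the statement, and \<open>C\<close> is fixed before \<open>F\<close>,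
  \<open>X\<close> and \<open>u\<close>.\<close>

lemma segment_average_strong_type:
  fixes A B :: "'a::euclidean_space set"
  assumes [measurable]: "A \<in> sets borel" "B \<in> sets borel"
    and fin: "emeasure lborel A \<noteq> \<infinity>" "emeasure lborel B \<noteq> \<infinity>"
    and ar: "1 \<le> a" "a \<le> r" "1 < r" and sub: "real DIM('a) * (1 / a - 1 / r) < 1"
  shows "\<exists>C>0. \<forall>F X. F \<in> borel_measurable borel \<longrightarrow> (\<forall>x. 0 \<le> F x) \<longrightarrow> 0 < X \<longrightarrow>
     (\<integral>\<^sup>+x. ennreal (F x powr a) \<partial>lborel) \<le> ennreal X \<longrightarrow>
     (\<forall>u. (\<forall>x::'a\<in>A. ennreal \<bar>u x\<bar> \<le> (\<integral>\<^sup>+(t,y). ennreal (indicator {0<..<1} t * indicator B y * F ((1 - t) *\<^sub>R x + t *\<^sub>R y)) \<partial>(lborel \<Otimes>\<^sub>M lborel))) \<longrightarrow>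
       (\<integral>\<^sup>+x. indicator A x * ennreal (\<bar>u x\<bar> powr r) \<partial>lborel) \<le> ennreal (C * X powr (r / a)))"
proof -
  \<comment> \<open>Hoelder splits F into \<open>(t powr b1 * F powr a) powr (1 / r)\<close> and
    \<open>(t powr g * F powr e) powr (1 - 1 / r)\<close>. The x-integral of the first factor needs \<open>-1 < b1\<close>, the
    uniform bound on the second one needs \<open>b1 < b2\<close>; subcriticality says exactly \<open>-1 < b2\<close>.\<close>
  define N where "N = real DIM('a)"
  \<comment> \<open>Solves \<open>a / r + e * (1 - 1 / r) = 1\<close>, so that the two factors
    recombine to the first power of \<open>F\<close>; \<open>e \<le> a\<close> amounts to
    \<open>1 \<le> a\<close>.\<close>
  define e where "e = (r - a) / (r - 1)"
  have e: "0 \<le> e" "e \<le> a"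
  proof -
    show "0 \<le> e" using ar by (simp add: e_def)
    have "1 * r \<le> a * r" using ar by (intro mult_right_mono) auto
    then have "r - a \<le> a * (r - 1)" by (simp add: algebra_simps)
    then show "e \<le> a" using ar by (simp add: e_def field_simps)
  qed
  define b2 where "b2 = (r - 1) - N * (r - a) / a"
  have b2: "-1 < b2"
  proof -
    have "N * (1 / a - 1 / r) * r < 1 * r" using sub ar by (intro mult_strict_right_mono) (auto simp: N_def)
    moreover have "N * (1 / a - 1 / r) * r = N * (r - a) / a" using ar by (simp add: field_simps)
    ultimately show ?thesis by (simp add: b2_def)
  qed
  define b1 where "b1 = (b2 - 1) / 2"
  have b1: "-1 < b1" "b1 < b2" using b2 by (auto simp: b1_def)
  \<comment> \<open>Forced by \<open>b1 / r + g * (1 - 1 / r) = 0\<close>: the auxiliary powers of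
    \<open>t\<close> have to cancel in the product of the two factors.\<close>
  define g where "g = - b1 / (r - 1)"
  have Ne: "N * e / a * (r - 1) = N * (r - a) / a" using ar by (simp add: e_def)
  have g: "-1 < g - N * e / a"
  proof -
    have "(N * e / a - 1) * (r - 1) = N * (r - a) / a - (r - 1)" by (simp only: left_diff_distrib Ne mult_1)
    also have "\<dots> < - b1" using b1 by (simp add: b2_def)
    finally have "(N * e / a - 1) * (r - 1) < - b1" .
    then have "N * e / a - 1 < g" unfolding g_def using ar by (subst pos_less_divide_eq) auto
    then show ?thesis by simp
  qed
  define c2 where "c2 = (measure lborel B + 1) / (g - N * e / a + 1)"
  have c2: "0 < c2" using g by (simp add: c2_def add_nonneg_pos)
  define c1 where "c1 = 2 powr N * (measure lborel A + measure lborel B) / (b1 + 1)"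
  have c1: "0 \<le> c1" using b1 by (simp add: c1_def)
  \<comment> \<open>The summand 1 keeps \<open>C\<close> positive, since \<open>c1\<close> vanishes
    when \<open>A\<close> and \<open>B\<close> are null sets.\<close>
  define C where "C = c2 powr (r - 1) * c1 + 1"
  have "0 < C" using c1 by (simp add: C_def add_nonneg_pos)
  moreover have "(\<integral>\<^sup>+x. indicator A x * ennreal (\<bar>u x\<bar> powr r) \<partial>lborel) \<le> ennreal (C * X powr (r / a))"
    if [measurable]: "F \<in> borel_measurable borel" and F: "\<And>x. 0 \<le> F x" and X: "0 < X"
      and FX: "(\<integral>\<^sup>+x. ennreal (F x powr a) \<partial>lborel) \<le> ennreal X"
      and u: "\<And>x. x \<in> A \<Longrightarrow> ennreal \<bar>u x\<bar> \<le> (\<integral>\<^sup>+(t,y). ennreal (indicator {0<..<1} t * indicator B y * F ((1 - t) *\<^sub>R x + t *\<^sub>R y)) \<partial>(lborel \<Otimes>\<^sub>M lborel))"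
    for F :: "'a \<Rightarrow> real" and X u
  proof -
    define f1 where "f1 x = (\<lambda>(t,y). indicator {0<..<1} t * indicator B y * t powr b1 * F ((1 - t) *\<^sub>R x + t *\<^sub>R y) powr a)" for x
    define g1 where "g1 x = (\<lambda>(t,y). indicator {0<..<1} t * indicator B y * t powr g * F ((1 - t) *\<^sub>R x + t *\<^sub>R y) powr e)" for x
    have m1: "f1 x \<in> borel_measurable (lborel \<Otimes>\<^sub>M lborel)" for x unfolding f1_def by measurable
    have m2: "g1 x \<in> borel_measurable (lborel \<Otimes>\<^sub>M lborel)" for x
      unfolding g1_def by simp
    define Y where "Y = c2 * X powr (e / a)"
    have Y: "0 < Y" using c2 X by (simp add: Y_def)
    have split: "indicator {0<..<1} t * indicator B y * F ((1 - t) *\<^sub>R x + t *\<^sub>R y) = f1 x (t,y) powr (1 / r) * g1 x (t,y) powr (1 - 1 / r)" for t y x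
    proof (cases "t \<in> {0<..<1} \<and> y \<in> B \<and> F ((1 - t) *\<^sub>R x + t *\<^sub>R y) \<noteq> 0")
      case True
      define z where "z = F ((1 - t) *\<^sub>R x + t *\<^sub>R y)"
      have z: "0 < z" and t: "0 < t" using True F[of "((1 - t) *\<^sub>R x + t *\<^sub>R y)"] by (auto simp: z_def)
      have "f1 x (t,y) powr (1 / r) * g1 x (t,y) powr (1 - 1 / r)
        = t powr (b1 * (1 / r)) * z powr (a * (1 / r)) * (t powr (g * (1 - 1 / r)) * z powr (e * (1 - 1 / r)))"
        using True by (simp add: f1_def g1_def powr_mult powr_powr flip: z_def)
      also have "\<dots> = t powr (b1 * (1 / r) + g * (1 - 1 / r)) * z powr (a * (1 / r) + e * (1 - 1 / r))"
        by (simp only: powr_add mult_ac)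
      also have "b1 * (1 / r) + g * (1 - 1 / r) = 0"
        using ar by (simp add: g_def field_simps)
      also have "a * (1 / r) + e * (1 - 1 / r) = 1"
      proof -
        have "e * (1 - 1 / r) = (r - a) / r" using ar by (simp add: e_def field_simps)
        then show ?thesis using ar by (simp add: field_simps)
      qed
      finally show ?thesis using True t z by (simp add: z_def)
    qed (auto simp: f1_def)
    have "(\<integral>\<^sup>+x. indicator A x * ennreal (\<bar>u x\<bar> powr r) \<partial>lborel)
       \<le> (\<integral>\<^sup>+x. ennreal (Y powr (r - 1)) * (indicator A x * (\<integral>\<^sup>+ty. ennreal (f1 x ty) \<partial>(lborel \<Otimes>\<^sub>M lborel))) \<partial>lborel)"
    proof (rule nn_integral_mono)
      fix x
      show "indicator A x * ennreal (\<bar>u x\<bar> powr r)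
        \<le> ennreal (Y powr (r - 1)) * (indicator A x * (\<integral>\<^sup>+ty. ennreal (f1 x ty) \<partial>(lborel \<Otimes>\<^sub>M lborel)))"
      proof (cases "x \<in> A")
        case True
        have "ennreal (\<bar>u x\<bar> powr r) \<le> ennreal (Y powr (r - 1)) * (\<integral>\<^sup>+ty. ennreal (f1 x ty) \<partial>(lborel \<Otimes>\<^sub>M lborel))"
        proof (rule nn_integral_Holder_le[OF m1 m2[of x]])
          show "ennreal \<bar>u x\<bar> \<le> (\<integral>\<^sup>+ty. ennreal (f1 x ty powr (1 / r) * g1 x ty powr (1 - 1 / r)) \<partial>(lborel \<Otimes>\<^sub>M lborel))"
            using u[OF True] unfolding split by (simp add: case_prod_unfold)
          show "(\<integral>\<^sup>+ty. ennreal (g1 x ty) \<partial>(lborel \<Otimes>\<^sub>M lborel)) \<le> ennreal Y"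
            using segment_average_kernel[of F B e a X g x] e F X FX fin g ar
            by (simp add: g1_def Y_def c2_def N_def case_prod_unfold)
        qed (use ar Y in \<open>auto simp: f1_def g1_def\<close>)
        then show ?thesis using True by simp
      qed simp
    qed
    also have "\<dots> = ennreal (Y powr (r - 1)) * (\<integral>\<^sup>+x. indicator A x * (\<integral>\<^sup>+ty. ennreal (f1 x ty) \<partial>(lborel \<Otimes>\<^sub>M lborel)) \<partial>lborel)"
      unfolding f1_def by (intro nn_integral_cmult) measurable
    also have "\<dots> \<le> ennreal (Y powr (r - 1)) * ennreal (c1 * X)"
      using segment_average_integral[of F A B X a b1] X FX fin b1
      by (intro mult_left_mono) (auto simp: f1_def c1_def N_def case_prod_unfold)
    also have "\<dots> = ennreal (c2 powr (r - 1) * c1 * X powr (r / a))"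
    proof -
      have "X powr (e / a * (r - 1)) * X = X powr (e / a * (r - 1) + 1)" using X by (simp add: powr_add)
      also have "e / a * (r - 1) + 1 = r / a" using ar by (simp add: e_def field_simps)
      finally show ?thesis
        using c2 c1 X by (simp flip: ennreal_mult' add: Y_def powr_mult powr_powr mult_ac)
    qed
    also have "\<dots> \<le> ennreal (C * X powr (r / a))"
      by (intro ennreal_leI) (simp add: C_def algebra_simps)
    finally show ?thesis .
  qed
  ultimately show ?thesis by blast
qed

text \<open>Every \<open>y\<close> in the inner ball is a zero of the function, so the segment bound
  may be averaged over all of them; this spreads the gradient over a solid region and brings the
  averages of the previous lemmas into play. No boundary condition is imposed on the sphere of
  radius \<open>R\<close>.\<close>

lemma sobolev_vanishing_on_ball:
  assumes R: "0 < R1" "R1 \<le> R"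
    and ar: "1 \<le> a" "a \<le> r" "1 < r" and sub: "real DIM('a::euclidean_space) * (1 / a - 1 / r) < 1"
  shows "\<exists>C>0. \<forall>(\<phi>::'a \<Rightarrow> real) d\<phi> X. (\<forall>x. (\<phi> has_derivative (\<lambda>h. d\<phi> x \<bullet> h)) (at x)) \<longrightarrow> continuous_on UNIV d\<phi> \<longrightarrow>
     (\<forall>x\<in>ball 0 R1. \<phi> x = 0) \<longrightarrow> 0 < X \<longrightarrow>
     (\<integral>\<^sup>+x. indicator (ball 0 R) x * ennreal (norm (d\<phi> x) powr a) \<partial>lborel) \<le> ennreal X \<longrightarrow>
     (\<integral>\<^sup>+x. indicator (ball 0 R) x * ennreal (\<bar>\<phi> x\<bar> powr r) \<partial>lborel) \<le> ennreal (C * X powr (r / a))"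
proof -
  define A where "A = (ball 0 R :: 'a set)"
  define B where "B = (ball 0 R1 :: 'a set)"
  have fin: "emeasure lborel A \<noteq> \<infinity>" "emeasure lborel B \<noteq> \<infinity>"
    unfolding A_def B_def using emeasure_bounded_finite[of "ball 0 _"] by (auto simp: less_top)
  have BA: "B \<subseteq> A" using R by (auto simp: A_def B_def)
  have [measurable]: "A \<in> sets borel" "B \<in> sets borel" by (auto simp: A_def B_def)
  define v where "v = measure lborel B"
  have v: "0 < v"
    using content_ball_pos[of R1 "0::'a"] R by (simp add: v_def B_def)
  obtain C where C: "0 < C" and CC: "\<And>F X u. F \<in> borel_measurable borel \<Longrightarrow> (\<forall>x. 0 \<le> F x) \<Longrightarrow> 0 < X \<Longrightarrow>
     (\<integral>\<^sup>+x. ennreal (F x powr a) \<partial>lborel) \<le> ennreal X \<Longrightarrow>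
     (\<forall>x::'a\<in>A. ennreal \<bar>u x\<bar> \<le> (\<integral>\<^sup>+(t,y). ennreal (indicator {0<..<1} t * indicator B y * F ((1 - t) *\<^sub>R x + t *\<^sub>R y)) \<partial>(lborel \<Otimes>\<^sub>M lborel))) \<Longrightarrow>
       (\<integral>\<^sup>+x. indicator A x * ennreal (\<bar>u x\<bar> powr r) \<partial>lborel) \<le> ennreal (C * X powr (r / a))"
    using segment_average_strong_type[of A B a r] ar sub fin by auto
  have "(\<integral>\<^sup>+x. indicator A x * ennreal (\<bar>\<phi> x\<bar> powr r) \<partial>lborel) \<le> ennreal (C * ((2 * R / v) powr r) * X powr (r / a))"
    if d: "\<And>x. (\<phi> has_derivative (\<lambda>h. d\<phi> x \<bullet> h)) (at x)" and c: "continuous_on UNIV d\<phi>"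
      and z: "\<And>x. x \<in> B \<Longrightarrow> \<phi> x = 0" and X: "0 < X"
      and le: "(\<integral>\<^sup>+x. indicator A x * ennreal (norm (d\<phi> x) powr a) \<partial>lborel) \<le> ennreal X"
    for \<phi> :: "'a \<Rightarrow> real" and d\<phi> X
  proof -
    have [measurable]: "d\<phi> \<in> borel_measurable borel" using c by (rule borel_measurable_continuous_onI)
    \<comment> \<open>Segments between points of the convex set \<open>A\<close> stay in
      \<open>A\<close>, so the indicator loses nothing along them, while it turns the gradient bound
      on the ball into one on the whole space.\<close>
    define F where "F x = indicator A x * norm (d\<phi> x)" for x
    have [measurable]: "F \<in> borel_measurable borel" unfolding F_def by measurable
    \<comment> \<open>Integrating the segment bound over \<open>y\<close> in \<open>B\<close> gives
      the factor \<open>v\<close> on the left and the maximal length \<open>2 * R\<close> of a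
      segment on the right.\<close>
    define k where "k = v / (2 * R)"
    have k: "0 < k" using v R by (simp add: k_def)
    have main: "(\<integral>\<^sup>+x. indicator A x * ennreal (\<bar>k * \<phi> x\<bar> powr r) \<partial>lborel) \<le> ennreal (C * X powr (r / a))"
    proof (rule CC)
      show "(\<integral>\<^sup>+x. ennreal (F x powr a) \<partial>lborel) \<le> ennreal X"
        using le by (rule order.trans[rotated]) (auto intro!: nn_integral_mono simp: F_def indicator_def)
      show "\<forall>x\<in>A. ennreal \<bar>k * \<phi> x\<bar> \<le> (\<integral>\<^sup>+(t,y). ennreal (indicator {0<..<1} t * indicator B y * F ((1 - t) *\<^sub>R x + t *\<^sub>R y)) \<partial>(lborel \<Otimes>\<^sub>M lborel))"
      proof
        fix x assume x: "x \<in> A"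
        define J where "J y = (\<integral>\<^sup>+t. ennreal (indicator {0<..<1} t * F ((1 - t) *\<^sub>R x + t *\<^sub>R y)) \<partial>lborel)" for y
        have J: "ennreal \<bar>\<phi> x\<bar> \<le> ennreal (2 * R) * J y" if y: "y \<in> B" for y
        proof -
          have yA: "y \<in> A" using y BA by auto
          have "norm (x - y) \<le> norm x + norm y" by (rule norm_triangle_ineq4)
          also have "\<dots> \<le> 2 * R" using x yA by (auto simp: A_def)
          finally have "ennreal \<bar>\<phi> x\<bar> \<le> ennreal (2 * R) * (\<integral>\<^sup>+t. ennreal (indicator {0<..<1} t * norm (d\<phi> ((1 - t) *\<^sub>R x + t *\<^sub>R y))) \<partial>lborel)"
            using C1_segment_bound[OF d c z[OF y]] by blast
          also have "(\<integral>\<^sup>+t. ennreal (indicator {0<..<1} t * norm (d\<phi> ((1 - t) *\<^sub>R x + t *\<^sub>R y))) \<partial>lborel) = J y"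
            unfolding J_def
          proof (rule nn_integral_cong)
            fix t :: real
            have "(1 - t) *\<^sub>R x + t *\<^sub>R y \<in> A" if "t \<in> {0<..<1}"
              using that x yA convexD_alt[of A x y t] by (auto simp: A_def)
            then show "ennreal (indicator {0<..<1} t * norm (d\<phi> ((1 - t) *\<^sub>R x + t *\<^sub>R y))) = ennreal (indicator {0<..<1} t * F ((1 - t) *\<^sub>R x + t *\<^sub>R y))"
              by (auto simp: F_def indicator_def)
          qed
          finally show ?thesis .
        qed
        have mJ[measurable]: "J \<in> borel_measurable borel" unfolding J_def by measurable
        have "ennreal (v * \<bar>\<phi> x\<bar>) = (\<integral>\<^sup>+y. ennreal \<bar>\<phi> x\<bar> * indicator B y \<partial>lborel)"
          using fin v by (subst nn_integral_cmult_indicator)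
            (auto simp: emeasure_eq_ennreal_measure v_def mult.commute simp flip: ennreal_mult')
        also have "\<dots> \<le> (\<integral>\<^sup>+y. ennreal (2 * R) * (indicator B y * J y) \<partial>lborel)"
          using J by (intro nn_integral_mono) (auto simp: indicator_def)
        also have "\<dots> = ennreal (2 * R) * (\<integral>\<^sup>+y. indicator B y * J y \<partial>lborel)"
          by (intro nn_integral_cmult) measurable
        finally have "ennreal (1 / (2 * R)) * ennreal (v * \<bar>\<phi> x\<bar>) \<le> ennreal (1 / (2 * R)) * (ennreal (2 * R) * (\<integral>\<^sup>+y. indicator B y * J y \<partial>lborel))"
          by (intro mult_left_mono) auto
        also have "ennreal (1 / (2 * R)) * (ennreal (2 * R) * (\<integral>\<^sup>+y. indicator B y * J y \<partial>lborel)) = (\<integral>\<^sup>+y. indicator B y * J y \<partial>lborel)"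
          using R by (simp flip: mult.assoc ennreal_mult')
        also have "ennreal (1 / (2 * R)) * ennreal (v * \<bar>\<phi> x\<bar>) = ennreal \<bar>k * \<phi> x\<bar>"
          using R v by (simp flip: ennreal_mult' add: k_def abs_mult)
        also have "(\<integral>\<^sup>+y. indicator B y * J y \<partial>lborel) = (\<integral>\<^sup>+y. \<integral>\<^sup>+t. ennreal (indicator {0<..<1} t * indicator B y * F ((1 - t) *\<^sub>R x + t *\<^sub>R y)) \<partial>lborel \<partial>lborel)"
          unfolding J_def by (auto intro!: nn_integral_cong simp: indicator_def)
        also have "\<dots> = (\<integral>\<^sup>+t. \<integral>\<^sup>+y. ennreal (indicator {0<..<1} t * indicator B y * F ((1 - t) *\<^sub>R x + t *\<^sub>R y)) \<partial>lborel \<partial>lborel)"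
          by (rule lborel_pair.Fubini') measurable
        also have "\<dots> = (\<integral>\<^sup>+(t,y). ennreal (indicator {0<..<1} t * indicator B y * F ((1 - t) *\<^sub>R x + t *\<^sub>R y)) \<partial>(lborel \<Otimes>\<^sub>M lborel))"
          by (simp add: lborel.nn_integral_fst[symmetric])
        finally show "ennreal \<bar>k * \<phi> x\<bar> \<le> (\<integral>\<^sup>+(t,y). ennreal (indicator {0<..<1} t * indicator B y * F ((1 - t) *\<^sub>R x + t *\<^sub>R y)) \<partial>(lborel \<Otimes>\<^sub>M lborel))" .
      qed
    qed (auto simp: F_def X)
    have c\<phi>: "continuous_on UNIV \<phi>"
      using d by (intro continuous_at_imp_continuous_on) (blast intro: has_derivative_continuous)
    have [measurable]: "\<phi> \<in> borel_measurable borel" by (rule borel_measurable_continuous_onI[OF c\<phi>])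
    have "(\<integral>\<^sup>+x. indicator A x * ennreal (\<bar>\<phi> x\<bar> powr r) \<partial>lborel)
      = (\<integral>\<^sup>+x. ennreal ((2 * R / v) powr r) * (indicator A x * ennreal (\<bar>k * \<phi> x\<bar> powr r)) \<partial>lborel)"
    proof (rule nn_integral_cong)
      fix x
      have "\<bar>\<phi> x\<bar> powr r = ((2 * R / v) * \<bar>k * \<phi> x\<bar>) powr r"
        using R v by (simp add: k_def abs_mult)
      also have "\<dots> = (2 * R / v) powr r * \<bar>k * \<phi> x\<bar> powr r" by (rule powr_mult)
      finally show "indicator A x * ennreal (\<bar>\<phi> x\<bar> powr r) = ennreal ((2 * R / v) powr r) * (indicator A x * ennreal (\<bar>k * \<phi> x\<bar> powr r))"
        by (simp add: ennreal_mult' mult.left_commute)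
    qed
    also have "\<dots> = ennreal ((2 * R / v) powr r) * (\<integral>\<^sup>+x. indicator A x * ennreal (\<bar>k * \<phi> x\<bar> powr r) \<partial>lborel)"
      by (intro nn_integral_cmult) measurable
    also have "\<dots> \<le> ennreal ((2 * R / v) powr r) * ennreal (C * X powr (r / a))"
      by (intro mult_left_mono main) auto
    also have "\<dots> = ennreal (C * ((2 * R / v) powr r) * X powr (r / a))"
      using C by (simp flip: ennreal_mult' add: mult_ac)
    finally show ?thesis .
  qed
  moreover have "0 < C * ((2 * R / v) powr r)" using C R v by simp
  ultimately show ?thesis unfolding A_def B_def by blast
qed

section \<open>The weighted space on the annulus\<close>

lemma norm_add_powr_le:
  fixes x y :: "'b::real_normed_vector"
  assumes "0 \<le> p"
  shows "norm (x + y) powr p \<le> 2 powr p * (norm x powr p + norm y powr p)"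
proof -
  have "norm (x + y) \<le> 2 * max (norm x) (norm y)"
    using norm_triangle_ineq[of x y] by linarith
  then have "norm (x + y) powr p \<le> (2 * max (norm x) (norm y)) powr p"
    using assms by (intro powr_mono2) auto
  also have "\<dots> = 2 powr p * max (norm x) (norm y) powr p"
    by (simp add: powr_mult)
  also have "max (norm x) (norm y) powr p \<le> norm x powr p + norm y powr p"
    by (auto simp: max_def)
  finally show ?thesis by simp
qed

lemma nn_integral_Fatou_le:
  fixes u :: "nat \<Rightarrow> 'b \<Rightarrow> ennreal"
  assumes [measurable]: "\<And>n. u n \<in> borel_measurable M"
    and lim: "AE x in M. (\<lambda>n. u n x) \<longlonglongrightarrow> v x"
    and le: "\<forall>\<^sub>F n in sequentially. (\<integral>\<^sup>+x. u n x \<partial>M) \<le> c"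
  shows "(\<integral>\<^sup>+x. v x \<partial>M) \<le> c"
proof -
  have "(\<integral>\<^sup>+x. v x \<partial>M) = (\<integral>\<^sup>+x. liminf (\<lambda>n. u n x) \<partial>M)"
    using lim by (intro nn_integral_cong_AE) (auto elim!: eventually_mono dest!: lim_imp_Liminf[rotated])
  also have "\<dots> \<le> liminf (\<lambda>n. \<integral>\<^sup>+x. u n x \<partial>M)" by (rule nn_integral_liminf) simp
  also have "\<dots> \<le> limsup (\<lambda>n. \<integral>\<^sup>+x. u n x \<partial>M)" by (rule Liminf_le_Limsup) simp
  also have "\<dots> \<le> c" using le by (rule Limsup_bounded)
  finally show ?thesis .
qed

text \<open>The number \<open>d\<close> is both the size of the \<open>q\<close>-norm bound and the
  level at which the values are split: above it,
  \<open>\<bar>z\<bar> \<le> d powr (1 - q) * \<bar>z\<bar> powr q\<close>. This makes the result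
  linear in \<open>d\<close>.\<close>

lemma nn_set_integral_le_powr:
  fixes f :: "'b \<Rightarrow> real"
  assumes [measurable]: "f \<in> borel_measurable M" "E \<in> sets M"
    and q: "1 \<le> q" and d: "0 < d" and fin: "emeasure M E \<noteq> \<infinity>"
    and le: "(\<integral>\<^sup>+x\<in>E. ennreal (\<bar>f x\<bar> powr q) \<partial>M) \<le> ennreal (d powr q)"
  shows "(\<integral>\<^sup>+x\<in>E. ennreal \<bar>f x\<bar> \<partial>M) \<le> ennreal ((measure M E + 1) * d)"
proof -
  have pw: "\<bar>z\<bar> \<le> d + d powr (1 - q) * \<bar>z\<bar> powr q" for z :: real
  proof (cases "\<bar>z\<bar> \<le> d")
    case False
    have "\<bar>z\<bar> powr (1 - q) * \<bar>z\<bar> powr q \<le> d powr (1 - q) * \<bar>z\<bar> powr q"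
      using False d q by (intro mult_right_mono powr_mono2') auto
    moreover have "\<bar>z\<bar> powr (1 - q) * \<bar>z\<bar> powr q = \<bar>z\<bar>" using False d by (simp flip: powr_add)
    ultimately show ?thesis using d by simp
  qed (simp add: add_increasing2)
  have "(\<integral>\<^sup>+x\<in>E. ennreal \<bar>f x\<bar> \<partial>M) \<le> (\<integral>\<^sup>+x. ennreal d * indicator E x + ennreal (d powr (1 - q)) * (ennreal (\<bar>f x\<bar> powr q) * indicator E x) \<partial>M)"
    using pw d by (intro nn_integral_mono)
      (auto simp: indicator_def simp flip: ennreal_mult' ennreal_plus intro: ennreal_leI)
  also have "\<dots> = ennreal d * emeasure M E + ennreal (d powr (1 - q)) * (\<integral>\<^sup>+x\<in>E. ennreal (\<bar>f x\<bar> powr q) \<partial>M)"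
    by (simp add: nn_integral_add nn_integral_cmult)
  also have "\<dots> \<le> ennreal d * ennreal (measure M E) + ennreal (d powr (1 - q)) * ennreal (d powr q)"
    using fin by (intro add_mono mult_left_mono le) (auto simp: emeasure_eq_ennreal_measure)
  also have "\<dots> = ennreal (d * measure M E + d powr (1 - q) * d powr q)"
    using d by (simp add: ennreal_mult ennreal_plus)
  also have "d powr (1 - q) * d powr q = d" using d by (simp flip: powr_add)
  finally show ?thesis by (simp add: algebra_simps)
qed

section \<open>Annuli and compactly supported C1 functions\<close>

lemma annulus_eq: "annulus a (ereal b) = ball 0 b - cball 0 a"
  by (auto simp: annulus_def)

lemma open_annulus: "open (annulus a b :: 'a::real_normed_vector set)"
proof -
  have "annulus a b = (norm -` {a<..}) \<inter> ((\<lambda>x::'a. ereal (norm x)) -` {..<b})"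
    by (auto simp: annulus_def)
  moreover have "open ((\<lambda>x::'a. ereal (norm x)) -` {..<b})"
    by (intro open_vimage open_lessThan open_greaterThan continuous_intros)
  moreover have "open ((norm :: 'a \<Rightarrow> real) -` {a<..})"
    by (intro open_vimage open_lessThan open_greaterThan continuous_intros)
  ultimately show ?thesis by auto
qed

lemma annulus_sets_lebesgue [measurable]: "annulus a b \<in> sets (lebesgue :: 'a::euclidean_space measure)"
  using open_annulus borel_open by (metis sets_completionI_sets sets_lborel)

lemma C1c_deriv_zero:
  assumes "C1c A \<phi> d\<phi>" "compact S" "\<forall>x. x \<notin> S \<longrightarrow> \<phi> x = 0" "x \<notin> S"
  shows "d\<phi> x = 0"
proof -
  have "open (- S)" using assms(2) by (simp add: compact_imp_closed open_Compl)
  moreover have "(\<phi> has_derivative (\<lambda>h. d\<phi> x \<bullet> h)) (at x)" using assms(1) by (simp add: C1c_def)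
  moreover have "((\<lambda>_. 0) has_derivative (\<lambda>h. 0)) (at x)" by simp
  then have "(\<phi> has_derivative (\<lambda>h. 0)) (at x)"
    by (rule has_derivative_transform_within_open[OF _ \<open>open (- S)\<close>]) (use assms in auto)
  ultimately have "(\<lambda>h. d\<phi> x \<bullet> h) = (\<lambda>h. 0)" using has_derivative_unique by blast
  then have "d\<phi> x \<bullet> d\<phi> x = 0" by metis
  then show ?thesis by simp
qed

lemma C1c_support:
  assumes "C1c A \<phi> d\<phi>"
  obtains S where "compact S" "S \<subseteq> A" "\<And>x. x \<notin> S \<Longrightarrow> \<phi> x = 0" "\<And>x. x \<notin> S \<Longrightarrow> d\<phi> x = 0"
  using assms C1c_deriv_zero[OF assms] unfolding C1c_def by metis

lemma C1c_continuous:
  assumes "C1c A \<phi> d\<phi>"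
  shows "continuous_on UNIV \<phi>" "continuous_on UNIV d\<phi>"
  using assms by (auto simp: C1c_def intro!: continuous_at_imp_continuous_on dest: has_derivative_continuous)

lemma C1c_borel:
  assumes "C1c A \<phi> d\<phi>"
  shows "\<phi> \<in> borel_measurable lebesgue" "d\<phi> \<in> borel_measurable lebesgue"
  using C1c_continuous[OF assms] by (auto intro!: measurable_completion borel_measurable_continuous_onI)

lemma C1c_diff:
  assumes "C1c A \<phi> d\<phi>" "C1c A \<psi> d\<psi>"
  shows "C1c A (\<lambda>x. \<phi> x - \<psi> x) (\<lambda>x. d\<phi> x - d\<psi> x)"
proof -
  obtain S where S: "compact S" "S \<subseteq> A" "\<And>x. x \<notin> S \<Longrightarrow> \<phi> x = 0" using assms(1) by (auto simp: C1c_def)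
  obtain T where T: "compact T" "T \<subseteq> A" "\<And>x. x \<notin> T \<Longrightarrow> \<psi> x = 0" using assms(2) by (auto simp: C1c_def)
  have "compact (S \<union> T)" "S \<union> T \<subseteq> A" "\<forall>x. x \<notin> S \<union> T \<longrightarrow> \<phi> x - \<psi> x = 0" using S T by auto
  moreover have "((\<lambda>x. \<phi> x - \<psi> x) has_derivative (\<lambda>h. (d\<phi> x - d\<psi> x) \<bullet> h)) (at x)" for x
    using assms unfolding C1c_def by (auto intro!: derivative_eq_intros simp: inner_diff_left)
  moreover have "continuous_on UNIV (\<lambda>x. d\<phi> x - d\<psi> x)"
    using assms unfolding C1c_def by (auto intro!: continuous_intros)
  ultimately show ?thesis unfolding C1c_def by blast
qed

text \<open>Compactness of the support comes from \<open>F 0 = 0\<close> alone. Hence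
  \<open>\<zeta>\<close> may be nonzero at the inner sphere, as is the cutoff used later, which only
  localises away from the outer radius.\<close>

lemma C1c_compose_mult:
  fixes \<phi> :: "'a::euclidean_space \<Rightarrow> real"
  assumes "C1c A \<phi> d\<phi>"
    and F: "\<And>t. (F has_real_derivative F' t) (at t)" "continuous_on UNIV F'" "F 0 = 0"
    and z: "\<And>x. (\<zeta> has_derivative (\<lambda>h. d\<zeta> x \<bullet> h)) (at x)" "continuous_on UNIV d\<zeta>"
  shows "C1c A (\<lambda>x. \<zeta> x * F (\<phi> x)) (\<lambda>x. (\<zeta> x * F' (\<phi> x)) *\<^sub>R d\<phi> x + F (\<phi> x) *\<^sub>R d\<zeta> x)"
proof -
  obtain S where S: "compact S" "S \<subseteq> A" "\<And>x. x \<notin> S \<Longrightarrow> \<phi> x = 0" using assms(1) by (auto simp: C1c_def)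
  have d: "\<And>x. (\<phi> has_derivative (\<lambda>h. d\<phi> x \<bullet> h)) (at x)" using assms(1) by (simp add: C1c_def)
  have cF: "continuous_on UNIV F" using F(1) by (intro continuous_at_imp_continuous_on) (auto intro: DERIV_isCont)
  have cz: "continuous_on UNIV \<zeta>" using z(1) by (intro continuous_at_imp_continuous_on) (auto intro: has_derivative_continuous)
  have "((\<lambda>x. \<zeta> x * F (\<phi> x)) has_derivative (\<lambda>h. ((\<zeta> x * F' (\<phi> x)) *\<^sub>R d\<phi> x + F (\<phi> x) *\<^sub>R d\<zeta> x) \<bullet> h)) (at x)" for x
  proof -
    have "((\<lambda>x. F (\<phi> x)) has_derivative (\<lambda>h. F' (\<phi> x) * (d\<phi> x \<bullet> h))) (at x)"
      using has_derivative_compose[OF d, of F "\<lambda>h. F' (\<phi> x) * h"] F(1)[of "\<phi> x"]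
      by (simp add: has_field_derivative_def)
    from has_derivative_mult[OF z(1) this] show ?thesis
      by (rule has_derivative_eq_rhs) (auto simp: inner_add_left algebra_simps)
  qed
  moreover have "continuous_on UNIV (\<lambda>x. (\<zeta> x * F' (\<phi> x)) *\<^sub>R d\<phi> x + F (\<phi> x) *\<^sub>R d\<zeta> x)"
    using C1c_continuous[OF assms(1)] z(2) cz
    by (intro continuous_intros continuous_on_compose2[OF cF] continuous_on_compose2[OF F(2)]) auto
  ultimately show ?thesis using S F(3) unfolding C1c_def by (auto intro!: exI[of _ S])
qed

text \<open>Hoelder's inequality with the conjugate exponents \<open>q / (q - p)\<close> and
  \<open>q / p\<close>, the case \<open>q = p\<close> being the bounded one. It is used for
  \<open>V = L\<close> and for \<open>V = K\<close>, so that both weights are dominated by the same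
  \<open>q\<close>-norm.\<close>

lemma exp_int_Holder:
  fixes V :: "'a::euclidean_space \<Rightarrow> real"
  assumes V: "exp_int p q E V" and [measurable]: "V \<in> borel_measurable lebesgue" "E \<in> sets lebesgue"
    and pq: "0 < p" "p \<le> q"
  shows "\<exists>C>0. \<forall>w Y. w \<in> borel_measurable lebesgue \<longrightarrow> 0 < Y \<longrightarrow>
     (\<integral>\<^sup>+x\<in>E. ennreal (\<bar>w x\<bar> powr q) \<partial>lebesgue) \<le> ennreal Y \<longrightarrow>
     (\<integral>\<^sup>+x\<in>E. ennreal (\<bar>V x\<bar> * \<bar>w x\<bar> powr p) \<partial>lebesgue) \<le> ennreal (C * Y powr (p / q))"
proof (cases "q = p")
  case True
  then obtain M where M: "AE x in lebesgue. x \<in> E \<longrightarrow> \<bar>V x\<bar> \<le> M" using V by (auto simp: exp_int_def)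
  \<comment> \<open>The essential bound \<open>M\<close> need not be positive, for instance when
    \<open>E\<close> is a null set.\<close>
  obtain m where m: "0 < m" "M \<le> m" using that[of "\<bar>M\<bar> + 1"] by auto
  have "(\<integral>\<^sup>+x\<in>E. ennreal (\<bar>V x\<bar> * \<bar>w x\<bar> powr p) \<partial>lebesgue) \<le> ennreal (m * Y powr (p / q))"
    if [measurable]: "w \<in> borel_measurable lebesgue" and Y: "0 < Y"
      and le: "(\<integral>\<^sup>+x\<in>E. ennreal (\<bar>w x\<bar> powr q) \<partial>lebesgue) \<le> ennreal Y" for w Y
  proof -
    have "(\<integral>\<^sup>+x\<in>E. ennreal (\<bar>V x\<bar> * \<bar>w x\<bar> powr p) \<partial>lebesgue) \<le> (\<integral>\<^sup>+x. ennreal m * (ennreal (\<bar>w x\<bar> powr q) * indicator E x) \<partial>lebesgue)"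
    proof (rule nn_integral_mono_AE, use M in eventually_elim)
      fix x assume "x \<in> E \<longrightarrow> \<bar>V x\<bar> \<le> M"
      then have "x \<in> E \<Longrightarrow> \<bar>V x\<bar> * \<bar>w x\<bar> powr p \<le> m * \<bar>w x\<bar> powr q"
        using True m by (intro mult_mono) auto
      then show "ennreal (\<bar>V x\<bar> * \<bar>w x\<bar> powr p) * indicator E x \<le> ennreal m * (ennreal (\<bar>w x\<bar> powr q) * indicator E x)"
        using m by (auto simp: indicator_def simp flip: ennreal_mult' intro: ennreal_leI)
    qed
    also have "\<dots> = ennreal m * (\<integral>\<^sup>+x\<in>E. ennreal (\<bar>w x\<bar> powr q) \<partial>lebesgue)"
      by (intro nn_integral_cmult) measurable
    also have "\<dots> \<le> ennreal m * ennreal Y" by (intro mult_left_mono le) auto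
    also have "\<dots> = ennreal (m * Y powr (p / q))" using True pq Y m by (simp flip: ennreal_mult')
    finally show ?thesis .
  qed
  then show ?thesis using m by (intro exI[of _ m]) auto
next
  case False
  then have q: "p < q" using pq by simp
  have int: "integrable lebesgue (\<lambda>x. indicator E x *\<^sub>R \<bar>V x\<bar> powr (q / (q - p)))"
    using V False by (simp add: exp_int_def set_integrable_def)
  define I where "I = (\<integral>x. indicator E x *\<^sub>R \<bar>V x\<bar> powr (q / (q - p)) \<partial>lebesgue) + 1"
  have I: "0 < I" unfolding I_def by (intro add_nonneg_pos integral_nonneg_AE) auto
  have Ile: "(\<integral>\<^sup>+x. ennreal (indicator E x * \<bar>V x\<bar> powr (q / (q - p))) \<partial>lebesgue) \<le> ennreal I"
    using nn_integral_eq_integral[OF int] by (simp add: I_def ennreal_leI)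
  have "(\<integral>\<^sup>+x\<in>E. ennreal (\<bar>V x\<bar> * \<bar>w x\<bar> powr p) \<partial>lebesgue) \<le> ennreal (I powr (1 - p / q) * Y powr (p / q))"
    if [measurable]: "w \<in> borel_measurable lebesgue" and Y: "0 < Y"
      and le: "(\<integral>\<^sup>+x\<in>E. ennreal (\<bar>w x\<bar> powr q) \<partial>lebesgue) \<le> ennreal Y" for w Y
  proof -
    define f where "f x = indicator E x * \<bar>w x\<bar> powr q" for x
    define g where "g x = indicator E x * \<bar>V x\<bar> powr (q / (q - p))" for x
    have "(\<integral>\<^sup>+x\<in>E. ennreal (\<bar>V x\<bar> * \<bar>w x\<bar> powr p) \<partial>lebesgue)
       = (\<integral>\<^sup>+x. ennreal (f x powr (p / q) * g x powr (1 - p / q)) \<partial>lebesgue)"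
    proof (rule nn_integral_cong)
      fix x
      have "q / (q - p) * (1 - p / q) = 1" using q pq by (simp add: field_simps)
      then show "ennreal (\<bar>V x\<bar> * \<bar>w x\<bar> powr p) * indicator E x = ennreal (f x powr (p / q) * g x powr (1 - p / q))"
        using q pq by (auto simp: f_def g_def indicator_def powr_powr mult.commute)
    qed
    also have "\<dots> \<le> ennreal (Y powr (p / q) * I powr (1 - p / q))"
    proof (rule nn_integral_Holder)
      show "f \<in> borel_measurable lebesgue" "g \<in> borel_measurable lebesgue" unfolding f_def g_def by measurable
      show "(\<integral>\<^sup>+x. ennreal (g x) \<partial>lebesgue) \<le> ennreal I" using Ile by (simp add: g_def)
      have "(\<integral>\<^sup>+x. ennreal (f x) \<partial>lebesgue) = (\<integral>\<^sup>+x\<in>E. ennreal (\<bar>w x\<bar> powr q) \<partial>lebesgue)"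
        by (intro nn_integral_cong) (auto simp: f_def indicator_def)
      then show "(\<integral>\<^sup>+x. ennreal (f x) \<partial>lebesgue) \<le> ennreal Y" using le by simp
    qed (use q pq Y I in \<open>auto simp: f_def g_def\<close>)
    finally show ?thesis by (simp add: mult.commute)
  qed
  then show ?thesis using I by (intro exI[of _ "I powr (1 - p / q)"]) auto
qed

lemma tendsto_0_if_eventually_le:
  fixes f :: "'b \<Rightarrow> ennreal"
  assumes "\<And>e::real. 0 < e \<Longrightarrow> \<forall>\<^sub>F n in F. f n \<le> ennreal e"
  shows "(f \<longlongrightarrow> 0) F"
proof (rule order_tendstoI)
  fix c :: ennreal assume "0 < c"
  then obtain e :: real where e: "0 < e" "ennreal e < c"
    by (metis dense ennreal_0 ennreal_cases ennreal_less_zero_iff less_top order_less_trans)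
  have "\<forall>\<^sub>F n in F. f n \<le> ennreal e" using assms[OF e(1)] .
  then show "\<forall>\<^sub>F n in F. f n < c" by eventually_elim (use e in auto)
qed auto

text \<open>Two regions are kept apart: \<open>A\<close> is the annulus on which the equation and
  the function space live, \<open>E\<close> is the shell next to the inner sphere on which the
  Sobolev inequality and the integrability of powers are available. In the final result
  \<open>R\<close> is \<open>R1 + 2 * eps\<close>.\<close>

locale weighted_annulus =
  fixes L :: "'a::euclidean_space \<Rightarrow> real" and p R1 R s :: real and R2 :: ereal
  assumes p: "1 < p" and R1: "0 < R1" "R1 < R" and R2: "ereal R < R2"
    and L_meas [measurable]: "L \<in> borel_measurable lebesgue"
    and L_pos: "AE x in lebesgue. x \<in> annulus R1 R2 \<longrightarrow> 0 < L x"
    and L_loc: "\<And>S. compact S \<Longrightarrow> S \<subseteq> annulus R1 R2 \<Longrightarrow> set_integrable lebesgue S L"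
    and s: "1 / (p - 1) \<le> s"
    and L_inv: "set_integrable lebesgue (annulus R1 (ereal R)) (\<lambda>x. L x powr (- s))"
begin

section \<open>Weighted Hoelder and Sobolev inequalities on the shell\<close>

abbreviation A :: "'a set" where "A \<equiv> annulus R1 R2"
abbreviation E :: "'a set" where "E \<equiv> annulus R1 (ereal R)"

text \<open>The exponent written p_s in the notation: the power in which a gradient of finite
  weighted energy is integrable on \<open>E\<close>.\<close>

definition a :: real where "a = p * s / (s + 1)"

lemma s_pos: "0 < s"
proof -
  have "0 < 1 / (p - 1)" using p by simp
  then show ?thesis using s by linarith
qed

text \<open>Equivalent to \<open>s + 1 \<le> p * s\<close>, which is the hypothesis
  \<open>1 / (p - 1) \<le> s\<close> rearranged; the segment averages are estimated for exponents at
  least 1.\<close>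

lemma a_ge_1: "1 \<le> a"
proof -
  have "1 \<le> s * (p - 1)" using s p by (simp add: field_simps)
  then show ?thesis using s_pos by (simp add: a_def field_simps)
qed

lemma a_less_p: "a < p"
  using s_pos p by (simp add: a_def field_simps)

lemma E_subset_A: "E \<subseteq> A"
  using R2 by (auto simp: annulus_def) (metis ereal_less_eq(3) le_less_trans order.strict_implies_order)

lemma E_finite: "emeasure lebesgue E \<noteq> \<infinity>"
proof -
  have "emeasure lebesgue E \<le> emeasure lebesgue (ball 0 R :: 'a set)"
    by (intro emeasure_mono) (auto simp: annulus_eq)
  also have "\<dots> < \<infinity>" using emeasure_bounded_finite[of "ball (0::'a) R"] by simp
  finally show ?thesis by simp
qed

text \<open>Write \<open>\<bar>w\<bar> powr a\<close> as
  \<open>(L * \<bar>w\<bar> powr p) powr (a / p)\<close> times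
  \<open>(L powr (- s)) powr (1 - a / p)\<close>. The weight cancels because
  \<open>a / p = s / (s + 1)\<close>, and this is how \<open>a\<close> is found.\<close>

lemma gradient_Holder:
  "\<exists>C>0. \<forall>w X. w \<in> borel_measurable lebesgue \<longrightarrow> 0 < X \<longrightarrow>
     (\<integral>\<^sup>+x\<in>E. ennreal (L x * \<bar>w x\<bar> powr p) \<partial>lebesgue) \<le> ennreal X \<longrightarrow>
     (\<integral>\<^sup>+x\<in>E. ennreal (\<bar>w x\<bar> powr a) \<partial>lebesgue) \<le> ennreal (C * X powr (a / p))"
proof -
  have int: "integrable lebesgue (\<lambda>x. indicator E x *\<^sub>R L x powr (- s))"
    using L_inv by (simp add: set_integrable_def)
  define I where "I = (\<integral>x. indicator E x *\<^sub>R L x powr (- s) \<partial>lebesgue) + 1"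
  have I: "0 < I" unfolding I_def by (intro add_nonneg_pos integral_nonneg_AE) auto
  have Ile: "(\<integral>\<^sup>+x. ennreal (indicator E x * L x powr (- s)) \<partial>lebesgue) \<le> ennreal I"
    using nn_integral_eq_integral[OF int] by (simp add: I_def ennreal_leI)
  have ap: "0 < a / p" "a / p < 1" using a_ge_1 a_less_p p by auto
  have "(\<integral>\<^sup>+x\<in>E. ennreal (\<bar>w x\<bar> powr a) \<partial>lebesgue) \<le> ennreal (I powr (1 - a / p) * X powr (a / p))"
    if [measurable]: "w \<in> borel_measurable lebesgue" and X: "0 < X"
      and le: "(\<integral>\<^sup>+x\<in>E. ennreal (L x * \<bar>w x\<bar> powr p) \<partial>lebesgue) \<le> ennreal X" for w X
  proof -
    \<comment> \<open>The absolute value makes \<open>f\<close> nonnegative everywhere;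
      \<open>L\<close> itself is positive only almost everywhere on \<open>A\<close>.\<close>
    define f where "f x = indicator E x * (\<bar>L x\<bar> * \<bar>w x\<bar> powr p)" for x
    define g where "g x = indicator E x * L x powr (- s)" for x
    have "(\<integral>\<^sup>+x\<in>E. ennreal (\<bar>w x\<bar> powr a) \<partial>lebesgue)
       = (\<integral>\<^sup>+x. ennreal (f x powr (a / p) * g x powr (1 - a / p)) \<partial>lebesgue)"
    proof (rule nn_integral_cong_AE, use L_pos in eventually_elim)
      fix x assume L: "x \<in> A \<longrightarrow> 0 < L x"
      show "ennreal (\<bar>w x\<bar> powr a) * indicator E x = ennreal (f x powr (a / p) * g x powr (1 - a / p))"
      proof (cases "x \<in> E")
        case True
        then have Lx: "0 < L x" using L E_subset_A by auto
        have "f x powr (a / p) * g x powr (1 - a / p) = \<bar>w x\<bar> powr a * (L x powr (a / p) * L x powr ((- s) * (1 - a / p)))"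
          using True Lx p unfolding f_def g_def by (simp add: powr_mult powr_powr)
        also have "L x powr (a / p) * L x powr ((- s) * (1 - a / p)) = L x powr (a / p + (- s) * (1 - a / p))"
          by (simp only: powr_add)
        also have "a / p + (- s) * (1 - a / p) = 0"
        proof -
          have "a / p = s / (s + 1)" using p by (simp add: a_def)
          moreover have "1 - s / (s + 1) = 1 / (s + 1)" using s_pos by (simp add: field_simps)
          ultimately show ?thesis by simp
        qed
        finally show ?thesis using True Lx by simp
      qed (simp add: f_def)
    qed
    also have "\<dots> \<le> ennreal (X powr (a / p) * I powr (1 - a / p))"
    proof (rule nn_integral_Holder)
      show "f \<in> borel_measurable lebesgue" "g \<in> borel_measurable lebesgue" unfolding f_def g_def by measurable
      show "(\<integral>\<^sup>+x. ennreal (g x) \<partial>lebesgue) \<le> ennreal I" using Ile by (simp add: g_def)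
      have "(\<integral>\<^sup>+x. ennreal (f x) \<partial>lebesgue) = (\<integral>\<^sup>+x\<in>E. ennreal (L x * \<bar>w x\<bar> powr p) \<partial>lebesgue)"
        using L_pos
        by (intro nn_integral_cong_AE, eventually_elim) (use E_subset_A in \<open>auto simp: f_def indicator_def\<close>)
      then show "(\<integral>\<^sup>+x. ennreal (f x) \<partial>lebesgue) \<le> ennreal X" using le by simp
    qed (use ap X I in \<open>auto simp: f_def g_def\<close>)
    finally show ?thesis by (simp add: mult.commute)
  qed
  then show ?thesis using I by (intro exI[of _ "I powr (1 - a / p)"]) auto
qed

text \<open>The second condition is \<open>r < N * a / (N - a)\<close>, also meaningful for \<open>a \<ge> N\<close>.\<close>
definition sobolev_exponent :: "real \<Rightarrow> bool" where
  "sobolev_exponent r \<longleftrightarrow> p \<le> r \<and> real DIM('a) * (1 / a - 1 / r) < 1"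

text \<open>The support lies in \<open>A\<close>, hence outside the closed ball of radius
  \<open>R1\<close>: integrals over \<open>E\<close> and over the ball of radius \<open>R\<close>
  agree, and the inequality for functions vanishing on the inner ball applies after the weight has
  been removed. The support may extend beyond radius \<open>R\<close>.\<close>

lemma sobolev_C1c:
  assumes "sobolev_exponent r"
  shows "\<exists>C>0. \<forall>\<phi> d\<phi> X. C1c A \<phi> d\<phi> \<longrightarrow> 0 < X \<longrightarrow>
     (\<integral>\<^sup>+x\<in>E. ennreal (L x * norm (d\<phi> x) powr p) \<partial>lebesgue) \<le> ennreal X \<longrightarrow>
     (\<integral>\<^sup>+x\<in>E. ennreal (\<bar>\<phi> x\<bar> powr r) \<partial>lebesgue) \<le> ennreal (C * X powr (r / p))"
proof -
  have r: "a \<le> r" "1 < r" "real DIM('a) * (1 / a - 1 / r) < 1"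
    using assms a_less_p p by (auto simp: sobolev_exponent_def)
  obtain C where C: "0 < C" and CC: "\<And>w X. w \<in> borel_measurable lebesgue \<Longrightarrow> 0 < X \<Longrightarrow>
     (\<integral>\<^sup>+x\<in>E. ennreal (L x * \<bar>w x\<bar> powr p) \<partial>lebesgue) \<le> ennreal X \<Longrightarrow>
     (\<integral>\<^sup>+x\<in>E. ennreal (\<bar>w x\<bar> powr a) \<partial>lebesgue) \<le> ennreal (C * X powr (a / p))"
    using gradient_Holder by blast
  obtain D where D: "0 < D" and DD: "\<And>(\<phi>::'a \<Rightarrow> real) d\<phi> X. (\<forall>x. (\<phi> has_derivative (\<lambda>h. d\<phi> x \<bullet> h)) (at x)) \<Longrightarrow> continuous_on UNIV d\<phi> \<Longrightarrow>
     (\<forall>x\<in>ball 0 R1. \<phi> x = 0) \<Longrightarrow> 0 < X \<Longrightarrow>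
     (\<integral>\<^sup>+x. indicator (ball 0 R) x * ennreal (norm (d\<phi> x) powr a) \<partial>lborel) \<le> ennreal X \<Longrightarrow>
     (\<integral>\<^sup>+x. indicator (ball 0 R) x * ennreal (\<bar>\<phi> x\<bar> powr r) \<partial>lborel) \<le> ennreal (D * X powr (r / a))"
    using sobolev_vanishing_on_ball[of R1 R a r, where 'a='a] R1(1) less_imp_le[OF R1(2)] r a_ge_1 by blast
  have "(\<integral>\<^sup>+x\<in>E. ennreal (\<bar>\<phi> x\<bar> powr r) \<partial>lebesgue) \<le> ennreal (D * C powr (r / a) * X powr (r / p))"
    if \<phi>: "C1c A \<phi> d\<phi>" and X: "0 < X" and le: "(\<integral>\<^sup>+x\<in>E. ennreal (L x * norm (d\<phi> x) powr p) \<partial>lebesgue) \<le> ennreal X"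
    for \<phi> d\<phi> X
  proof -
    obtain S where S: "compact S" "S \<subseteq> A" "\<And>x. x \<notin> S \<Longrightarrow> \<phi> x = 0" "\<And>x. x \<notin> S \<Longrightarrow> d\<phi> x = 0"
      using C1c_support[OF \<phi>] by blast
    have z: "\<phi> x = 0" "d\<phi> x = 0" if "norm x \<le> R1" for x
    proof -
      have "x \<notin> S" using S(2) that by (auto simp: annulus_def)
      then show "\<phi> x = 0" "d\<phi> x = 0" using S by auto
    qed
    have [measurable]: "\<phi> \<in> borel_measurable lebesgue" "d\<phi> \<in> borel_measurable lebesgue" using C1c_borel[OF \<phi>] by auto
    have "(\<integral>\<^sup>+x. indicator (ball 0 R) x * ennreal (norm (d\<phi> x) powr a) \<partial>lborel)
      = (\<integral>\<^sup>+x. indicator (ball 0 R) x * ennreal (norm (d\<phi> x) powr a) \<partial>lebesgue)"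
      by (simp only: nn_integral_completion)
    also have "\<dots> = (\<integral>\<^sup>+x\<in>E. ennreal (\<bar>norm (d\<phi> x)\<bar> powr a) \<partial>lebesgue)"
      using a_ge_1 z by (intro nn_integral_cong) (auto simp: indicator_def annulus_eq)
    also have "\<dots> \<le> ennreal (C * X powr (a / p))"
      using le X by (intro CC) auto
    finally have "(\<integral>\<^sup>+x. indicator (ball 0 R) x * ennreal (\<bar>\<phi> x\<bar> powr r) \<partial>lborel) \<le> ennreal (D * (C * X powr (a / p)) powr (r / a))"
      using \<phi> C X z unfolding C1c_def by (intro DD) auto
    also have "D * (C * X powr (a / p)) powr (r / a) = D * C powr (r / a) * X powr (r / p)"
      using C X a_ge_1 by (simp add: powr_mult powr_powr)
    also have "(\<integral>\<^sup>+x. indicator (ball 0 R) x * ennreal (\<bar>\<phi> x\<bar> powr r) \<partial>lborel)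
      = (\<integral>\<^sup>+x. indicator (ball 0 R) x * ennreal (\<bar>\<phi> x\<bar> powr r) \<partial>lebesgue)"
      by (simp only: nn_integral_completion)
    also have "\<dots> = (\<integral>\<^sup>+x\<in>E. ennreal (\<bar>\<phi> x\<bar> powr r) \<partial>lebesgue)"
      using z by (intro nn_integral_cong) (auto simp: indicator_def annulus_eq)
    finally show ?thesis .
  qed
  moreover have "0 < D * C powr (r / a)" using C D by simp
  ultimately show ?thesis by blast
qed

text \<open>Membership in the space provides convergence on compact subsets of \<open>A\<close>
  only, while \<open>E\<close> touches the inner sphere. Bounds uniform over compact subsets are
  carried to \<open>E\<close> by Fatou's lemma along closed shells.\<close>

lemma compact_annuli_exhaust:
  assumes [measurable]: "f \<in> borel_measurable lebesgue"
    and le: "\<And>S. compact S \<Longrightarrow> S \<subseteq> E \<Longrightarrow> (\<integral>\<^sup>+x\<in>S. f x \<partial>lebesgue) \<le> c"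
  shows "(\<integral>\<^sup>+x\<in>E. f x \<partial>lebesgue) \<le> c"
proof -
  define T :: "nat \<Rightarrow> 'a set" where "T j = cball 0 (R - inverse (Suc j)) - ball 0 (R1 + inverse (Suc j))" for j
  have T: "compact (T j)" "T j \<subseteq> E" for j
  proof -
    show "compact (T j)" unfolding T_def by (intro compact_diff) auto
    show "T j \<subseteq> E"
    proof
      fix x assume "x \<in> T j"
      then have "norm x \<le> R - inverse (real (Suc j))" "R1 + inverse (real (Suc j)) \<le> norm x" by (auto simp: T_def)
      moreover have "0 < inverse (real (Suc j))" by simp
      ultimately have "R1 < norm x" "norm x < R" by linarith+
      then show "x \<in> E" by (simp add: annulus_def)
    qed
  qed
  have [measurable]: "T j \<in> sets lebesgue" for j
    using T(1)[of j] by (simp add: borel_compact)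
  show ?thesis
  proof (rule nn_integral_Fatou_le[where u = "\<lambda>j x. f x * indicator (T j) x"])
    show "AE x in lebesgue. (\<lambda>j. f x * indicator (T j) x) \<longlonglongrightarrow> f x * indicator E x"
    proof (rule AE_I2)
      fix x
      show "(\<lambda>j. f x * indicator (T j) x) \<longlonglongrightarrow> f x * indicator E x"
      proof (cases "x \<in> E")
        case True
        then have "0 < min (norm x - R1) (R - norm x)" by (auto simp: annulus_def)
        with LIMSEQ_inverse_real_of_nat
        have "\<forall>\<^sub>F j in sequentially. inverse (real (Suc j)) < min (norm x - R1) (R - norm x)"
          by (rule order_tendstoD)
        then have "\<forall>\<^sub>F j in sequentially. f x * indicator (T j) x = f x * indicator E x"
          by eventually_elim (use True in \<open>auto simp: T_def indicator_def\<close>)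
        then show ?thesis by (rule tendsto_eventually)
      next
        case False
        then have "x \<notin> T j" for j using T(2) by auto
        then show ?thesis using False by simp
      qed
    qed
  qed (use T le in auto)
qed

text \<open>The weighted gradients converge to \<open>g\<close>, so those of the differences
  \<open>\<phi> n - \<phi> m\<close> become small, and these differences are again admissible in the
  Sobolev inequality.\<close>

lemma inD0_cauchy:
  assumes r: "sobolev_exponent r" and C1: "\<And>n. C1c A (\<phi> n) (d\<phi> n)"
    and [measurable]: "g \<in> borel_measurable lebesgue"
    and lim: "(\<lambda>n. \<integral>\<^sup>+x\<in>A. ennreal (L x * norm (d\<phi> n x - g x) powr p) \<partial>lebesgue) \<longlonglongrightarrow> 0"
    and e: "0 < e"
  shows "\<exists>n0. \<forall>n\<ge>n0. \<forall>m\<ge>n0. (\<integral>\<^sup>+x\<in>E. ennreal (\<bar>\<phi> n x - \<phi> m x\<bar> powr r) \<partial>lebesgue) \<le> ennreal e"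
proof -
  obtain C where C: "0 < C" and CC: "\<And>\<phi> d\<phi> X. C1c A \<phi> d\<phi> \<Longrightarrow> 0 < X \<Longrightarrow>
     (\<integral>\<^sup>+x\<in>E. ennreal (L x * norm (d\<phi> x) powr p) \<partial>lebesgue) \<le> ennreal X \<Longrightarrow>
     (\<integral>\<^sup>+x\<in>E. ennreal (\<bar>\<phi> x\<bar> powr r) \<partial>lebesgue) \<le> ennreal (C * X powr (r / p))"
    using sobolev_C1c[OF r] by blast
  have r0: "0 < r" using r p by (simp add: sobolev_exponent_def)
  \<comment> \<open>The energy at which the Sobolev inequality returns exactly \<open>e\<close>.
    Below, \<open>Y\<close> is the share of each of the two approximation errors after the factor
    \<open>2 powr p\<close> of the triangle inequality.\<close>
  define X where "X = (e / C) powr (p / r)"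
  have X: "0 < X" "C * X powr (r / p) = e" using C e r0 p by (auto simp: X_def powr_powr)
  define Y where "Y = X / (2 * 2 powr p)"
  have Y: "0 < Y" using X by (simp add: Y_def)
  have [measurable]: "\<phi> n \<in> borel_measurable lebesgue" "d\<phi> n \<in> borel_measurable lebesgue" for n
    using C1c_borel[OF C1] by auto
  have "\<forall>\<^sub>F n in sequentially. (\<integral>\<^sup>+x\<in>A. ennreal (L x * norm (d\<phi> n x - g x) powr p) \<partial>lebesgue) < ennreal Y"
    using lim Y by (intro order_tendstoD) auto
  then obtain n0 where n0: "\<And>n. n \<ge> n0 \<Longrightarrow> (\<integral>\<^sup>+x\<in>A. ennreal (L x * norm (d\<phi> n x - g x) powr p) \<partial>lebesgue) \<le> ennreal Y"
    unfolding eventually_sequentially by (meson less_imp_le)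
  have "(\<integral>\<^sup>+x\<in>E. ennreal (\<bar>\<phi> n x - \<phi> m x\<bar> powr r) \<partial>lebesgue) \<le> ennreal e" if nm: "n \<ge> n0" "m \<ge> n0" for n m
  proof -
    have "(\<integral>\<^sup>+x\<in>E. ennreal (L x * norm (d\<phi> n x - d\<phi> m x) powr p) \<partial>lebesgue)
      \<le> (\<integral>\<^sup>+x. ennreal (2 powr p) * (ennreal (L x * norm (d\<phi> n x - g x) powr p) * indicator A x + ennreal (L x * norm (d\<phi> m x - g x) powr p) * indicator A x) \<partial>lebesgue)"
    proof (rule nn_integral_mono_AE, use L_pos in eventually_elim)
      fix x assume L: "x \<in> A \<longrightarrow> 0 < L x"
      have "norm (d\<phi> n x - d\<phi> m x) powr p \<le> 2 powr p * (norm (d\<phi> n x - g x) powr p + norm (d\<phi> m x - g x) powr p)"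
        using norm_add_powr_le[of p "d\<phi> n x - g x" "g x - d\<phi> m x"] p by (simp add: norm_minus_commute)
      then have "L x * norm (d\<phi> n x - d\<phi> m x) powr p \<le> 2 powr p * (L x * norm (d\<phi> n x - g x) powr p + L x * norm (d\<phi> m x - g x) powr p)" if "x \<in> E"
        using L that E_subset_A mult_left_mono[of _ _ "L x"] by (fastforce simp: algebra_simps)
      then show "ennreal (L x * norm (d\<phi> n x - d\<phi> m x) powr p) * indicator E x \<le> ennreal (2 powr p) * (ennreal (L x * norm (d\<phi> n x - g x) powr p) * indicator A x + ennreal (L x * norm (d\<phi> m x - g x) powr p) * indicator A x)"
        using E_subset_A L by (cases "x \<in> E") (auto simp: subset_iff simp flip: ennreal_plus ennreal_mult' intro: ennreal_leI)
    qed
    also have "\<dots> = ennreal (2 powr p) * ((\<integral>\<^sup>+x\<in>A. ennreal (L x * norm (d\<phi> n x - g x) powr p) \<partial>lebesgue) + (\<integral>\<^sup>+x\<in>A. ennreal (L x * norm (d\<phi> m x - g x) powr p) \<partial>lebesgue))"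
      by (simp add: nn_integral_cmult nn_integral_add)
    also have "\<dots> \<le> ennreal (2 powr p) * (ennreal Y + ennreal Y)"
      by (intro mult_left_mono add_mono n0 nm) auto
    also have "\<dots> = ennreal X"
      using Y by (simp flip: ennreal_plus ennreal_mult' add: Y_def)
    finally show ?thesis using CC[OF C1c_diff[OF C1[of n] C1[of m]] X(1)] X(2) by simp
  qed
  then show ?thesis by blast
qed

text \<open>Local convergence in the mean determines the limit but says nothing near the inner
  sphere. The Cauchy property in \<open>L^r(E)\<close> does: on \<open>E\<close>, of finite measure,
  it gives a Cauchy sequence in \<open>L^1\<close>, whose limit must be \<open>u\<close>; a
  subsequence converges almost everywhere, and Fatou's lemma returns convergence in
  \<open>L^r(E)\<close> to \<open>u\<close> itself.\<close>

lemma inD0_approx: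
  assumes r: "sobolev_exponent r" and u: "inD0 p L A u g"
  obtains \<phi> d\<phi> where "\<And>n. C1c A (\<phi> n) (d\<phi> n)"
    "(\<lambda>n. \<integral>\<^sup>+x\<in>A. ennreal (L x * norm (d\<phi> n x - g x) powr p) \<partial>lebesgue) \<longlonglongrightarrow> 0"
    "\<And>S. compact S \<Longrightarrow> S \<subseteq> A \<Longrightarrow> (\<lambda>n. \<integral>\<^sup>+x\<in>S. ennreal \<bar>\<phi> n x - u x\<bar> \<partial>lebesgue) \<longlonglongrightarrow> 0"
    "AE x in lebesgue. x \<in> E \<longrightarrow> (\<lambda>n. \<phi> n x) \<longlonglongrightarrow> u x"
    "(\<lambda>n. \<integral>\<^sup>+x\<in>E. ennreal (\<bar>\<phi> n x - u x\<bar> powr r) \<partial>lebesgue) \<longlonglongrightarrow> 0"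
proof -
  have [measurable]: "u \<in> borel_measurable lebesgue" "g \<in> borel_measurable lebesgue" using u by (auto simp: inD0_def)
  have r1: "1 \<le> r" using r p by (simp add: sobolev_exponent_def)
  obtain \<phi> d\<phi> where C1: "\<And>n. C1c A (\<phi> n) (d\<phi> n)"
    and lim: "(\<lambda>n. \<integral>\<^sup>+x\<in>A. ennreal (L x * norm (d\<phi> n x - g x) powr p) \<partial>lebesgue) \<longlonglongrightarrow> 0"
    and loc: "\<And>S. compact S \<Longrightarrow> S \<subseteq> A \<Longrightarrow> (\<lambda>n. \<integral>\<^sup>+x\<in>S. ennreal \<bar>\<phi> n x - u x\<bar> \<partial>lebesgue) \<longlonglongrightarrow> 0"
    using u unfolding inD0_def by blast
  have [measurable]: "\<phi> n \<in> borel_measurable lebesgue" for n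
    using C1c_borel[OF C1] by auto
  define v where "v = measure lebesgue E + 1"
  have v: "0 < v" by (simp add: v_def add_nonneg_pos)
  have L1: "\<exists>n0. \<forall>n\<ge>n0. (\<integral>\<^sup>+x\<in>E. ennreal \<bar>\<phi> n x - u x\<bar> \<partial>lebesgue) \<le> ennreal e" if e: "0 < e" for e
  proof -
    define d where "d = e / v"
    have d: "0 < d" "v * d = e" using v e by (auto simp: d_def)
    have "0 < d powr r" using d by simp
    then obtain n0 where n0: "\<And>n m. n \<ge> n0 \<Longrightarrow> m \<ge> n0 \<Longrightarrow> (\<integral>\<^sup>+x\<in>E. ennreal (\<bar>\<phi> n x - \<phi> m x\<bar> powr r) \<partial>lebesgue) \<le> ennreal (d powr r)"
      using inD0_cauchy[OF r C1 \<open>g \<in> borel_measurable lebesgue\<close> lim] by blast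
    have n0': "(\<integral>\<^sup>+x\<in>E. ennreal \<bar>\<phi> n x - \<phi> m x\<bar> \<partial>lebesgue) \<le> ennreal e" if "n \<ge> n0" "m \<ge> n0" for n m
      using nn_set_integral_le_powr[OF _ _ r1 d(1) E_finite n0[OF that]] d(2) by (simp add: v_def)
    \<comment> \<open>On a compact \<open>S\<close> the function \<open>u\<close> may be replaced by
      \<open>\<phi> m\<close> at a cost that vanishes as \<open>m\<close> grows; the Cauchy bound
      that remains does not depend on \<open>S\<close>.\<close>
    have "(\<integral>\<^sup>+x\<in>E. ennreal \<bar>\<phi> n x - u x\<bar> \<partial>lebesgue) \<le> ennreal e" if n: "n \<ge> n0" for n
    proof (rule compact_annuli_exhaust)
      fix S assume S: "compact S" "S \<subseteq> E"
      have [measurable]: "S \<in> sets lebesgue" using S(1) by (simp add: borel_compact)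
      have "(\<lambda>m. ennreal e + (\<integral>\<^sup>+x\<in>S. ennreal \<bar>\<phi> m x - u x\<bar> \<partial>lebesgue)) \<longlonglongrightarrow> ennreal e + 0"
        using S E_subset_A by (intro tendsto_add tendsto_const loc) auto
      moreover have "\<forall>\<^sub>F m in sequentially. (\<integral>\<^sup>+x\<in>S. ennreal \<bar>\<phi> n x - u x\<bar> \<partial>lebesgue) \<le> ennreal e + (\<integral>\<^sup>+x\<in>S. ennreal \<bar>\<phi> m x - u x\<bar> \<partial>lebesgue)"
        using eventually_ge_at_top[of n0]
      proof eventually_elim
        fix m assume m: "m \<ge> n0"
        have "(\<integral>\<^sup>+x\<in>S. ennreal \<bar>\<phi> n x - u x\<bar> \<partial>lebesgue) \<le> (\<integral>\<^sup>+x. ennreal \<bar>\<phi> n x - \<phi> m x\<bar> * indicator E x + ennreal \<bar>\<phi> m x - u x\<bar> * indicator S x \<partial>lebesgue)"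
          using S(2) by (intro nn_integral_mono) (auto simp: indicator_def simp flip: ennreal_plus intro!: ennreal_leI)
        also have "\<dots> = (\<integral>\<^sup>+x\<in>E. ennreal \<bar>\<phi> n x - \<phi> m x\<bar> \<partial>lebesgue) + (\<integral>\<^sup>+x\<in>S. ennreal \<bar>\<phi> m x - u x\<bar> \<partial>lebesgue)"
          by (intro nn_integral_add) measurable
        also have "\<dots> \<le> ennreal e + (\<integral>\<^sup>+x\<in>S. ennreal \<bar>\<phi> m x - u x\<bar> \<partial>lebesgue)"
          by (intro add_right_mono n0' n m)
        finally show "(\<integral>\<^sup>+x\<in>S. ennreal \<bar>\<phi> n x - u x\<bar> \<partial>lebesgue) \<le> ennreal e + (\<integral>\<^sup>+x\<in>S. ennreal \<bar>\<phi> m x - u x\<bar> \<partial>lebesgue)" .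
      qed
      ultimately show "(\<integral>\<^sup>+x\<in>S. ennreal \<bar>\<phi> n x - u x\<bar> \<partial>lebesgue) \<le> ennreal e"
        using tendsto_lowerbound[of _ "ennreal e + 0" sequentially] by simp
    qed measurable
    then show ?thesis by blast
  qed
  obtain n1 where n1: "\<And>n. n \<ge> n1 \<Longrightarrow> (\<integral>\<^sup>+x\<in>E. ennreal \<bar>\<phi> n x - u x\<bar> \<partial>lebesgue) \<le> ennreal 1"
    using L1[of 1] by auto
  \<comment> \<open>The shift by \<open>n1\<close> makes every member integrable, not only those far
    out, as the subsequence theorem demands.\<close>
  define w where "w n x = indicator E x * (\<phi> (n + n1) x - u x)" for n x
  have w_int: "(\<integral>\<^sup>+x. ennreal (norm (w n x)) \<partial>lebesgue) = (\<integral>\<^sup>+x\<in>E. ennreal \<bar>\<phi> (n + n1) x - u x\<bar> \<partial>lebesgue)" for n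
    by (intro nn_integral_cong) (auto simp: w_def indicator_def)
  have wi: "integrable lebesgue (w n)" for n
  proof (rule integrableI_bounded)
    show "w n \<in> borel_measurable lebesgue" unfolding w_def by measurable
    have "(\<integral>\<^sup>+x. ennreal (norm (w n x)) \<partial>lebesgue) \<le> ennreal 1" using n1[of "n + n1"] w_int by simp
    then show "(\<integral>\<^sup>+x. ennreal (norm (w n x)) \<partial>lebesgue) < \<infinity>" by (rule le_less_trans) simp
  qed
  have "(\<lambda>n. (\<integral>x. norm (w n x) \<partial>lebesgue)) \<longlonglongrightarrow> 0"
  proof (rule LIMSEQ_I)
    fix e :: real assume e: "0 < e"
    then obtain n0 where n0: "\<And>n. n \<ge> n0 \<Longrightarrow> (\<integral>\<^sup>+x\<in>E. ennreal \<bar>\<phi> n x - u x\<bar> \<partial>lebesgue) \<le> ennreal (e / 2)"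
      using L1[of "e / 2"] by auto
    have "norm ((\<integral>x. norm (w n x) \<partial>lebesgue) - 0) < e" if "n \<ge> n0" for n
    proof -
      have "ennreal (\<integral>x. norm (w n x) \<partial>lebesgue) = (\<integral>\<^sup>+x. ennreal (norm (w n x)) \<partial>lebesgue)"
        using wi by (intro nn_integral_eq_integral[symmetric]) auto
      also have "\<dots> \<le> ennreal (e / 2)" using n0[of "n + n1"] that w_int by simp
      finally have "(\<integral>x. norm (w n x) \<partial>lebesgue) \<le> e / 2" using e by (subst (asm) ennreal_le_iff) auto
      then show ?thesis using e by simp
    qed
    then show "\<exists>no. \<forall>n\<ge>no. norm ((\<integral>x. norm (w n x) \<partial>lebesgue) - 0) < e" by blast
  qed
  from tendsto_L1_AE_subseq[OF wi this] obtain k where k: "strict_mono k" "AE x in lebesgue. (\<lambda>n. w (k n) x) \<longlonglongrightarrow> 0" by blast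
  define l where "l n = k n + n1" for n
  have l: "strict_mono l" using k(1) by (auto simp: strict_mono_def l_def)
  have ae: "AE x in lebesgue. x \<in> E \<longrightarrow> (\<lambda>n. \<phi> (l n) x) \<longlonglongrightarrow> u x"
    using k(2)
  proof eventually_elim
    fix x assume "(\<lambda>n. w (k n) x) \<longlonglongrightarrow> 0"
    then show "x \<in> E \<longrightarrow> (\<lambda>n. \<phi> (l n) x) \<longlonglongrightarrow> u x"
      by (auto simp: w_def l_def indicator_def intro: LIM_zero_cancel)
  qed
  have Lr: "(\<lambda>n. \<integral>\<^sup>+x\<in>E. ennreal (\<bar>\<phi> (l n) x - u x\<bar> powr r) \<partial>lebesgue) \<longlonglongrightarrow> 0"
  proof (rule tendsto_0_if_eventually_le)
    fix e :: real assume e: "0 < e"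
    then obtain n0 where n0: "\<And>n m. n \<ge> n0 \<Longrightarrow> m \<ge> n0 \<Longrightarrow> (\<integral>\<^sup>+x\<in>E. ennreal (\<bar>\<phi> n x - \<phi> m x\<bar> powr r) \<partial>lebesgue) \<le> ennreal e"
      using inD0_cauchy[OF r C1 \<open>g \<in> borel_measurable lebesgue\<close> lim] by blast
    have ln: "l n \<ge> n0" if "n \<ge> n0" for n using that seq_suble[OF l, of n] by simp
    \<comment> \<open>Fatou's lemma in \<open>m\<close> with \<open>n\<close> fixed: the Cauchy
      bound between \<open>l n\<close> and \<open>l m\<close> passes to the almost everywhere
      limit.\<close>
    have "(\<integral>\<^sup>+x\<in>E. ennreal (\<bar>\<phi> (l n) x - u x\<bar> powr r) \<partial>lebesgue) \<le> ennreal e" if n: "n \<ge> n0" for n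
    proof (rule nn_integral_Fatou_le[where u = "\<lambda>m x. ennreal (\<bar>\<phi> (l n) x - \<phi> (l m) x\<bar> powr r) * indicator E x"])
      show "AE x in lebesgue. (\<lambda>m. ennreal (\<bar>\<phi> (l n) x - \<phi> (l m) x\<bar> powr r) * indicator E x) \<longlonglongrightarrow> ennreal (\<bar>\<phi> (l n) x - u x\<bar> powr r) * indicator E x"
        using ae
      proof eventually_elim
        fix x assume x: "x \<in> E \<longrightarrow> (\<lambda>n. \<phi> (l n) x) \<longlonglongrightarrow> u x"
        show "(\<lambda>m. ennreal (\<bar>\<phi> (l n) x - \<phi> (l m) x\<bar> powr r) * indicator E x) \<longlonglongrightarrow> ennreal (\<bar>\<phi> (l n) x - u x\<bar> powr r) * indicator E x"
        proof (cases "x \<in> E")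
          case True
          have "(\<lambda>m. \<bar>\<phi> (l n) x - \<phi> (l m) x\<bar> powr r) \<longlonglongrightarrow> \<bar>\<phi> (l n) x - u x\<bar> powr r"
            using x True r1 by (intro tendsto_powr' tendsto_intros) auto
          then show ?thesis using True by (auto intro: tendsto_ennrealI)
        qed simp
      qed
      show "\<forall>\<^sub>F m in sequentially. (\<integral>\<^sup>+x\<in>E. ennreal (\<bar>\<phi> (l n) x - \<phi> (l m) x\<bar> powr r) \<partial>lebesgue) \<le> ennreal e"
        using eventually_ge_at_top[of n0] by eventually_elim (intro n0 ln n)
    qed measurable
    then show "\<forall>\<^sub>F n in sequentially. (\<integral>\<^sup>+x\<in>E. ennreal (\<bar>\<phi> (l n) x - u x\<bar> powr r) \<partial>lebesgue) \<le> ennreal e"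
      unfolding eventually_sequentially by blast
  qed
  show ?thesis
  proof (rule that[of "\<lambda>n. \<phi> (l n)" "\<lambda>n. d\<phi> (l n)"])
    show "(\<lambda>n. \<integral>\<^sup>+x\<in>A. ennreal (L x * norm (d\<phi> (l n) x - g x) powr p) \<partial>lebesgue) \<longlonglongrightarrow> 0"
      using LIMSEQ_subseq_LIMSEQ[OF lim l] by (simp add: o_def)
    show "(\<lambda>n. \<integral>\<^sup>+x\<in>S. ennreal \<bar>\<phi> (l n) x - u x\<bar> \<partial>lebesgue) \<longlonglongrightarrow> 0" if "compact S" "S \<subseteq> A" for S
      using LIMSEQ_subseq_LIMSEQ[OF loc[OF that] l] by (simp add: o_def)
  qed (use C1 ae Lr in auto)
qed

text \<open>One approximant within energy distance 1 suffices: its gradient is bounded and lives on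
  a compact subset of \<open>A\<close>, where \<open>L\<close> is integrable.\<close>

lemma inD0_energy_finite:
  assumes "inD0 p L A u g"
  shows "(\<integral>\<^sup>+x\<in>A. ennreal (L x * norm (g x) powr p) \<partial>lebesgue) < \<infinity>"
proof -
  have [measurable]: "u \<in> borel_measurable lebesgue" "g \<in> borel_measurable lebesgue" using assms by (auto simp: inD0_def)
  obtain \<phi> d\<phi> where C1: "\<And>n. C1c A (\<phi> n) (d\<phi> n)"
    and lim: "(\<lambda>n. \<integral>\<^sup>+x\<in>A. ennreal (L x * norm (d\<phi> n x - g x) powr p) \<partial>lebesgue) \<longlonglongrightarrow> 0"
    using assms unfolding inD0_def by blast
  have "\<forall>\<^sub>F n in sequentially. (\<integral>\<^sup>+x\<in>A. ennreal (L x * norm (d\<phi> n x - g x) powr p) \<partial>lebesgue) < 1"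
    using lim by (intro order_tendstoD) auto
  then obtain n where n: "(\<integral>\<^sup>+x\<in>A. ennreal (L x * norm (d\<phi> n x - g x) powr p) \<partial>lebesgue) < 1"
    unfolding eventually_sequentially by blast
  obtain S where S: "compact S" "S \<subseteq> A" "\<And>x. x \<notin> S \<Longrightarrow> \<phi> n x = 0" "\<And>x. x \<notin> S \<Longrightarrow> d\<phi> n x = 0"
    using C1c_support[OF C1[of n]] by blast
  have [measurable]: "S \<in> sets lebesgue" using S(1) by (simp add: borel_compact)
  have [measurable]: "d\<phi> n \<in> borel_measurable lebesgue" using C1c_borel[OF C1[of n]] by auto
  have "bounded (d\<phi> n ` S)"
    using C1c_continuous(2)[OF C1[of n]] S(1) by (intro compact_imp_bounded compact_continuous_image) (auto intro: continuous_on_subset)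
  then obtain B where B: "0 < B" "\<And>x. x \<in> S \<Longrightarrow> norm (d\<phi> n x) \<le> B"
    by (auto simp: bounded_pos)
  have "integrable lebesgue (\<lambda>x. indicator S x *\<^sub>R L x)" using L_loc[OF S(1,2)] by (simp add: set_integrable_def)
  then have LS: "(\<integral>\<^sup>+x. ennreal \<bar>indicator S x * L x\<bar> \<partial>lebesgue) < \<infinity>" by (simp add: integrable_iff_bounded)
  have "(\<integral>\<^sup>+x\<in>A. ennreal (L x * norm (g x) powr p) \<partial>lebesgue)
    \<le> (\<integral>\<^sup>+x. ennreal (2 powr p) * (ennreal (L x * norm (d\<phi> n x - g x) powr p) * indicator A x + ennreal (B powr p) * ennreal \<bar>indicator S x * L x\<bar>) \<partial>lebesgue)"
  proof (rule nn_integral_mono_AE, use L_pos in eventually_elim)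
    fix x assume L: "x \<in> A \<longrightarrow> 0 < L x"
    have le: "norm (g x) powr p \<le> 2 powr p * (norm (d\<phi> n x - g x) powr p + norm (d\<phi> n x) powr p)"
      using norm_add_powr_le[of p "g x - d\<phi> n x" "d\<phi> n x"] p by (simp add: norm_minus_commute)
    have "norm (d\<phi> n x) powr p \<le> B powr p * indicator S x"
      using B(2)[of x] S(4)[of x] p by (auto simp: indicator_def intro: powr_mono2)
    with le have "norm (g x) powr p \<le> 2 powr p * (norm (d\<phi> n x - g x) powr p + B powr p * indicator S x)"
      by (smt (verit, best) mult_left_mono powr_ge_zero)
    then have "L x * norm (g x) powr p \<le> 2 powr p * (L x * norm (d\<phi> n x - g x) powr p + B powr p * \<bar>indicator S x * L x\<bar>)" if "x \<in> A"
      using L that mult_left_mono[of "norm (g x) powr p" _ "L x"] by (fastforce simp: algebra_simps abs_mult)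
    then show "ennreal (L x * norm (g x) powr p) * indicator A x \<le> ennreal (2 powr p) * (ennreal (L x * norm (d\<phi> n x - g x) powr p) * indicator A x + ennreal (B powr p) * ennreal \<bar>indicator S x * L x\<bar>)"
      using L by (cases "x \<in> A") (auto simp flip: ennreal_plus ennreal_mult' intro: ennreal_leI)
  qed
  also have "\<dots> = ennreal (2 powr p) * ((\<integral>\<^sup>+x\<in>A. ennreal (L x * norm (d\<phi> n x - g x) powr p) \<partial>lebesgue) + ennreal (B powr p) * (\<integral>\<^sup>+x. ennreal \<bar>indicator S x * L x\<bar> \<partial>lebesgue))"
    by (simp add: nn_integral_cmult nn_integral_add)
  also have "\<dots> < \<infinity>"
    using n LS by (auto simp: ennreal_mult_less_top ennreal_add_less_top intro: less_trans)
  finally show ?thesis .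
qed

text \<open>Fatou's lemma transfers the inequality from the approximants to \<open>u\<close>. Only
  the energy on \<open>E\<close> appears in the bound, although the approximants converge in energy
  on all of \<open>A\<close>.\<close>

lemma inD0_sobolev:
  assumes r: "sobolev_exponent r"
  shows "\<exists>C>0. \<forall>u g X. inD0 p L A u g \<longrightarrow> 0 < X \<longrightarrow>
     (\<integral>\<^sup>+x\<in>E. ennreal (L x * norm (g x) powr p) \<partial>lebesgue) \<le> ennreal X \<longrightarrow>
     (\<integral>\<^sup>+x\<in>E. ennreal (\<bar>u x\<bar> powr r) \<partial>lebesgue) \<le> ennreal (C * X powr (r / p))"
proof -
  obtain C where C: "0 < C" and CC: "\<And>\<phi> d\<phi> X. C1c A \<phi> d\<phi> \<Longrightarrow> 0 < X \<Longrightarrow>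
     (\<integral>\<^sup>+x\<in>E. ennreal (L x * norm (d\<phi> x) powr p) \<partial>lebesgue) \<le> ennreal X \<Longrightarrow>
     (\<integral>\<^sup>+x\<in>E. ennreal (\<bar>\<phi> x\<bar> powr r) \<partial>lebesgue) \<le> ennreal (C * X powr (r / p))"
    using sobolev_C1c[OF r] by blast
  \<comment> \<open>Eventually the approximation error is below \<open>X\<close>, so the
    approximants have energy at most \<open>2 powr p * (X + X)\<close> on \<open>E\<close>.\<close>
  define c where "c = 2 powr p * 2"
  have c: "0 < c" by (simp add: c_def)
  have "(\<integral>\<^sup>+x\<in>E. ennreal (\<bar>u x\<bar> powr r) \<partial>lebesgue) \<le> ennreal (C * c powr (r / p) * X powr (r / p))"
    if u: "inD0 p L A u g" and X: "0 < X" and le: "(\<integral>\<^sup>+x\<in>E. ennreal (L x * norm (g x) powr p) \<partial>lebesgue) \<le> ennreal X" for u g X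
  proof -
    have [measurable]: "u \<in> borel_measurable lebesgue" "g \<in> borel_measurable lebesgue" using u by (auto simp: inD0_def)
    obtain \<phi> d\<phi> where C1: "\<And>n. C1c A (\<phi> n) (d\<phi> n)"
      and lim: "(\<lambda>n. \<integral>\<^sup>+x\<in>A. ennreal (L x * norm (d\<phi> n x - g x) powr p) \<partial>lebesgue) \<longlonglongrightarrow> 0"
      and "\<And>S. compact S \<Longrightarrow> S \<subseteq> A \<Longrightarrow> (\<lambda>n. \<integral>\<^sup>+x\<in>S. ennreal \<bar>\<phi> n x - u x\<bar> \<partial>lebesgue) \<longlonglongrightarrow> 0"
      and ae: "AE x in lebesgue. x \<in> E \<longrightarrow> (\<lambda>n. \<phi> n x) \<longlonglongrightarrow> u x"
      and "(\<lambda>n. \<integral>\<^sup>+x\<in>E. ennreal (\<bar>\<phi> n x - u x\<bar> powr r) \<partial>lebesgue) \<longlonglongrightarrow> 0"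
      using inD0_approx[OF r u] by blast
    have [measurable]: "\<phi> n \<in> borel_measurable lebesgue" "d\<phi> n \<in> borel_measurable lebesgue" for n
      using C1c_borel[OF C1] by auto
    have r0: "0 < r" using r p by (simp add: sobolev_exponent_def)
    have "(\<integral>\<^sup>+x\<in>E. ennreal (\<bar>u x\<bar> powr r) \<partial>lebesgue) \<le> ennreal (C * (c * X) powr (r / p))"
    proof (rule nn_integral_Fatou_le[where u = "\<lambda>n x. ennreal (\<bar>\<phi> n x\<bar> powr r) * indicator E x"])
      show "AE x in lebesgue. (\<lambda>n. ennreal (\<bar>\<phi> n x\<bar> powr r) * indicator E x) \<longlonglongrightarrow> ennreal (\<bar>u x\<bar> powr r) * indicator E x"
        using ae
      proof eventually_elim
        fix x assume x: "x \<in> E \<longrightarrow> (\<lambda>n. \<phi> n x) \<longlonglongrightarrow> u x"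
        show "(\<lambda>m. ennreal (\<bar>\<phi> m x\<bar> powr r) * indicator E x) \<longlonglongrightarrow> ennreal (\<bar>u x\<bar> powr r) * indicator E x"
        proof (cases "x \<in> E")
          case True
          have "(\<lambda>m. \<bar>\<phi> m x\<bar> powr r) \<longlonglongrightarrow> \<bar>u x\<bar> powr r"
            using x True r0 by (intro tendsto_powr' tendsto_intros) auto
          then show ?thesis using True by (auto intro: tendsto_ennrealI)
        qed simp
      qed
      have "\<forall>\<^sub>F n in sequentially. (\<integral>\<^sup>+x\<in>A. ennreal (L x * norm (d\<phi> n x - g x) powr p) \<partial>lebesgue) < ennreal X"
        using lim X by (intro order_tendstoD) auto
      then show "\<forall>\<^sub>F n in sequentially. (\<integral>\<^sup>+x\<in>E. ennreal (\<bar>\<phi> n x\<bar> powr r) \<partial>lebesgue) \<le> ennreal (C * (c * X) powr (r / p))"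
      proof eventually_elim
        fix n assume n: "(\<integral>\<^sup>+x\<in>A. ennreal (L x * norm (d\<phi> n x - g x) powr p) \<partial>lebesgue) < ennreal X"
        have "(\<integral>\<^sup>+x\<in>E. ennreal (L x * norm (d\<phi> n x) powr p) \<partial>lebesgue)
          \<le> (\<integral>\<^sup>+x. ennreal (2 powr p) * (ennreal (L x * norm (d\<phi> n x - g x) powr p) * indicator A x + ennreal (L x * norm (g x) powr p) * indicator E x) \<partial>lebesgue)"
        proof (rule nn_integral_mono_AE, use L_pos in eventually_elim)
          fix x assume L: "x \<in> A \<longrightarrow> 0 < L x"
          have "norm (d\<phi> n x) powr p \<le> 2 powr p * (norm (d\<phi> n x - g x) powr p + norm (g x) powr p)"
            using norm_add_powr_le[of p "d\<phi> n x - g x" "g x"] p by simp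
          then have "L x * norm (d\<phi> n x) powr p \<le> 2 powr p * (L x * norm (d\<phi> n x - g x) powr p + L x * norm (g x) powr p)" if "x \<in> E"
            using L that E_subset_A mult_left_mono[of _ _ "L x"] by (fastforce simp: algebra_simps)
          then show "ennreal (L x * norm (d\<phi> n x) powr p) * indicator E x \<le> ennreal (2 powr p) * (ennreal (L x * norm (d\<phi> n x - g x) powr p) * indicator A x + ennreal (L x * norm (g x) powr p) * indicator E x)"
            using E_subset_A L by (cases "x \<in> E") (auto simp: subset_iff simp flip: ennreal_plus ennreal_mult' intro: ennreal_leI)
        qed
        also have "\<dots> = ennreal (2 powr p) * ((\<integral>\<^sup>+x\<in>A. ennreal (L x * norm (d\<phi> n x - g x) powr p) \<partial>lebesgue) + (\<integral>\<^sup>+x\<in>E. ennreal (L x * norm (g x) powr p) \<partial>lebesgue))"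
          by (simp add: nn_integral_cmult nn_integral_add)
        also have "\<dots> \<le> ennreal (2 powr p) * (ennreal X + ennreal X)"
          using n le by (intro mult_left_mono add_mono) auto
        also have "\<dots> = ennreal (c * X)" using X by (simp flip: ennreal_plus ennreal_mult' add: c_def)
        finally show "(\<integral>\<^sup>+x\<in>E. ennreal (\<bar>\<phi> n x\<bar> powr r) \<partial>lebesgue) \<le> ennreal (C * (c * X) powr (r / p))"
          using C1 c X by (intro CC) auto
      qed
    qed measurable
    also have "C * (c * X) powr (r / p) = C * c powr (r / p) * X powr (r / p)"
      by (simp add: powr_mult)
    finally show ?thesis .
  qed
  moreover have "0 < C * c powr (r / p)" using C c by simp
  ultimately show ?thesis by blast
qed

end

section \<open>Truncations and cutoffs\<close>

text \<open>Since \<open>f' 0 = 0\<close>, the function can be continued to the left by the constant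
  \<open>f 0\<close> without a corner. Both the smoothed positive part and the cutoff arise in this
  way.\<close>

lemma has_real_derivative_max_0:
  fixes f :: "real \<Rightarrow> real"
  assumes f: "\<And>y. 0 \<le> y \<Longrightarrow> (f has_real_derivative f' y) (at y)" and "f' 0 = 0"
  shows "((\<lambda>y. f (max 0 y)) has_real_derivative f' (max 0 y)) (at y)"
proof -
  consider "0 < y" | "y < 0" | "y = 0" by linarith
  then show ?thesis
  proof cases
    case 1
    then have "(f has_real_derivative f' (max 0 y)) (at y)" using f by auto
    then show ?thesis
      by (rule has_field_derivative_transform_within_open[where S = "{0<..}"]) (use 1 in auto)
  next
    case 2
    have "((\<lambda>_. f 0) has_real_derivative f' (max 0 y)) (at y)" using 2 assms(2) by simp
    then show ?thesis
      by (rule has_field_derivative_transform_within_open[where S = "{..<0}"]) (use 2 in auto)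
  next
    case 3
    \<comment> \<open>At 0 the modified difference quotient equals the original one for positive
      \<open>h\<close> and is 0 for negative \<open>h\<close>, hence it is dominated in absolute
      value by the original one.\<close>
    have "((\<lambda>h. (f (0 + h) - f 0) / h) \<longlongrightarrow> 0) (at 0)"
      using f[of 0] assms(2) by (simp add: DERIV_def)
    then have "((\<lambda>h. (f (max 0 h) - f 0) / h) \<longlongrightarrow> 0) (at 0)"
      by (rule Lim_transform_bound[rotated]) (rule always_eventually, auto simp: max_def divide_le_0_iff)
    then show ?thesis using 3 assms(2) by (simp add: DERIV_def)
  qed
qed

text \<open>A continuously differentiable convex substitute for the positive part: it lies between
  \<open>y - d\<close> and \<open>max 0 y\<close>, so test functions built from it need no chain rule for Lipschitz functions.\<close>
definition soft_pos :: "real \<Rightarrow> real \<Rightarrow> real" where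
  "soft_pos d y = (max 0 y)\<^sup>2 / (d + max 0 y)"

definition soft_pos' :: "real \<Rightarrow> real \<Rightarrow> real" where
  "soft_pos' d y = 1 - d\<^sup>2 / (d + max 0 y)\<^sup>2"

lemma soft_pos_deriv:
  assumes "0 < d"
  shows "(soft_pos d has_real_derivative soft_pos' d y) (at y)"
proof -
  have "((\<lambda>y. (\<lambda>z. z\<^sup>2 / (d + z)) (max 0 y)) has_real_derivative (\<lambda>z. 1 - d\<^sup>2 / (d + z)\<^sup>2) (max 0 y)) (at y)"
  proof (rule has_real_derivative_max_0)
    fix z :: real assume "0 \<le> z"
    then show "((\<lambda>z. z\<^sup>2 / (d + z)) has_real_derivative 1 - d\<^sup>2 / (d + z)\<^sup>2) (at z)"
    proof -
      define D where "D = d + z"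
      have D: "D \<noteq> 0" using \<open>0 \<le> z\<close> assms by (simp add: D_def)
      have "((\<lambda>z. z\<^sup>2 / (d + z)) has_real_derivative (2 * z * (d + z) - z\<^sup>2) / (d + z)\<^sup>2) (at z)"
        using D by (auto intro!: derivative_eq_intros simp: D_def power2_eq_square)
      moreover have "(2 * z * (d + z) - z\<^sup>2) / (d + z)\<^sup>2 = 1 - d\<^sup>2 / (d + z)\<^sup>2"
      proof -
        have "2 * z * (d + z) - z\<^sup>2 = D\<^sup>2 - d\<^sup>2" by (simp add: D_def power2_eq_square algebra_simps)
        then show ?thesis using D by (simp add: diff_divide_distrib flip: D_def)
      qed
      ultimately show ?thesis by simp
    qed
  qed (use assms in simp)
  then show ?thesis by (simp add: soft_pos_def[abs_def] soft_pos'_def)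
qed

lemma soft_pos'_continuous: "0 < d \<Longrightarrow> continuous_on UNIV (soft_pos' d)"
  unfolding soft_pos'_def by (auto intro!: continuous_intros simp: add_pos_nonneg less_imp_neq[symmetric])

lemma soft_pos'_bounds:
  assumes "0 < d"
  shows "0 \<le> soft_pos' d y" "soft_pos' d y \<le> 1"
proof -
  have "d\<^sup>2 \<le> (d + max 0 y)\<^sup>2" using assms by (intro power_mono) auto
  then show "0 \<le> soft_pos' d y" using assms by (simp add: soft_pos'_def field_simps add_pos_nonneg)
  show "soft_pos' d y \<le> 1" by (simp add: soft_pos'_def)
qed

text \<open>The second bound is the tangent inequality of a convex function vanishing at 0. It is
  the decisive one: it lets the undifferentiated factor of a test function be absorbed by the
  differentiated one.\<close>

lemma soft_pos_bounds:
  assumes "0 < d"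
  shows "0 \<le> soft_pos d y" "soft_pos d y \<le> soft_pos' d y * max 0 y" "soft_pos d y \<le> max 0 y" "y - d \<le> soft_pos d y"
proof -
  define z where "z = max 0 y"
  have z: "0 \<le> z" "0 < d + z" "y \<le> z" using assms by (auto simp: z_def add_pos_nonneg)
  show "0 \<le> soft_pos d y" using z by (simp add: soft_pos_def flip: z_def)
  have "soft_pos' d y * z - soft_pos d y = z * z * d / (d + z)\<^sup>2"
  proof -
    define D where "D = d + z"
    have D: "D \<noteq> 0" "d = D - z" using z by (auto simp: D_def)
    have "soft_pos' d y * z - soft_pos d y = (1 - (D - z)\<^sup>2 / D\<^sup>2) * z - z\<^sup>2 / D"
      using D by (simp add: soft_pos_def soft_pos'_def flip: z_def D_def)
    also have "\<dots> = z * z * (D - z) / D\<^sup>2"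
      using D(1) by (simp add: divide_simps) (simp add: algebra_simps power2_eq_square)
    finally show ?thesis by (simp add: D_def)
  qed
  moreover have "0 \<le> z * z * d / (d + z)\<^sup>2" using z assms by simp
  ultimately show 1: "soft_pos d y \<le> soft_pos' d y * max 0 y" by (simp flip: z_def)
  have "soft_pos' d y * z \<le> 1 * z" using soft_pos'_bounds[OF assms] z by (intro mult_right_mono) auto
  then show "soft_pos d y \<le> max 0 y" using 1 by (simp flip: z_def)
  have "(z - d) * (d + z) \<le> z\<^sup>2" by (simp add: algebra_simps power2_eq_square)
  then have "z - d \<le> soft_pos d y" using z by (simp add: soft_pos_def pos_le_divide_eq flip: z_def)
  then show "y - d \<le> soft_pos d y" using z by simp
qed

lemma lipschitz_of_deriv_le_1:
  fixes F :: "real \<Rightarrow> real"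
  assumes "\<And>t. (F has_real_derivative F' t) (at t)" "\<And>t. 0 \<le> F' t" "\<And>t. F' t \<le> 1"
  shows "\<bar>F x - F y\<bar> \<le> \<bar>x - y\<bar>"
  using field_differentiable_bound[of UNIV F F' 1 x y] assms by (auto simp: abs_le_iff)

text \<open>The scaling by R keeps the gradient bound independent of b; the price is that the cutoff is not 1
  on smaller balls but only bounded below there.\<close>
definition cutoff :: "real \<Rightarrow> real \<Rightarrow> nat \<Rightarrow> 'a::euclidean_space \<Rightarrow> real" where
  "cutoff R b m x = (max 0 ((b\<^sup>2 - x \<bullet> x) / R\<^sup>2)) ^ m"

definition cutoff' :: "real \<Rightarrow> real \<Rightarrow> nat \<Rightarrow> 'a::euclidean_space \<Rightarrow> 'a" where
  "cutoff' R b m x = (real m * (max 0 ((b\<^sup>2 - x \<bullet> x) / R\<^sup>2)) ^ (m - 1) * (- 2 / R\<^sup>2)) *\<^sub>R x"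

lemma cutoff_deriv:
  assumes "2 \<le> m"
  shows "(cutoff R b m has_derivative (\<lambda>h. cutoff' R b m x \<bullet> h)) (at x)"
proof -
  have 1: "((\<lambda>y. (max 0 y) ^ m) has_real_derivative (\<lambda>z. real m * z ^ (m - 1)) (max 0 y)) (at y)" for y
    using assms by (intro has_real_derivative_max_0) (auto intro!: derivative_eq_intros)
  have 2: "((\<lambda>x. (b\<^sup>2 - x \<bullet> x) / R\<^sup>2) has_derivative (\<lambda>h. (- 2 / R\<^sup>2) * (x \<bullet> h))) (at x)"
    by (auto intro!: derivative_eq_intros simp: inner_commute divide_inverse)
  from has_derivative_compose[OF 2 1[unfolded has_field_derivative_def]] show ?thesis
    unfolding cutoff_def[abs_def] by (rule has_derivative_eq_rhs) (simp add: cutoff'_def mult_ac)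
qed

lemma cutoff'_continuous: "continuous_on UNIV (cutoff' R b m)"
  unfolding cutoff'_def divide_inverse by (intro continuous_intros)

lemma cutoff_zero:
  assumes "2 \<le> m" "0 \<le> b" "b \<le> norm x"
  shows "cutoff R b m x = 0" "cutoff' R b m x = 0"
proof -
  have "b\<^sup>2 \<le> x \<bullet> x" using assms by (simp add: power2_norm_eq_inner[symmetric] power_mono)
  then have "(b\<^sup>2 - x \<bullet> x) / R\<^sup>2 \<le> 0" by (intro divide_nonpos_nonneg) auto
  then have "max 0 ((b\<^sup>2 - x \<bullet> x) / R\<^sup>2) = 0" by (rule max.absorb1)
  then show "cutoff R b m x = 0" "cutoff' R b m x = 0" using assms by (auto simp: cutoff_def cutoff'_def)
qed

lemma cutoff_bounds:
  assumes "0 < R" "0 \<le> b" "b \<le> R"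
  shows "0 \<le> cutoff R b m x" "cutoff R b m x \<le> 1"
proof -
  have "b\<^sup>2 \<le> R\<^sup>2" using assms by (intro power_mono) auto
  moreover have "0 \<le> x \<bullet> x" by (rule inner_ge_zero)
  ultimately have "b\<^sup>2 - x \<bullet> x \<le> R\<^sup>2" by linarith
  then have "(b\<^sup>2 - x \<bullet> x) / R\<^sup>2 \<le> 1" using assms by (simp add: pos_divide_le_eq)
  then show "0 \<le> cutoff R b m x" "cutoff R b m x \<le> 1"
    by (auto simp: cutoff_def intro!: power_le_one)
qed

text \<open>This positive lower bound replaces the value 1 on the smaller ball; dividing by it later
  produces a factor that grows only geometrically along the chosen radii.\<close>

lemma cutoff_lower:
  assumes "norm x \<le> c" "c \<le> b" "0 < R"
  shows "((b\<^sup>2 - c\<^sup>2) / R\<^sup>2) ^ m \<le> cutoff R b m x"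
proof -
  have c: "0 \<le> c" using assms(1) norm_ge_zero[of x] by linarith
  have "x \<bullet> x \<le> c\<^sup>2" using assms(1) by (simp add: power2_norm_eq_inner[symmetric] power_mono)
  then have "(b\<^sup>2 - c\<^sup>2) / R\<^sup>2 \<le> (b\<^sup>2 - x \<bullet> x) / R\<^sup>2" by (simp add: divide_right_mono)
  moreover have "c\<^sup>2 \<le> b\<^sup>2" using assms c by (intro power_mono) auto
  ultimately show ?thesis unfolding cutoff_def by (intro power_mono) auto
qed

text \<open>With \<open>t\<close> the base of the power, the gradient is of order
  \<open>t ^ (m - 1)\<close>, and the \<open>(p - 1) / p\<close>-th power of the cutoff is
  \<open>t powr (m * (p - 1) / p)\<close>. As \<open>t \<le> 1\<close>, the first is dominated by
  the second once \<open>m\<close> is at least \<open>p\<close>; this is why a high power is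
  taken.\<close>

lemma cutoff'_bound:
  assumes "0 < R" "0 \<le> b" "b \<le> R" "2 \<le> m" "1 < p" "p \<le> real m"
  shows "norm (cutoff' R b m x) \<le> (2 * real m / R) * cutoff R b m x powr ((p - 1) / p)"
proof (cases "norm x < b")
  case False
  then show ?thesis using cutoff_zero[OF assms(4,2), of x R] by simp
next
  case True
  define t where "t = max 0 ((b\<^sup>2 - x \<bullet> x) / R\<^sup>2)"
  have "x \<bullet> x < b\<^sup>2" using True assms by (simp add: power2_norm_eq_inner[symmetric] power_strict_mono)
  then have t0: "0 < t" using assms by (simp add: t_def)
  have "b\<^sup>2 \<le> R\<^sup>2" using assms by (intro power_mono) auto
  moreover have "0 \<le> x \<bullet> x" by (rule inner_ge_zero)
  ultimately have "b\<^sup>2 - x \<bullet> x \<le> R\<^sup>2" by linarith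
  then have t1: "t \<le> 1" using assms by (simp add: t_def pos_divide_le_eq)
  have "norm (cutoff' R b m x) = real m * t ^ (m - 1) * (2 / R\<^sup>2) * norm x"
    using t0 by (simp add: cutoff'_def abs_mult flip: t_def)
  also have "\<dots> \<le> real m * t ^ (m - 1) * (2 / R\<^sup>2) * R"
    using True assms t0 by (intro mult_left_mono) auto
  also have "\<dots> = (2 * real m / R) * t powr (real m - 1)"
    using assms t0 by (simp add: power2_eq_square powr_realpow[symmetric] of_nat_diff)
  also have "\<dots> \<le> (2 * real m / R) * t powr (real m * ((p - 1) / p))"
    using assms t0 t1 by (intro mult_left_mono powr_mono') (auto simp: field_simps)
  also have "t powr (real m * ((p - 1) / p)) = cutoff R b m x powr ((p - 1) / p)"
    using t0 by (simp add: cutoff_def powr_realpow[symmetric] powr_powr flip: t_def)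
  finally show ?thesis .
qed

text \<open>A comparison of \<open>t\<close> with \<open>2 * c\<close> takes the place of the sharp
  Young inequality; what matters is the coefficient 1/2, which allows absorption.\<close>

lemma young_powr:
  fixes c t :: real
  assumes "1 < p" "0 \<le> c" "0 \<le> t"
  shows "c * t powr (p - 1) \<le> t powr p / 2 + (2 * c) powr p"
proof (cases "2 * c \<le> t")
  case True
  have "c * t powr (p - 1) \<le> (t / 2) * t powr (p - 1)" using True by (intro mult_right_mono) auto
  also have "\<dots> = t powr p / 2"
    using assms by (cases "t = 0") (auto simp: powr_diff)
  finally show ?thesis by (simp add: add_increasing2)
next
  case False
  have "c * t powr (p - 1) \<le> (2 * c) * (2 * c) powr (p - 1)"
    using False assms by (intro mult_mono powr_mono2) auto
  also have "\<dots> = (2 * c) powr p"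
    using False assms by (simp add: powr_diff)
  finally show ?thesis by (simp add: add_increasing)
qed

text \<open>The Caccioppoli inequality already holds before integration, with \<open>h\<close> the
  gradient of the test function. The cutoff enters to the first power only: its gradient is bounded
  by \<open>zt powr ((p - 1) / p)\<close>, just what Young's inequality can absorb into the good
  term.\<close>

lemma caccioppoli_pointwise:
  fixes g z h :: "'b::real_inner"
  assumes p: "1 < p" and zt: "0 \<le> zt" "zt \<le> 1" and F': "0 \<le> F'" "F' \<le> 1"
    and F: "0 \<le> F" "F \<le> F' * s" and s: "0 \<le> s" and c: "0 \<le> c"
    and z: "norm z \<le> c * zt powr ((p - 1) / p)"
    and h: "h = (zt * F') *\<^sub>R g + F *\<^sub>R z"
  shows "norm h powr p \<le> (2 * 2 powr p) * (norm g powr (p - 2) * (g \<bullet> h))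
      + (2 powr p * (2 * (2 * c) powr p + c powr p)) * s powr p"
proof -
  define e where "e = (zt * F') powr (1 / p)"
  define t where "t = e * norm g"
  have e: "0 \<le> e" "e \<le> 1" "e powr p = zt * F'"
    using zt F' p by (auto simp: e_def powr_powr mult_le_one intro!: powr_le1)
  have t: "0 \<le> t" using e by (simp add: t_def)
  have tp: "t powr p = zt * F' * norm g powr p" using e by (simp add: t_def powr_mult)
  have Fz: "F * norm z \<le> c * s * e powr (p - 1)"
  proof -
    have "F * norm z \<le> (F' * s) * (c * zt powr ((p - 1) / p))"
      using F z s F' c by (intro mult_mono) auto
    also have "\<dots> \<le> (F' powr ((p - 1) / p) * s) * (c * zt powr ((p - 1) / p))"
    proof (intro mult_right_mono s)
      show "F' \<le> F' powr ((p - 1) / p)"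
        using F' p powr_mono'[of "(p - 1) / p" 1 F'] by (cases "F' = 0") auto
    qed (use c in auto)
    also have "\<dots> = c * s * e powr (p - 1)"
      by (simp add: e_def powr_powr powr_mult)
    finally show ?thesis .
  qed
  \<comment> \<open>Since \<open>0 powr x = 0\<close> for every exponent, the factor
    \<open>norm g powr (p - 2)\<close> is 0 at \<open>g = 0\<close> even when \<open>p < 2\<close>,
    and no singularity arises.\<close>
  have gg: "norm g powr (p - 2) * (g \<bullet> g) = norm g powr p"
  proof (cases "g = 0")
    case False
    have "norm g powr (p - 2) * norm g powr 2 = norm g powr p" by (simp only: flip: powr_add) simp
    moreover have "norm g powr 2 = g \<bullet> g" using False by (simp add: power2_norm_eq_inner)
    ultimately show ?thesis by simp
  qed (use p in auto)
  have gz: "norm g powr (p - 2) * \<bar>g \<bullet> z\<bar> \<le> norm g powr (p - 1) * norm z"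
  proof (cases "g = 0")
    case False
    have "norm g powr (p - 2) * \<bar>g \<bullet> z\<bar> \<le> norm g powr (p - 2) * (norm g * norm z)"
      by (intro mult_left_mono Cauchy_Schwarz_ineq2) auto
    also have "\<dots> = (norm g powr (p - 2) * norm g powr 1) * norm z" by simp
    also have "norm g powr (p - 2) * norm g powr 1 = norm g powr (p - 1)" by (simp only: flip: powr_add) simp
    finally show ?thesis .
  qed simp
  have eq: "norm g powr (p - 2) * (g \<bullet> h) = t powr p + F * (norm g powr (p - 2) * (g \<bullet> z))"
  proof -
    have "norm g powr (p - 2) * (g \<bullet> h) = zt * F' * (norm g powr (p - 2) * (g \<bullet> g)) + F * (norm g powr (p - 2) * (g \<bullet> z))"
      by (simp add: h inner_add_right algebra_simps)
    then show ?thesis by (simp add: gg tp)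
  qed
  have "\<bar>F * (norm g powr (p - 2) * (g \<bullet> z))\<bar> = F * (norm g powr (p - 2) * \<bar>g \<bullet> z\<bar>)"
    using F by (simp add: abs_mult)
  also have "\<dots> \<le> F * (norm g powr (p - 1) * norm z)" by (intro mult_left_mono gz F)
  also have "\<dots> = (F * norm z) * norm g powr (p - 1)" by simp
  also have "\<dots> \<le> (c * s * e powr (p - 1)) * norm g powr (p - 1)" by (intro mult_right_mono Fz) auto
  also have "\<dots> = (c * s) * t powr (p - 1)" using e by (simp add: t_def powr_mult)
  also have "\<dots> \<le> t powr p / 2 + (2 * (c * s)) powr p" using p c s t by (intro young_powr) auto
  finally have "- (F * (norm g powr (p - 2) * (g \<bullet> z))) \<le> t powr p / 2 + (2 * (c * s)) powr p"
    by (rule abs_le_D2)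
  then have T: "t powr p \<le> 2 * (norm g powr (p - 2) * (g \<bullet> h)) + 2 * (2 * (c * s)) powr p"
    unfolding eq by argo
  have "norm h \<le> norm ((zt * F') *\<^sub>R g) + norm (F *\<^sub>R z)" unfolding h by (rule norm_triangle_ineq)
  \<comment> \<open>Because \<open>0 \<le> e \<le> 1\<close> and \<open>1 < p\<close>, the
    coefficient \<open>zt * F' = e powr p\<close> is at most \<open>e\<close>.\<close>
  also have "norm ((zt * F') *\<^sub>R g) \<le> t"
  proof -
    have "e powr p \<le> e powr 1" using e(1,2) p by (intro powr_mono') auto
    then have "zt * F' \<le> e" using e by simp
    then show ?thesis using zt F' by (simp add: t_def abs_mult mult_right_mono)
  qed
  also have "norm (F *\<^sub>R z) \<le> c * s"
  proof -
    have "e powr (p - 1) \<le> 1" using e p by (intro powr_le1) auto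
    then have "c * s * e powr (p - 1) \<le> c * s * 1" using c s by (intro mult_left_mono) auto
    then show ?thesis using Fz F by simp
  qed
  finally have "norm h powr p \<le> (t + c * s) powr p" using p by (intro powr_mono2) auto
  also have "\<dots> \<le> 2 powr p * (t powr p + (c * s) powr p)"
    using norm_add_powr_le[of p t "c * s"] p t c s by simp
  also have "\<dots> \<le> 2 powr p * ((2 * (norm g powr (p - 2) * (g \<bullet> h)) + 2 * (2 * (c * s)) powr p) + (c * s) powr p)"
    using T by (intro mult_left_mono add_right_mono) auto
  also have "\<dots> = (2 * 2 powr p) * (norm g powr (p - 2) * (g \<bullet> h))
      + (2 powr p * (2 * (2 * c) powr p + c powr p)) * s powr p"
    by (simp add: powr_mult algebra_simps)
  finally show ?thesis .
qed

section \<open>De Giorgi iteration\<close>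

context weighted_annulus begin

text \<open>The approximants are \<open>\<zeta> * F (\<phi> n)\<close>. Their gradient error splits
  into three terms: the energy error of \<open>\<phi> n\<close>, the change of \<open>F'\<close>
  against the fixed gradient \<open>g\<close>, and the change of \<open>F\<close> against
  \<open>d\<zeta>\<close>. The last one carries the weight \<open>L\<close> without any gradient of
  \<open>u\<close>, which is where the integrability of a power of \<open>L\<close> is used.\<close>

lemma inD0_cutoff_compose:
  assumes q: "sobolev_exponent q" and Lq: "exp_int p q E L" and u: "inD0 p L A u g"
    and F: "\<And>t. (F has_real_derivative F' t) (at t)" "continuous_on UNIV F'" "F 0 = 0"
      "\<And>t. 0 \<le> F' t" "\<And>t. F' t \<le> 1"
    and z: "\<And>x. (\<zeta> has_derivative (\<lambda>h. d\<zeta> x \<bullet> h)) (at x)" "continuous_on UNIV d\<zeta>"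
      "\<And>x. 0 \<le> \<zeta> x" "\<And>x. \<zeta> x \<le> 1" "\<And>x. norm (d\<zeta> x) \<le> B"
      "\<And>x. R \<le> norm x \<Longrightarrow> \<zeta> x = 0" "\<And>x. R \<le> norm x \<Longrightarrow> d\<zeta> x = 0"
  shows "inD0 p L A (\<lambda>x. \<zeta> x * F (u x)) (\<lambda>x. (\<zeta> x * F' (u x)) *\<^sub>R g x + F (u x) *\<^sub>R d\<zeta> x)"
proof -
  have [measurable]: "u \<in> borel_measurable lebesgue" "g \<in> borel_measurable lebesgue" using u by (auto simp: inD0_def)
  obtain \<phi> d\<phi> where C1: "\<And>n. C1c A (\<phi> n) (d\<phi> n)"
    and lim: "(\<lambda>n. \<integral>\<^sup>+x\<in>A. ennreal (L x * norm (d\<phi> n x - g x) powr p) \<partial>lebesgue) \<longlonglongrightarrow> 0"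
    and loc: "\<And>S. compact S \<Longrightarrow> S \<subseteq> A \<Longrightarrow> (\<lambda>n. \<integral>\<^sup>+x\<in>S. ennreal \<bar>\<phi> n x - u x\<bar> \<partial>lebesgue) \<longlonglongrightarrow> 0"
    and ae: "AE x in lebesgue. x \<in> E \<longrightarrow> (\<lambda>n. \<phi> n x) \<longlonglongrightarrow> u x"
    and Lim: "(\<lambda>n. \<integral>\<^sup>+x\<in>E. ennreal (\<bar>\<phi> n x - u x\<bar> powr q) \<partial>lebesgue) \<longlonglongrightarrow> 0"
    using inD0_approx[OF q u] by blast
  have [measurable]: "\<phi> n \<in> borel_measurable lebesgue" "d\<phi> n \<in> borel_measurable lebesgue" for n
    using C1c_borel[OF C1] by auto
  have cF: "continuous_on UNIV F" using F(1) by (intro continuous_at_imp_continuous_on) (auto intro: DERIV_isCont)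
  have cz: "continuous_on UNIV \<zeta>" using z(1) by (intro continuous_at_imp_continuous_on) (auto intro: has_derivative_continuous)
  have [measurable]: "F \<in> borel_measurable borel" "F' \<in> borel_measurable borel"
    using cF F(2) by (auto intro: borel_measurable_continuous_onI)
  have [measurable]: "\<zeta> \<in> borel_measurable lebesgue" "d\<zeta> \<in> borel_measurable lebesgue"
    using cz z(2) by (auto intro!: measurable_completion borel_measurable_continuous_onI)
  have q0: "0 < p" "p \<le> q" using q p by (auto simp: sobolev_exponent_def)
  have B: "0 \<le> B" using z(5)[of 0] norm_ge_zero[of "d\<zeta> 0"] by linarith
  have lipF: "\<bar>F x - F y\<bar> \<le> \<bar>x - y\<bar>" for x y by (rule lipschitz_of_deriv_le_1[OF F(1,4,5)])
  define W where "W x = \<zeta> x * F (u x)" for x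
  define h where "h x = (\<zeta> x * F' (u x)) *\<^sub>R g x + F (u x) *\<^sub>R d\<zeta> x" for x
  define Wn where "Wn n x = \<zeta> x * F (\<phi> n x)" for n x
  define hn where "hn n x = (\<zeta> x * F' (\<phi> n x)) *\<^sub>R d\<phi> n x + F (\<phi> n x) *\<^sub>R d\<zeta> x" for n x
  have [measurable]: "W \<in> borel_measurable lebesgue" "h \<in> borel_measurable lebesgue"
    unfolding W_def h_def by measurable
  have C1n: "C1c A (Wn n) (hn n)" for n
    unfolding Wn_def hn_def by (rule C1c_compose_mult[OF C1 F(1-3) z(1,2)])
  define T1 where "T1 n = (\<integral>\<^sup>+x\<in>A. ennreal (L x * norm (d\<phi> n x - g x) powr p) \<partial>lebesgue)" for n
  define T2 where "T2 n = (\<integral>\<^sup>+x. ennreal (L x * norm (g x) powr p * (\<zeta> x * \<bar>F' (\<phi> n x) - F' (u x)\<bar>) powr p) * indicator A x \<partial>lebesgue)" for n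
  define T3 where "T3 n = (\<integral>\<^sup>+x\<in>E. ennreal (\<bar>L x\<bar> * \<bar>\<phi> n x - u x\<bar> powr p) \<partial>lebesgue)" for n
  have T1: "T1 \<longlonglongrightarrow> 0" using lim by (simp add: T1_def[abs_def])
  \<comment> \<open>Since \<open>F'\<close> is merely continuous, no rate is available; dominated
    convergence works with the energy density of \<open>g\<close> as majorant.\<close>
  have T2: "T2 \<longlonglongrightarrow> (\<integral>\<^sup>+x. 0 \<partial>(lebesgue :: 'a measure))"
    unfolding T2_def[abs_def]
  proof (rule nn_integral_dominated_convergence[where w = "\<lambda>x. ennreal (L x * norm (g x) powr p) * indicator A x"])
    show "(\<integral>\<^sup>+x\<in>A. ennreal (L x * norm (g x) powr p) \<partial>lebesgue) < \<infinity>" by (rule inD0_energy_finite[OF u])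
    show "AE x in lebesgue. ennreal (L x * norm (g x) powr p * (\<zeta> x * \<bar>F' (\<phi> n x) - F' (u x)\<bar>) powr p) * indicator A x \<le> ennreal (L x * norm (g x) powr p) * indicator A x" for n
      using L_pos
    proof eventually_elim
      fix x assume L: "x \<in> A \<longrightarrow> 0 < L x"
      have "\<bar>F' (\<phi> n x) - F' (u x)\<bar> \<le> 1"
        using F(4)[of "\<phi> n x"] F(5)[of "\<phi> n x"] F(4)[of "u x"] F(5)[of "u x"] by linarith
      then have "\<zeta> x * \<bar>F' (\<phi> n x) - F' (u x)\<bar> \<le> 1" using z(3,4)[of x] by (intro mult_le_one) auto
      then have "(\<zeta> x * \<bar>F' (\<phi> n x) - F' (u x)\<bar>) powr p \<le> 1" using z(3)[of x] q0 by (intro powr_le1) auto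
      then have "x \<in> A \<Longrightarrow> L x * norm (g x) powr p * (\<zeta> x * \<bar>F' (\<phi> n x) - F' (u x)\<bar>) powr p \<le> L x * norm (g x) powr p * 1"
        using L by (intro mult_left_mono) auto
      then show "ennreal (L x * norm (g x) powr p * (\<zeta> x * \<bar>F' (\<phi> n x) - F' (u x)\<bar>) powr p) * indicator A x \<le> ennreal (L x * norm (g x) powr p) * indicator A x"
        by (auto simp: indicator_def intro: ennreal_leI)
    qed
    show "AE x in lebesgue. (\<lambda>n. ennreal (L x * norm (g x) powr p * (\<zeta> x * \<bar>F' (\<phi> n x) - F' (u x)\<bar>) powr p) * indicator A x) \<longlonglongrightarrow> 0"
      using ae
    proof eventually_elim
      fix x assume x: "x \<in> E \<longrightarrow> (\<lambda>n. \<phi> n x) \<longlonglongrightarrow> u x"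
      \<comment> \<open>Pointwise convergence of the approximants is known only on \<open>E\<close>;
        in the rest of \<open>A\<close> the cutoff vanishes.\<close>
      consider "x \<notin> A" | "x \<in> A" "R \<le> norm x" | "x \<in> E" by (force simp: annulus_def)
      then show "(\<lambda>n. ennreal (L x * norm (g x) powr p * (\<zeta> x * \<bar>F' (\<phi> n x) - F' (u x)\<bar>) powr p) * indicator A x) \<longlonglongrightarrow> 0"
      proof cases
        case 3
        have "isCont F' (u x)" using F(2) by (simp add: continuous_on_eq_continuous_at)
        then have "(\<lambda>n. F' (\<phi> n x)) \<longlonglongrightarrow> F' (u x)" using x 3 by (auto intro: isCont_tendsto_compose)
        then have "(\<lambda>n. L x * norm (g x) powr p * (\<zeta> x * \<bar>F' (\<phi> n x) - F' (u x)\<bar>) powr p) \<longlonglongrightarrow> L x * norm (g x) powr p * (\<zeta> x * \<bar>F' (u x) - F' (u x)\<bar>) powr p"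
          using z(3)[of x] q0 by (intro tendsto_intros tendsto_powr') auto
        then have "(\<lambda>n. ennreal (L x * norm (g x) powr p * (\<zeta> x * \<bar>F' (\<phi> n x) - F' (u x)\<bar>) powr p)) \<longlonglongrightarrow> ennreal 0"
          using q0 by (intro tendsto_ennrealI) simp
        then show ?thesis using 3 E_subset_A by auto
      qed (use z(6)[of x] q0 in auto)
    qed
  qed measurable
  \<comment> \<open>Convergence in \<open>L^q(E)\<close> is converted into convergence in the
    weighted power \<open>p\<close>; \<open>Y\<close> below is the threshold at which the Hoelder
    bound equals \<open>e\<close>.\<close>
  have T3: "T3 \<longlonglongrightarrow> 0"
  proof (rule tendsto_0_if_eventually_le)
    fix e :: real assume e: "0 < e"
    obtain C where C: "0 < C" and CC: "\<And>w Y. w \<in> borel_measurable lebesgue \<Longrightarrow> 0 < Y \<Longrightarrow>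
       (\<integral>\<^sup>+x\<in>E. ennreal (\<bar>w x\<bar> powr q) \<partial>lebesgue) \<le> ennreal Y \<Longrightarrow>
       (\<integral>\<^sup>+x\<in>E. ennreal (\<bar>L x\<bar> * \<bar>w x\<bar> powr p) \<partial>lebesgue) \<le> ennreal (C * Y powr (p / q))"
      using exp_int_Holder[OF Lq _ _ q0] by auto
    define Y where "Y = (e / C) powr (q / p)"
    have Y: "0 < Y" "C * Y powr (p / q) = e" using C e q0 by (auto simp: Y_def powr_powr)
    have "\<forall>\<^sub>F n in sequentially. (\<integral>\<^sup>+x\<in>E. ennreal (\<bar>\<phi> n x - u x\<bar> powr q) \<partial>lebesgue) < ennreal Y"
      using Lim Y by (intro order_tendstoD) auto
    then show "\<forall>\<^sub>F n in sequentially. T3 n \<le> ennreal e"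
    proof eventually_elim
      case (elim n)
      then show ?case using CC[of "\<lambda>x. \<phi> n x - u x" Y] Y by (simp add: T3_def)
    qed
  qed
  have bnd: "(\<integral>\<^sup>+x\<in>A. ennreal (L x * norm (hn n x - h x) powr p) \<partial>lebesgue)
     \<le> ennreal (4 powr p) * (T1 n + T2 n + ennreal (B powr p) * T3 n)" for n
  proof -
    have "(\<integral>\<^sup>+x\<in>A. ennreal (L x * norm (hn n x - h x) powr p) \<partial>lebesgue)
      \<le> (\<integral>\<^sup>+x. ennreal (4 powr p) * (ennreal (L x * norm (d\<phi> n x - g x) powr p) * indicator A x
          + ennreal (L x * norm (g x) powr p * (\<zeta> x * \<bar>F' (\<phi> n x) - F' (u x)\<bar>) powr p) * indicator A x
          + ennreal (B powr p) * (ennreal (\<bar>L x\<bar> * \<bar>\<phi> n x - u x\<bar> powr p) * indicator E x)) \<partial>lebesgue)"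
    proof (rule nn_integral_mono_AE, use L_pos in eventually_elim)
      fix x assume L: "x \<in> A \<longrightarrow> 0 < L x"
      show "ennreal (L x * norm (hn n x - h x) powr p) * indicator A x
        \<le> ennreal (4 powr p) * (ennreal (L x * norm (d\<phi> n x - g x) powr p) * indicator A x
          + ennreal (L x * norm (g x) powr p * (\<zeta> x * \<bar>F' (\<phi> n x) - F' (u x)\<bar>) powr p) * indicator A x
          + ennreal (B powr p) * (ennreal (\<bar>L x\<bar> * \<bar>\<phi> n x - u x\<bar> powr p) * indicator E x))"
      proof (cases "x \<in> A")
        case True
        then have Lx: "0 < L x" using L by simp
        define v1 where "v1 = (\<zeta> x * F' (\<phi> n x)) *\<^sub>R (d\<phi> n x - g x)"
        define v2 where "v2 = (\<zeta> x * (F' (\<phi> n x) - F' (u x))) *\<^sub>R g x"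
        define v3 where "v3 = (F (\<phi> n x) - F (u x)) *\<^sub>R d\<zeta> x"
        have "hn n x - h x = v1 + (v2 + v3)"
          by (simp add: hn_def h_def v1_def v2_def v3_def algebra_simps)
        then have "norm (hn n x - h x) powr p \<le> 2 powr p * (norm v1 powr p + norm (v2 + v3) powr p)"
          using norm_add_powr_le[of p v1 "v2 + v3"] q0 by simp
        also have "\<dots> \<le> 2 powr p * (2 powr p * norm v1 powr p + 2 powr p * (norm v2 powr p + norm v3 powr p))"
        proof (intro mult_left_mono add_mono)
          have "1 \<le> 2 powr p" using q0 by (intro ge_one_powr_ge_zero) auto
          then show "norm v1 powr p \<le> 2 powr p * norm v1 powr p"
            using mult_right_mono[of 1 "2 powr p" "norm v1 powr p"] by simp
          show "norm (v2 + v3) powr p \<le> 2 powr p * (norm v2 powr p + norm v3 powr p)"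
            using q0 by (intro norm_add_powr_le) auto
        qed auto
        also have "\<dots> = (2 powr p * 2 powr p) * (norm v1 powr p + norm v2 powr p + norm v3 powr p)"
          by (simp add: algebra_simps)
        also have "2 powr p * 2 powr p = (4::real) powr p" by (simp flip: powr_mult)
        finally have h1: "norm (hn n x - h x) powr p \<le> 4 powr p * (norm v1 powr p + norm v2 powr p + norm v3 powr p)" .
        have "norm v1 \<le> 1 * norm (d\<phi> n x - g x)"
          unfolding v1_def using z(3,4)[of x] F(4,5)[of "\<phi> n x"]
          by (simp only: norm_scaleR) (intro mult_right_mono, auto simp: mult_le_one)
        then have n1: "norm v1 powr p \<le> norm (d\<phi> n x - g x) powr p" using q0 by (intro powr_mono2) auto
        have n2: "norm v2 powr p = norm (g x) powr p * (\<zeta> x * \<bar>F' (\<phi> n x) - F' (u x)\<bar>) powr p"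
          using z(3)[of x] by (simp add: v2_def abs_mult powr_mult mult_ac)
        have n3: "norm v3 powr p \<le> B powr p * (\<bar>\<phi> n x - u x\<bar> powr p * indicator E x)"
        proof (cases "x \<in> E")
          case True
          have "norm v3 \<le> B * \<bar>\<phi> n x - u x\<bar>"
            unfolding v3_def using mult_mono[OF lipF z(5)] by (simp add: mult.commute)
          then have "norm v3 powr p \<le> (B * \<bar>\<phi> n x - u x\<bar>) powr p" using q0 by (intro powr_mono2) auto
          then show ?thesis using True by (simp add: powr_mult)
        next
          case False
          then have "R \<le> norm x" using \<open>x \<in> A\<close> by (force simp: annulus_def)
          then show ?thesis using z(7) q0 False by (simp add: v3_def)
        qed
        have "norm (hn n x - h x) powr p \<le> 4 powr p * (norm (d\<phi> n x - g x) powr p + norm (g x) powr p * (\<zeta> x * \<bar>F' (\<phi> n x) - F' (u x)\<bar>) powr p + B powr p * (\<bar>\<phi> n x - u x\<bar> powr p * indicator E x))"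
          by (rule order.trans[OF h1]) (use n1 n2 n3 in \<open>auto intro!: mult_left_mono add_mono\<close>)
        then have "L x * norm (hn n x - h x) powr p \<le> L x * (4 powr p * (norm (d\<phi> n x - g x) powr p + norm (g x) powr p * (\<zeta> x * \<bar>F' (\<phi> n x) - F' (u x)\<bar>) powr p + B powr p * (\<bar>\<phi> n x - u x\<bar> powr p * indicator E x)))"
          using Lx by (intro mult_left_mono) auto
        also have "\<dots> = 4 powr p * (L x * norm (d\<phi> n x - g x) powr p + L x * norm (g x) powr p * (\<zeta> x * \<bar>F' (\<phi> n x) - F' (u x)\<bar>) powr p + B powr p * (\<bar>L x\<bar> * \<bar>\<phi> n x - u x\<bar> powr p * indicator E x))"
          using Lx by (simp add: algebra_simps)
        finally have "ennreal (L x * norm (hn n x - h x) powr p) \<le> ennreal (4 powr p * (L x * norm (d\<phi> n x - g x) powr p + L x * norm (g x) powr p * (\<zeta> x * \<bar>F' (\<phi> n x) - F' (u x)\<bar>) powr p + B powr p * (\<bar>L x\<bar> * \<bar>\<phi> n x - u x\<bar> powr p * indicator E x)))"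
          by (rule ennreal_leI)
        then show ?thesis
          using True Lx by (cases "x \<in> E") (simp_all flip: ennreal_mult' ennreal_plus)
      qed simp
    qed
    also have "\<dots> = ennreal (4 powr p) * (T1 n + T2 n + ennreal (B powr p) * T3 n)"
      unfolding T1_def T2_def T3_def by (simp add: nn_integral_cmult nn_integral_add)
    finally show ?thesis .
  qed
  have "(\<lambda>n. ennreal (4 powr p) * (T1 n + T2 n + ennreal (B powr p) * T3 n)) \<longlonglongrightarrow> ennreal (4 powr p) * (0 + 0 + ennreal (B powr p) * 0)"
    using T1 T2 T3 by (intro tendsto_add ennreal_tendsto_cmult) auto
  then have g0: "(\<lambda>n. \<integral>\<^sup>+x\<in>A. ennreal (L x * norm (hn n x - h x) powr p) \<partial>lebesgue) \<longlonglongrightarrow> 0"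
    unfolding mult_zero_right add_0_right
    by (rule tendsto_sandwich[OF _ _ tendsto_const, rotated 2]) (simp_all only: bnd zero_le always_eventually simp_thms)
  have l0: "(\<lambda>n. \<integral>\<^sup>+x\<in>S. ennreal \<bar>Wn n x - W x\<bar> \<partial>lebesgue) \<longlonglongrightarrow> 0" if "compact S" "S \<subseteq> A" for S
  proof (rule tendsto_sandwich[OF _ _ tendsto_const[of 0] loc[OF that]])
    have "\<bar>Wn n x - W x\<bar> \<le> \<bar>\<phi> n x - u x\<bar>" for n x
    proof -
      have "\<bar>Wn n x - W x\<bar> = \<zeta> x * \<bar>F (\<phi> n x) - F (u x)\<bar>"
        using z(3)[of x] by (simp add: Wn_def W_def abs_mult flip: right_diff_distrib)
      also have "\<dots> \<le> 1 * \<bar>\<phi> n x - u x\<bar>" using z(3,4)[of x] lipF by (intro mult_mono) auto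
      finally show ?thesis by simp
    qed
    then show "\<forall>\<^sub>F n in sequentially. (\<integral>\<^sup>+x\<in>S. ennreal \<bar>Wn n x - W x\<bar> \<partial>lebesgue) \<le> (\<integral>\<^sup>+x\<in>S. ennreal \<bar>\<phi> n x - u x\<bar> \<partial>lebesgue)"
      by (intro always_eventually allI nn_integral_mono mult_right_mono ennreal_leI) auto
  qed auto
  have "inD0 p L A W h"
    unfolding inD0_def using C1n g0 l0 \<open>W \<in> borel_measurable lebesgue\<close> \<open>h \<in> borel_measurable lebesgue\<close>
    by (intro conjI exI[of _ Wn] exI[of _ hn]) blast+
  then show ?thesis by (simp add: W_def[abs_def] h_def[abs_def])
qed

text \<open>The pointwise Caccioppoli inequality is multiplied by \<open>L\<close> and integrated,
  and the equation replaces the flux. A Bochner integral of a non-integrable function is 0 by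
  convention, so integrability of the flux must be proved before its integral can be used in an
  inequality. The set \<open>D\<close> carries the cutoff error.\<close>

lemma energy_estimate:
  assumes u: "inD0 p L A u g" and W: "inD0 p L A W h"
    and [measurable]: "K \<in> borel_measurable lebesgue" "D \<in> sets lebesgue" "w \<in> borel_measurable lebesgue"
    and D: "D \<subseteq> A"
    and eqn: "(\<integral>x\<in>A. L x * norm (g x) powr (p - 2) * (g x \<bullet> h x) \<partial>lebesgue)
             = lam * (\<integral>x\<in>A. K x * \<bar>u x\<bar> powr (p - 2) * u x * W x \<partial>lebesgue)"
    and lam: "0 < lam" and c: "0 \<le> c1" "0 \<le> c2" and Y: "0 \<le> Y1" "0 \<le> Y2"
    and pw: "\<And>x. x \<in> A \<Longrightarrow> norm (h x) powr p \<le> c1 * (norm (g x) powr (p - 2) * (g x \<bullet> h x)) + c2 * (w x powr p * indicator D x)"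
    and le1: "(\<integral>\<^sup>+x\<in>D. ennreal (\<bar>L x\<bar> * w x powr p) \<partial>lebesgue) \<le> ennreal Y1"
    and le2: "(\<integral>\<^sup>+x\<in>A. ennreal \<bar>K x * \<bar>u x\<bar> powr (p - 2) * u x * W x\<bar> \<partial>lebesgue) \<le> ennreal Y2"
  shows "(\<integral>\<^sup>+x\<in>A. ennreal (L x * norm (h x) powr p) \<partial>lebesgue) \<le> ennreal (c1 * lam * Y2 + c2 * Y1)"
proof -
  have [measurable]: "u \<in> borel_measurable lebesgue" "g \<in> borel_measurable lebesgue" using u by (auto simp: inD0_def)
  have [measurable]: "W \<in> borel_measurable lebesgue" "h \<in> borel_measurable lebesgue" using W by (auto simp: inD0_def)
  define i1 where "i1 x = indicator A x * (\<bar>L x\<bar> * norm (h x) powr p)" for x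
  define i0 where "i0 x = indicator A x * (\<bar>L x\<bar> * norm (g x) powr p)" for x
  define i2 where "i2 x = indicator A x * (L x * norm (g x) powr (p - 2) * (g x \<bullet> h x))" for x
  define i3 where "i3 x = indicator D x * (\<bar>L x\<bar> * w x powr p)" for x
  define i4 where "i4 x = indicator A x * (K x * \<bar>u x\<bar> powr (p - 2) * u x * W x)" for x
  have [measurable]: "i1 \<in> borel_measurable lebesgue" "i0 \<in> borel_measurable lebesgue" "i2 \<in> borel_measurable lebesgue" "i3 \<in> borel_measurable lebesgue" "i4 \<in> borel_measurable lebesgue"
    unfolding i0_def i1_def i2_def i3_def i4_def by measurable
  have n1: "(\<integral>\<^sup>+x. ennreal (i1 x) \<partial>lebesgue) = (\<integral>\<^sup>+x\<in>A. ennreal (L x * norm (h x) powr p) \<partial>lebesgue)"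
    using L_pos by (intro nn_integral_cong_AE, eventually_elim) (auto simp: i1_def indicator_def)
  have n0: "(\<integral>\<^sup>+x. ennreal (i0 x) \<partial>lebesgue) = (\<integral>\<^sup>+x\<in>A. ennreal (L x * norm (g x) powr p) \<partial>lebesgue)"
    using L_pos by (intro nn_integral_cong_AE, eventually_elim) (auto simp: i0_def indicator_def)
  have n3: "(\<integral>\<^sup>+x. ennreal (i3 x) \<partial>lebesgue) \<le> ennreal Y1"
    using le1 by (rule order.trans[rotated]) (auto intro!: nn_integral_mono simp: i3_def indicator_def)
  have n4: "(\<integral>\<^sup>+x. ennreal (norm (i4 x)) \<partial>lebesgue) \<le> ennreal Y2"
    using le2 by (rule order.trans[rotated]) (auto intro!: nn_integral_mono simp: i4_def indicator_def)
  have int1: "integrable lebesgue i1"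
    using inD0_energy_finite[OF W] n1 by (intro integrableI_nonneg) (auto simp: i1_def)
  have int0: "integrable lebesgue i0"
    using inD0_energy_finite[OF u] n0 by (intro integrableI_nonneg) (auto simp: i0_def)
  have int3: "integrable lebesgue i3"
    using n3 by (intro integrableI_nonneg) (auto simp: i3_def intro: le_less_trans)
  have int4: "integrable lebesgue i4"
    using n4 by (intro integrableI_bounded) (auto intro: le_less_trans)
  \<comment> \<open>The flux is dominated by the sum of the energy densities of \<open>g\<close> and
    \<open>h\<close>, by comparing both norms with the larger one.\<close>
  have int2: "integrable lebesgue i2"
  proof (rule Bochner_Integration.integrable_bound)
    show "integrable lebesgue (\<lambda>x. i0 x + i1 x)" using int0 int1 by simp
    show "AE x in lebesgue. norm (i2 x) \<le> norm (i0 x + i1 x)"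
    proof (rule AE_I2)
      fix x
      have "norm (g x) powr (p - 2) * \<bar>g x \<bullet> h x\<bar> \<le> norm (g x) powr p + norm (h x) powr p"
      proof (cases "g x = 0")
        case False
        define m where "m = max (norm (g x)) (norm (h x))"
        have m: "0 < m" "norm (g x) \<le> m" "norm (h x) \<le> m" using False by (auto simp: m_def less_max_iff_disj)
        have "norm (g x) powr (p - 2) * \<bar>g x \<bullet> h x\<bar> \<le> norm (g x) powr (p - 2) * (norm (g x) * norm (h x))"
          by (intro mult_left_mono Cauchy_Schwarz_ineq2) auto
        also have "\<dots> = (norm (g x) powr (p - 2) * norm (g x) powr 1) * norm (h x)" by simp
        also have "norm (g x) powr (p - 2) * norm (g x) powr 1 = norm (g x) powr (p - 1)" by (simp only: flip: powr_add) simp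
        also have "norm (g x) powr (p - 1) * norm (h x) \<le> m powr (p - 1) * m"
          using m p by (intro mult_mono powr_mono2) auto
        also have "\<dots> = m powr p" using m by (simp add: powr_diff)
        also have "\<dots> \<le> norm (g x) powr p + norm (h x) powr p" by (auto simp: m_def max_def)
        finally show ?thesis .
      qed (simp add: add_nonneg_nonneg)
      from mult_left_mono[OF this, of "\<bar>L x\<bar>"]
      show "norm (i2 x) \<le> norm (i0 x + i1 x)"
        by (auto simp: i0_def i1_def i2_def indicator_def abs_mult algebra_simps)
    qed
  qed measurable
  have "AE x in lebesgue. i1 x \<le> c1 * i2 x + c2 * i3 x"
    using L_pos
  proof eventually_elim
    fix x assume L: "x \<in> A \<longrightarrow> 0 < L x"
    show "i1 x \<le> c1 * i2 x + c2 * i3 x"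
    proof (cases "x \<in> A")
      case True
      then have "L x * norm (h x) powr p \<le> L x * (c1 * (norm (g x) powr (p - 2) * (g x \<bullet> h x)) + c2 * (w x powr p * indicator D x))"
        using L pw[OF True] by (intro mult_left_mono) auto
      then show ?thesis using True L by (simp add: i1_def i2_def i3_def algebra_simps)
    next
      case False
      then have "x \<notin> D" using D by auto
      with False show ?thesis by (simp add: i1_def i2_def i3_def)
    qed
  qed
  then have "(\<integral>x. i1 x \<partial>lebesgue) \<le> (\<integral>x. c1 * i2 x + c2 * i3 x \<partial>lebesgue)"
    using int1 int2 int3 by (intro integral_mono_AE) auto
  also have "\<dots> = c1 * (\<integral>x. i2 x \<partial>lebesgue) + c2 * (\<integral>x. i3 x \<partial>lebesgue)"
    using int2 int3 by simp
  also have "(\<integral>x. i2 x \<partial>lebesgue) = lam * (\<integral>x. i4 x \<partial>lebesgue)"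
    using eqn by (simp add: set_lebesgue_integral_def i2_def[abs_def] i4_def[abs_def])
  also have "c1 * (lam * (\<integral>x. i4 x \<partial>lebesgue)) + c2 * (\<integral>x. i3 x \<partial>lebesgue) \<le> c1 * (lam * Y2) + c2 * Y1"
  proof (intro add_mono mult_left_mono c)
    have "ennreal (norm (\<integral>x. i4 x \<partial>lebesgue)) \<le> ennreal Y2"
      using integral_norm_bound_ennreal[OF int4] n4 by (rule order.trans)
    then show "(\<integral>x. i4 x \<partial>lebesgue) \<le> Y2" using Y by (subst (asm) ennreal_le_iff) auto
    have "ennreal (\<integral>x. i3 x \<partial>lebesgue) = (\<integral>\<^sup>+x. ennreal (i3 x) \<partial>lebesgue)"
      using int3 by (rule nn_integral_eq_integral[symmetric]) (simp add: i3_def)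
    then have "ennreal (\<integral>x. i3 x \<partial>lebesgue) \<le> ennreal Y1" using n3 by simp
    then show "(\<integral>x. i3 x \<partial>lebesgue) \<le> Y1" using Y by (subst (asm) ennreal_le_iff) auto
  qed (use lam in auto)
  finally have "ennreal (\<integral>x. i1 x \<partial>lebesgue) \<le> ennreal (c1 * lam * Y2 + c2 * Y1)"
    by (intro ennreal_leI) (simp add: mult.assoc)
  moreover have "(\<integral>\<^sup>+x. ennreal (i1 x) \<partial>lebesgue) = ennreal (\<integral>x. i1 x \<partial>lebesgue)"
    using int1 by (rule nn_integral_eq_integral) (simp add: i1_def)
  ultimately show ?thesis using n1 by simp
qed

end

section \<open>One step of the iteration\<close>

context weighted_annulus begin

text \<open>Each factor has its own source: \<open>(1 + 3 * k0 / G)\<close> from comparing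
  \<open>u\<close> with \<open>u - k0\<close> on the right-hand side of the equation, the quotient
  of squared radii from the lower bound of the cutoff, \<open>G powr (q - r)\<close> from trading
  the power \<open>q\<close> for \<open>r\<close> above a positive level, and
  \<open>Y powr (r / q)\<close> from Hoelder followed by Sobolev. \<open>C\<close> and
  \<open>m\<close> precede all other quantities, so they may be reused at every stage.\<close>

lemma degiorgi_step:
  assumes q: "sobolev_exponent q" and r: "sobolev_exponent r" and qr: "q < r"
    and Lq: "exp_int p q E L" and Kq: "exp_int p q E K"
    and [measurable]: "K \<in> borel_measurable lebesgue" and lam: "0 < lam"
  shows "\<exists>C>0. \<exists>m::nat. \<forall>u b b' k0 G Y. weak_solution p L K A lam u \<longrightarrow> 0 \<le> k0 \<longrightarrow> 0 < G \<longrightarrow>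
     R1 < b' \<longrightarrow> b' < b \<longrightarrow> b \<le> R \<longrightarrow> 0 < Y \<longrightarrow>
     (\<integral>\<^sup>+x\<in>annulus R1 (ereal b). ennreal (max 0 (u x - k0) powr q) \<partial>lebesgue) \<le> ennreal Y \<longrightarrow>
     (\<integral>\<^sup>+x\<in>annulus R1 (ereal b'). ennreal (max 0 (u x - (k0 + G)) powr q) \<partial>lebesgue)
       \<le> ennreal (C * (1 + 3 * k0 / G) powr r * (R\<^sup>2 / (b\<^sup>2 - b'\<^sup>2)) powr (real m * r) * G powr (q - r) * Y powr (r / q))"
proof -
  have pq: "0 < p" "p \<le> q" using q p by (auto simp: sobolev_exponent_def)
  obtain CL where CL: "0 < CL" and CLL: "\<And>w Y. w \<in> borel_measurable lebesgue \<Longrightarrow> 0 < Y \<Longrightarrow>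
       (\<integral>\<^sup>+x\<in>E. ennreal (\<bar>w x\<bar> powr q) \<partial>lebesgue) \<le> ennreal Y \<Longrightarrow>
       (\<integral>\<^sup>+x\<in>E. ennreal (\<bar>L x\<bar> * \<bar>w x\<bar> powr p) \<partial>lebesgue) \<le> ennreal (CL * Y powr (p / q))"
    using exp_int_Holder[OF Lq _ _ pq] by auto
  obtain CK where CK: "0 < CK" and CKK: "\<And>w Y. w \<in> borel_measurable lebesgue \<Longrightarrow> 0 < Y \<Longrightarrow>
       (\<integral>\<^sup>+x\<in>E. ennreal (\<bar>w x\<bar> powr q) \<partial>lebesgue) \<le> ennreal Y \<Longrightarrow>
       (\<integral>\<^sup>+x\<in>E. ennreal (\<bar>K x\<bar> * \<bar>w x\<bar> powr p) \<partial>lebesgue) \<le> ennreal (CK * Y powr (p / q))"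
    using exp_int_Holder[OF Kq _ _ pq] by auto
  obtain CS where CS: "0 < CS" and CSS: "\<And>u g X. inD0 p L A u g \<Longrightarrow> 0 < X \<Longrightarrow>
     (\<integral>\<^sup>+x\<in>E. ennreal (L x * norm (g x) powr p) \<partial>lebesgue) \<le> ennreal X \<Longrightarrow>
     (\<integral>\<^sup>+x\<in>E. ennreal (\<bar>u x\<bar> powr r) \<partial>lebesgue) \<le> ennreal (CS * X powr (r / p))"
    using inD0_sobolev[OF r] by blast
  \<comment> \<open>At least 2 for a continuously differentiable cutoff, at least \<open>p\<close>
    for its gradient bound.\<close>
  define m where "m = nat \<lceil>p\<rceil> + 2"
  have m: "2 \<le> m" "p \<le> real m" unfolding m_def by linarith+
  define c where "c = 2 * real m / R"
  have R0: "0 < R" using R1 by linarith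
  have c: "0 \<le> c" using R0 by (simp add: c_def)
  define c1 where "c1 = 2 * 2 powr p"
  define c2 where "c2 = 2 powr p * (2 * (2 * c) powr p + c powr p)"
  have c12: "0 < c1" "0 \<le> c2" by (auto simp: c1_def c2_def)
  define C3 where "C3 = c1 * lam * CK + c2 * CL"
  have C3: "0 < C3" using c12 lam CK CL by (simp add: C3_def add_pos_nonneg)
  define C where "C = CS * C3 powr (r / p) * (1 / 3) powr (q - r)"
  have C: "0 < C" using CS C3 by (simp add: C_def)
  have "(\<integral>\<^sup>+x\<in>annulus R1 (ereal b'). ennreal (max 0 (u x - (k0 + G)) powr q) \<partial>lebesgue)
       \<le> ennreal (C * (1 + 3 * k0 / G) powr r * (R\<^sup>2 / (b\<^sup>2 - b'\<^sup>2)) powr (real m * r) * G powr (q - r) * Y powr (r / q))"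
    if sol: "weak_solution p L K A lam u" and k0: "0 \<le> k0" and G: "0 < G" and b: "R1 < b'" "b' < b" "b \<le> R" and Y: "0 < Y"
      and le: "(\<integral>\<^sup>+x\<in>annulus R1 (ereal b). ennreal (max 0 (u x - k0) powr q) \<partial>lebesgue) \<le> ennreal Y"
    for u b b' k0 G Y
  proof -
    obtain g where u: "inD0 p L A u g" and eqn: "\<And>\<phi> h. inD0 p L A \<phi> h \<Longrightarrow>
           (\<integral>x\<in>A. L x * norm (g x) powr (p - 2) * (g x \<bullet> h x) \<partial>lebesgue)
             = lam * (\<integral>x\<in>A. K x * \<bar>u x\<bar> powr (p - 2) * u x * \<phi> x \<partial>lebesgue)"
      using sol unfolding weak_solution_def by blast
    have [measurable]: "u \<in> borel_measurable lebesgue" "g \<in> borel_measurable lebesgue" using u by (auto simp: inD0_def)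
    define D :: "'a set" where "D = annulus R1 (ereal b)"
    have [measurable]: "D \<in> sets lebesgue" unfolding D_def by measurable
    have DE: "D \<subseteq> E" using b by (auto simp: D_def annulus_def)
    then have DA: "D \<subseteq> A" using E_subset_A by auto
    \<comment> \<open>Thirds of the gap: above \<open>k0 + G / 3\<close> the ratio of u to \<open>u - k0\<close> is bounded, the smoothing of
      the positive part costs another third, and the last one turns the q-th power into an r-th power.\<close>
    define k where "k = k0 + G / 3"
    define d where "d = G / 3"
    have d: "0 < d" using G by (simp add: d_def)
    have k: "0 \<le> k" using k0 G by (simp add: k_def)
    define F where "F t = soft_pos d (t - k)" for t
    define F' where "F' t = soft_pos' d (t - k)" for t
    have F1: "(F has_real_derivative F' t) (at t)" for t
    proof -
      have "((\<lambda>t. t - k) has_real_derivative 1) (at t)" by (auto intro!: derivative_eq_intros)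
      from DERIV_chain2[OF soft_pos_deriv[OF d] this] show ?thesis by (simp add: F_def[abs_def] F'_def)
    qed
    have F2: "continuous_on UNIV F'"
      unfolding F'_def by (intro continuous_on_compose2[OF soft_pos'_continuous[OF d]] continuous_intros) auto
    have F3: "F 0 = 0" using k by (simp add: F_def soft_pos_def)
    have F4: "0 \<le> F' t" "F' t \<le> 1" for t using soft_pos'_bounds[OF d] by (auto simp: F'_def)
    define \<zeta> :: "'a \<Rightarrow> real" where "\<zeta> = cutoff R b m"
    define d\<zeta> :: "'a \<Rightarrow> 'a" where "d\<zeta> = cutoff' R b m"
    have b0: "0 \<le> b" "0 < b'" using b R1 by auto
    have z12: "0 \<le> \<zeta> x" "\<zeta> x \<le> 1" for x using cutoff_bounds[OF R0 b0(1) b(3)] by (auto simp: \<zeta>_def)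
    have zb: "norm (d\<zeta> x) \<le> c * \<zeta> x powr ((p - 1) / p)" for x
      unfolding d\<zeta>_def \<zeta>_def c_def by (rule cutoff'_bound[OF R0 b0(1) b(3) m(1) p m(2)])
    have zb': "norm (d\<zeta> x) \<le> c" for x
    proof -
      have "\<zeta> x powr ((p - 1) / p) \<le> 1" using z12 p by (intro powr_le1) auto
      then have "c * \<zeta> x powr ((p - 1) / p) \<le> c * 1" using c by (intro mult_left_mono) auto
      then show ?thesis using zb[of x] by simp
    qed
    have z0: "\<zeta> x = 0" "d\<zeta> x = 0" if "b \<le> norm x" for x
      using cutoff_zero[OF m(1) b0(1) that] by (auto simp: \<zeta>_def d\<zeta>_def)
    define W where "W x = \<zeta> x * F (u x)" for x
    define h where "h x = (\<zeta> x * F' (u x)) *\<^sub>R g x + F (u x) *\<^sub>R d\<zeta> x" for x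
    have Wh: "inD0 p L A W h"
      unfolding W_def[abs_def] h_def[abs_def]
    proof (rule inD0_cutoff_compose[OF q Lq u F1 F2 F3 F4, where B = c])
      show "(\<zeta> has_derivative (\<lambda>h. d\<zeta> x \<bullet> h)) (at x)" for x
        unfolding \<zeta>_def d\<zeta>_def by (rule cutoff_deriv[OF m(1)])
      show "continuous_on UNIV d\<zeta>" unfolding d\<zeta>_def by (rule cutoff'_continuous)
    qed (use z12 zb' z0 b in auto)
    have [measurable]: "W \<in> borel_measurable lebesgue" "h \<in> borel_measurable lebesgue" using Wh by (auto simp: inD0_def)
    have W0: "0 \<le> W x" for x using z12 soft_pos_bounds[OF d] by (simp add: W_def F_def)
    \<comment> \<open>The truncation at the lower level, extended by zero from \<open>D\<close>:
      through it both weighted Hoelder bounds see only the given integral \<open>Y\<close>.\<close>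
    define w where "w x = indicator D x * max 0 (u x - k0)" for x
    have [measurable]: "w \<in> borel_measurable lebesgue" unfolding w_def by measurable
    have wq: "(\<integral>\<^sup>+x\<in>E. ennreal (\<bar>w x\<bar> powr q) \<partial>lebesgue) \<le> ennreal Y"
      using le by (rule order.trans[rotated]) (use pq in \<open>auto intro!: nn_integral_mono simp: w_def D_def[symmetric] indicator_def\<close>)
    \<comment> \<open>Where the test function is nonzero, \<open>u - k0\<close> exceeds
      \<open>G / 3\<close>; there \<open>k0 \<le> (3 * k0 / G) * (u - k0)\<close> and hence
      \<open>u \<le> kap * (u - k0)\<close>.\<close>
    define kap where "kap = 1 + 3 * k0 / G"
    have kap: "1 \<le> kap" using k0 G by (simp add: kap_def)
    define Y1 where "Y1 = CL * Y powr (p / q)"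
    define Y2 where "Y2 = kap powr (p - 1) * (CK * Y powr (p / q))"
    have en: "(\<integral>\<^sup>+x\<in>A. ennreal (L x * norm (h x) powr p) \<partial>lebesgue) \<le> ennreal (c1 * lam * Y2 + c2 * Y1)"
    proof (rule energy_estimate[OF u Wh, where K = K and D = D and w = w])
      show "D \<subseteq> A" by (rule DA)
      show "(\<integral>x\<in>A. L x * norm (g x) powr (p - 2) * (g x \<bullet> h x) \<partial>lebesgue)
             = lam * (\<integral>x\<in>A. K x * \<bar>u x\<bar> powr (p - 2) * u x * W x \<partial>lebesgue)" by (rule eqn[OF Wh])
      show "norm (h x) powr p \<le> c1 * (norm (g x) powr (p - 2) * (g x \<bullet> h x)) + c2 * (w x powr p * indicator D x)" if "x \<in> A" for x
      proof (cases "x \<in> D")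
        case True
        have "norm (h x) powr p \<le> c1 * (norm (g x) powr (p - 2) * (g x \<bullet> h x)) + c2 * max 0 (u x - k) powr p"
          unfolding c1_def c2_def
          by (rule caccioppoli_pointwise[where zt = "\<zeta> x" and F' = "F' (u x)" and F = "F (u x)" and z = "d\<zeta> x"])
             (use p z12 F4 c zb soft_pos_bounds[OF d] in \<open>auto simp: h_def F_def F'_def\<close>)
        also have "\<dots> \<le> c1 * (norm (g x) powr (p - 2) * (g x \<bullet> h x)) + c2 * w x powr p"
        proof -
          have "max 0 (u x - k) powr p \<le> w x powr p"
            using True G pq by (intro powr_mono2) (auto simp: w_def k_def)
          then show ?thesis using c12 by (simp add: mult_left_mono)
        qed
        finally show ?thesis using True by simp
      next
        case False
        then have "b \<le> norm x" using that by (force simp: D_def annulus_def)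
        then have "h x = 0" using z0 by (simp add: h_def)
        then show ?thesis using False pq by simp
      qed
      show "(\<integral>\<^sup>+x\<in>D. ennreal (\<bar>L x\<bar> * w x powr p) \<partial>lebesgue) \<le> ennreal Y1"
      proof -
        have "(\<integral>\<^sup>+x\<in>D. ennreal (\<bar>L x\<bar> * w x powr p) \<partial>lebesgue) \<le> (\<integral>\<^sup>+x\<in>E. ennreal (\<bar>L x\<bar> * \<bar>w x\<bar> powr p) \<partial>lebesgue)"
          using DE by (intro nn_integral_mono) (auto simp: indicator_def w_def)
        also have "\<dots> \<le> ennreal Y1" unfolding Y1_def by (intro CLL wq Y) measurable
        finally show ?thesis .
      qed
      show "(\<integral>\<^sup>+x\<in>A. ennreal \<bar>K x * \<bar>u x\<bar> powr (p - 2) * u x * W x\<bar> \<partial>lebesgue) \<le> ennreal Y2"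
      proof -
        have "(\<integral>\<^sup>+x\<in>A. ennreal \<bar>K x * \<bar>u x\<bar> powr (p - 2) * u x * W x\<bar> \<partial>lebesgue)
          \<le> (\<integral>\<^sup>+x. ennreal (kap powr (p - 1)) * (ennreal (\<bar>K x\<bar> * \<bar>w x\<bar> powr p) * indicator E x) \<partial>lebesgue)"
        proof (rule nn_integral_mono)
          fix x
          show "ennreal \<bar>K x * \<bar>u x\<bar> powr (p - 2) * u x * W x\<bar> * indicator A x \<le> ennreal (kap powr (p - 1)) * (ennreal (\<bar>K x\<bar> * \<bar>w x\<bar> powr p) * indicator E x)"
          proof (cases "x \<in> A \<and> W x \<noteq> 0")
            case True
            then have "norm x < b" using z0[of x] by (force simp: W_def)
            then have xD: "x \<in> D" using True by (simp add: D_def annulus_def)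
            then have xE: "x \<in> E" using DE by auto
            have "F (u x) \<noteq> 0" using True by (auto simp: W_def)
            then have uk: "k < u x" by (auto simp: F_def soft_pos_def max_def split: if_splits)
            have u0: "0 < u x" using uk k by linarith
            define v where "v = u x - k0"
            have v: "G / 3 < v" using uk by (simp add: v_def k_def)
            then have v0: "0 < v" using G by linarith
            have wv: "w x = v" using xD v0 by (simp add: w_def v_def)
            have ukap: "u x \<le> kap * v"
            proof -
              have "k0 * G \<le> k0 * (3 * v)" using v k0 by (intro mult_left_mono) auto
              then have "k0 \<le> 3 * k0 / G * v" using G by (simp add: field_simps)
              then show ?thesis by (simp add: kap_def v_def algebra_simps)
            qed
            have "W x \<le> 1 * max 0 (u x - k)"
              unfolding W_def F_def using z12 soft_pos_bounds[OF d] by (intro mult_mono) auto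
            also have "\<dots> \<le> v" using v0 G by (simp add: v_def k_def)
            finally have Wv: "W x \<le> v" .
            have "\<bar>u x\<bar> powr (p - 2) * u x = u x powr (p - 1)"
            proof -
              have "u x powr (p - 2) * u x powr 1 = u x powr (p - 1)" by (simp only: flip: powr_add) simp
              then show ?thesis using u0 by simp
            qed
            then have "\<bar>K x * \<bar>u x\<bar> powr (p - 2) * u x * W x\<bar> = \<bar>K x\<bar> * (u x powr (p - 1) * W x)"
              using W0[of x] by (simp add: abs_mult mult.assoc)
            also have "\<dots> \<le> \<bar>K x\<bar> * ((kap * v) powr (p - 1) * v)"
              using ukap u0 p Wv W0[of x] by (intro mult_left_mono mult_mono powr_mono2) auto
            also have "\<dots> = kap powr (p - 1) * (\<bar>K x\<bar> * \<bar>w x\<bar> powr p)"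
            proof -
              have "v powr (p - 1) * v powr 1 = v powr p" by (simp only: flip: powr_add) simp
              then show ?thesis using v0 by (simp add: wv powr_mult)
            qed
            finally show ?thesis using xE True by (simp flip: ennreal_mult' add: ennreal_leI)
          qed auto
        qed
        also have "\<dots> = ennreal (kap powr (p - 1)) * (\<integral>\<^sup>+x\<in>E. ennreal (\<bar>K x\<bar> * \<bar>w x\<bar> powr p) \<partial>lebesgue)"
          by (intro nn_integral_cmult) measurable
        also have "\<dots> \<le> ennreal (kap powr (p - 1)) * ennreal (CK * Y powr (p / q))"
          by (intro mult_left_mono CKK wq Y) auto
        also have "\<dots> = ennreal Y2" using CK by (simp flip: ennreal_mult' add: Y2_def)
        finally show ?thesis .
      qed
    qed (use lam c12 CL CK in \<open>auto simp: Y1_def Y2_def\<close>)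
    \<comment> \<open>As \<open>1 \<le> kap\<close>, both energy contributions may be given the
      common factor \<open>kap powr p\<close>, which the Sobolev power \<open>r / p\<close> turns
      into \<open>kap powr r\<close>.\<close>
    define X where "X = C3 * kap powr p * Y powr (p / q)"
    have X: "0 < X" using C3 kap Y by (simp add: X_def)
    have "c1 * lam * Y2 + c2 * Y1 \<le> X"
    proof -
      have "kap powr (p - 1) \<le> kap powr p" using kap by (intro powr_mono) auto
      then have "c1 * lam * CK * Y powr (p / q) * kap powr (p - 1) \<le> c1 * lam * CK * Y powr (p / q) * kap powr p"
        using c12 lam CK by (intro mult_left_mono) auto
      moreover have "1 \<le> kap powr p" using kap pq by (intro ge_one_powr_ge_zero) auto
      then have "c2 * CL * Y powr (p / q) * 1 \<le> c2 * CL * Y powr (p / q) * kap powr p"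
        using c12 CL by (intro mult_left_mono) auto
      ultimately show ?thesis by (simp add: X_def C3_def Y1_def Y2_def algebra_simps)
    qed
    then have "(\<integral>\<^sup>+x\<in>A. ennreal (L x * norm (h x) powr p) \<partial>lebesgue) \<le> ennreal X"
      using en by (meson ennreal_leI order.trans)
    moreover have "(\<integral>\<^sup>+x\<in>E. ennreal (L x * norm (h x) powr p) \<partial>lebesgue) \<le> (\<integral>\<^sup>+x\<in>A. ennreal (L x * norm (h x) powr p) \<partial>lebesgue)"
      using E_subset_A by (intro nn_integral_mono) (auto simp: indicator_def)
    ultimately have "(\<integral>\<^sup>+x\<in>E. ennreal (L x * norm (h x) powr p) \<partial>lebesgue) \<le> ennreal X" by (rule order.trans[rotated])
    then have SW: "(\<integral>\<^sup>+x\<in>E. ennreal (\<bar>W x\<bar> powr r) \<partial>lebesgue) \<le> ennreal (CS * X powr (r / p))"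
      by (rule CSS[OF Wh X])
    define th where "th = (b\<^sup>2 - b'\<^sup>2) / R\<^sup>2"
    have "b'\<^sup>2 < b\<^sup>2" using b b0 by (intro power_strict_mono) auto
    then have th: "0 < th" using R0 by (simp add: th_def)
    \<comment> \<open>The first factor removes the cutoff on the smaller shell; the second uses
      \<open>q < r\<close> and the lower bound \<open>G / 3\<close> for the shifted
      truncation.\<close>
    define H where "H = (1 / th ^ m) powr r * (G / 3) powr (q - r)"
    have r0: "0 < r" using qr pq by linarith
    have H: "0 \<le> H" by (simp add: H_def)
    have "(\<integral>\<^sup>+x\<in>annulus R1 (ereal b'). ennreal (max 0 (u x - (k0 + G)) powr q) \<partial>lebesgue)
      \<le> (\<integral>\<^sup>+x. ennreal H * (ennreal (\<bar>W x\<bar> powr r) * indicator E x) \<partial>lebesgue)"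
    proof (rule nn_integral_mono)
      fix x
      show "ennreal (max 0 (u x - (k0 + G)) powr q) * indicator (annulus R1 (ereal b')) x \<le> ennreal H * (ennreal (\<bar>W x\<bar> powr r) * indicator E x)"
      proof (cases "x \<in> annulus R1 (ereal b') \<and> k0 + G < u x")
        case True
        then have xb: "norm x < b'" and xE: "x \<in> E" using b by (auto simp: annulus_def)
        define v where "v = u x - k0 - 2 * G / 3"
        have v: "G / 3 < v" "u x - (k0 + G) \<le> v" using True G by (auto simp: v_def)
        then have v0: "0 < v" using G by linarith
        have "th ^ m \<le> \<zeta> x" unfolding th_def \<zeta>_def using xb b R0 by (intro cutoff_lower) auto
        moreover have "v \<le> F (u x)"
          using soft_pos_bounds(4)[OF d, of "u x - k"] by (simp add: F_def v_def k_def d_def)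
        ultimately have "th ^ m * v \<le> W x" unfolding W_def using th v0 z12 by (intro mult_mono) auto
        then have "v \<le> (1 / th ^ m) * W x" using th by (simp add: field_simps)
        then have "v powr r \<le> ((1 / th ^ m) * W x) powr r" using v0 r0 by (intro powr_mono2) auto
        then have vr: "v powr r \<le> (1 / th ^ m) powr r * W x powr r" by (simp only: powr_mult)
        have "max 0 (u x - (k0 + G)) powr q \<le> v powr q" using v v0 pq by (intro powr_mono2) auto
        also have "\<dots> = v powr (q - r) * v powr r" by (simp flip: powr_add)
        also have "\<dots> \<le> (G / 3) powr (q - r) * ((1 / th ^ m) powr r * W x powr r)"
          using v G qr vr by (intro mult_mono powr_mono2') auto
        also have "\<dots> = H * \<bar>W x\<bar> powr r" using W0[of x] by (simp add: H_def)
        finally have "ennreal (max 0 (u x - (k0 + G)) powr q) \<le> ennreal H * ennreal (\<bar>W x\<bar> powr r)"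
          using H by (subst ennreal_mult[symmetric]) (auto intro!: ennreal_leI)
        then show ?thesis using xE True by simp
      next
        case False
        then show ?thesis using pq by (auto simp: indicator_def max_def)
      qed
    qed
    also have "\<dots> = ennreal H * (\<integral>\<^sup>+x\<in>E. ennreal (\<bar>W x\<bar> powr r) \<partial>lebesgue)"
      by (intro nn_integral_cmult) measurable
    also have "\<dots> \<le> ennreal H * ennreal (CS * X powr (r / p))" by (intro mult_left_mono SW) auto
    also have "\<dots> = ennreal (H * (CS * X powr (r / p)))" using H by (simp flip: ennreal_mult')
    also have "H * (CS * X powr (r / p)) = C * (1 + 3 * k0 / G) powr r * (R\<^sup>2 / (b\<^sup>2 - b'\<^sup>2)) powr (real m * r) * G powr (q - r) * Y powr (r / q)"
    proof -
      have "X powr (r / p) = C3 powr (r / p) * kap powr r * Y powr (r / q)"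
        using pq by (simp add: X_def powr_mult powr_powr)
      moreover have "(1 / th ^ m) powr r = (R\<^sup>2 / (b\<^sup>2 - b'\<^sup>2)) powr (real m * r)"
      proof -
        have e: "R\<^sup>2 / (b\<^sup>2 - b'\<^sup>2) = 1 / th" by (simp add: th_def)
        have "(1 / th) powr (real m * r) = ((1 / th) powr real m) powr r" by (simp add: powr_powr)
        also have "(1 / th) powr real m = 1 / th ^ m" using th by (simp add: powr_realpow power_one_over)
        finally show ?thesis using e by simp
      qed
      moreover have "(G / 3) powr (q - r) = G powr (q - r) * (1 / 3) powr (q - r)"
        by (simp flip: powr_mult)
      ultimately show ?thesis by (simp add: H_def C_def kap_def)
    qed
    finally show ?thesis .
  qed
  with C show ?thesis by blast
qed

end

section \<open>Symmetry under change of sign\<close>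

lemma C1c_uminus: "C1c A \<phi> d\<phi> \<Longrightarrow> C1c A (\<lambda>x. - \<phi> x) (\<lambda>x. - d\<phi> x)"
  unfolding C1c_def by (auto intro!: derivative_eq_intros continuous_intros)

lemma inD0_uminus:
  assumes "inD0 p L A u g"
  shows "inD0 p L A (\<lambda>x. - u x) (\<lambda>x. - g x)"
proof -
  obtain \<phi> d\<phi> where 1: "\<And>n. C1c A (\<phi> n) (d\<phi> n)"
    and 2: "(\<lambda>n. \<integral>\<^sup>+x\<in>A. ennreal (L x * norm (d\<phi> n x - g x) powr p) \<partial>lebesgue) \<longlonglongrightarrow> 0"
    and 3: "\<And>S. compact S \<Longrightarrow> S \<subseteq> A \<Longrightarrow> (\<lambda>n. \<integral>\<^sup>+x\<in>S. ennreal \<bar>\<phi> n x - u x\<bar> \<partial>lebesgue) \<longlonglongrightarrow> 0"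
    using assms unfolding inD0_def by blast
  have n: "norm (- d\<phi> n x - - g x) = norm (d\<phi> n x - g x)" "\<bar>- \<phi> n x - - u x\<bar> = \<bar>\<phi> n x - u x\<bar>" for n x
    by (simp_all add: norm_minus_commute)
  have "(\<lambda>x. - u x) \<in> borel_measurable lebesgue" "(\<lambda>x. - g x) \<in> borel_measurable lebesgue"
    using assms by (auto simp: inD0_def)
  then show ?thesis
    unfolding inD0_def using C1c_uminus[OF 1] 2 3
    by (intro conjI exI[of _ "\<lambda>n x. - \<phi> n x"] exI[of _ "\<lambda>n x. - d\<phi> n x"]) (simp_all only: n, blast+)
qed

text \<open>Both sides of the equation are odd in \<open>u\<close>. An upper bound valid for every
  solution therefore bounds the absolute value as well.\<close>

lemma weak_solution_uminus:
  assumes "weak_solution p L K A lam u"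
  shows "weak_solution p L K A lam (\<lambda>x. - u x)"
proof -
  obtain g where g: "inD0 p L A u g" and e: "\<And>\<phi> h. inD0 p L A \<phi> h \<Longrightarrow>
           (\<integral>x\<in>A. L x * norm (g x) powr (p - 2) * (g x \<bullet> h x) \<partial>lebesgue)
             = lam * (\<integral>x\<in>A. K x * \<bar>u x\<bar> powr (p - 2) * u x * \<phi> x \<partial>lebesgue)"
    using assms unfolding weak_solution_def by blast
  have "(\<integral>x\<in>A. L x * norm (- g x) powr (p - 2) * (- g x \<bullet> h x) \<partial>lebesgue)
      = lam * (\<integral>x\<in>A. K x * \<bar>- u x\<bar> powr (p - 2) * - u x * \<phi> x \<partial>lebesgue)" if "inD0 p L A \<phi> h" for \<phi> h
    using e[OF that] by (simp add: set_lebesgue_integral_def)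
  then show ?thesis unfolding weak_solution_def using inD0_uminus[OF g] by blast
qed

section \<open>Convergence of the iteration\<close>

context weighted_annulus begin

text \<open>Levels increase to \<open>M\<close> and radii decrease to \<open>R1 + eps\<close>, both
  geometrically with ratio 1/2. The step bound is homogeneous of degree \<open>q\<close> in
  \<open>M\<close>: the gap contributes \<open>M powr (q - r)\<close> and the data
  \<open>M powr r\<close>. Thus the threshold \<open>z0\<close> is independent of \<open>u\<close>,
  and \<open>M\<close> can be taken proportional to \<open>1 + I powr (1 / q)\<close>, where the 1
  keeps the gaps positive when \<open>I = 0\<close>.\<close>

lemma degiorgi_upper_bound:
  assumes q: "sobolev_exponent q" and r: "sobolev_exponent r" and qr: "q < r"
    and Lq: "exp_int p q E L" and Kq: "exp_int p q E K"
    and K: "K \<in> borel_measurable lebesgue" and lam: "0 < lam"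
    and eps: "0 < eps" and R: "R = R1 + 2 * eps"
  shows "\<exists>C>0. \<forall>u I. weak_solution p L K A lam u \<longrightarrow> 0 \<le> I \<longrightarrow>
     (\<integral>\<^sup>+x\<in>E. ennreal (\<bar>u x\<bar> powr q) \<partial>lebesgue) \<le> ennreal I \<longrightarrow>
     (AE x in lebesgue. x \<in> annulus R1 (ereal (R1 + eps)) \<longrightarrow> u x \<le> C * (1 + I powr (1 / q)))"
proof -
  have q0: "0 < q" "0 < r" using q r p by (auto simp: sobolev_exponent_def)
  obtain C m where C: "0 < C" and step: "\<And>u b b' k0 G Y. weak_solution p L K A lam u \<Longrightarrow> 0 \<le> k0 \<Longrightarrow> 0 < G \<Longrightarrow>
     R1 < b' \<Longrightarrow> b' < b \<Longrightarrow> b \<le> R \<Longrightarrow> 0 < Y \<Longrightarrow>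
     (\<integral>\<^sup>+x\<in>annulus R1 (ereal b). ennreal (max 0 (u x - k0) powr q) \<partial>lebesgue) \<le> ennreal Y \<Longrightarrow>
     (\<integral>\<^sup>+x\<in>annulus R1 (ereal b'). ennreal (max 0 (u x - (k0 + G)) powr q) \<partial>lebesgue)
       \<le> ennreal (C * (1 + 3 * k0 / G) powr r * (R\<^sup>2 / (b\<^sup>2 - b'\<^sup>2)) powr (real m * r) * G powr (q - r) * Y powr (r / q))"
    using degiorgi_step[OF q r qr Lq Kq K lam] by blast
  define gam where "gam = r / q - 1"
  have gam: "0 < gam" "r / q = 1 + gam" using qr q0 by (auto simp: gam_def field_simps)
  \<comment> \<open>The total growth exponent in \<open>2 ^ j\<close> at stage \<open>j\<close>:
    \<open>r\<close> from the ratio of level to gap, \<open>real m * r\<close> from the radii,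
    \<open>r - q\<close> from the gap.\<close>
  define bet where "bet = r + real m * r + (r - q)"
  have "0 \<le> real m * r" using q0 by simp
  then have bet: "0 < bet" unfolding bet_def using q0 qr by linarith
  define D where "D = R\<^sup>2 / (eps * R1)"
  have R0: "0 < R" using R1 by linarith
  have D: "0 < D" using R0 R1 eps by (simp add: D_def)
  \<comment> \<open>All factors independent of the stage: 7 bounds \<open>1 + 3 * k j / G\<close>
    relative to \<open>2 ^ j\<close>, \<open>D\<close> does the same for the radii, and 2 comes from
    the gap \<open>M / (2 * 2 ^ j)\<close>.\<close>
  define C' where "C' = C * 7 powr r * D powr (real m * r) * 2 powr (r - q)"
  have C': "0 < C'" using C D by (simp add: C'_def)
  \<comment> \<open>Defined by \<open>om powr gam = 2 powr (- bet)\<close>, so that the superlinear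
    excess of \<open>om ^ j\<close> cancels the growth of the constants exactly.\<close>
  define om :: real where "om = 2 powr (- bet / gam)"
  have om: "0 < om" "om < 1"
  proof -
    have "- bet / gam < 0" using bet gam by (simp add: divide_neg_pos)
    then have "om < 2 powr 0" unfolding om_def by (intro powr_less_mono) auto
    then show "om < 1" by simp
  qed (simp add: om_def)
  \<comment> \<open>The starting size for which one step multiplies the bound by exactly
    \<open>om\<close>, since \<open>C' * z0 powr gam = om\<close>.\<close>
  define z0 where "z0 = (om / C') powr (1 / gam)"
  have z0: "0 < z0" "C' * z0 powr gam = om" using om C' gam by (auto simp: z0_def powr_powr)
  \<comment> \<open>Makes the initial integral admissible: \<open>M powr q * z0\<close> equals
    \<open>(1 + I powr (1 / q)) powr q\<close>, which is at least \<open>I\<close>.\<close>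
  define c where "c = z0 powr (- 1 / q)"
  have c: "0 < c" using z0 by (simp add: c_def)
  have "AE x in lebesgue. x \<in> annulus R1 (ereal (R1 + eps)) \<longrightarrow> u x \<le> c * (1 + I powr (1 / q))"
    if sol: "weak_solution p L K A lam u" and I: "0 \<le> I" and le: "(\<integral>\<^sup>+x\<in>E. ennreal (\<bar>u x\<bar> powr q) \<partial>lebesgue) \<le> ennreal I" for u I
  proof -
    have [measurable]: "u \<in> borel_measurable lebesgue"
      using sol by (auto simp: weak_solution_def inD0_def)
    define M where "M = c * (1 + I powr (1 / q))"
    have M: "0 < M" using c by (simp add: M_def add_pos_nonneg)
    have MI: "I \<le> M powr q * z0"
    proof -
      have "I = (I powr (1 / q)) powr q" using I q0 by (simp add: powr_powr)
      also have "\<dots> \<le> (1 + I powr (1 / q)) powr q" using q0 by (intro powr_mono2) auto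
      also have "\<dots> = M powr q * z0"
      proof -
        have "c powr q = z0 powr (- 1 / q * q)" by (simp only: c_def powr_powr)
        then have "c powr q = 1 / z0" using z0 q0 by (simp add: powr_minus_divide)
        then show ?thesis using z0 by (simp add: M_def powr_mult)
      qed
      finally show ?thesis .
    qed
    define Y where "Y j = M powr q * z0 * om ^ j" for j :: nat
    have Y: "0 < Y j" for j using M z0 om by (simp add: Y_def)
    define b where "b j = R1 + eps * (1 + (1/2) ^ j)" for j :: nat
    define k where "k j = M * (1 - (1/2) ^ j)" for j :: nat
    have half: "0 < (1/2::real) ^ j" "(1/2::real) ^ j \<le> 1" for j by (auto simp: power_le_one)
    have P: "(\<integral>\<^sup>+x\<in>annulus R1 (ereal (b j)). ennreal (max 0 (u x - k j) powr q) \<partial>lebesgue) \<le> ennreal (Y j)" for j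
    proof (induction j)
      case 0
      have "(\<integral>\<^sup>+x\<in>annulus R1 (ereal (b 0)). ennreal (max 0 (u x - k 0) powr q) \<partial>lebesgue) \<le> (\<integral>\<^sup>+x\<in>E. ennreal (\<bar>u x\<bar> powr q) \<partial>lebesgue)"
        using q0 by (intro nn_integral_mono) (auto simp: b_def k_def R indicator_def mult.commute intro!: ennreal_leI powr_mono2)
      also have "\<dots> \<le> ennreal I" by (rule le)
      also have "\<dots> \<le> ennreal (Y 0)" using MI by (intro ennreal_leI) (simp add: Y_def)
      finally show ?case .
    next
      case (Suc j)
      define t :: real where "t = 2 ^ j"
      have t: "1 \<le> t" "(1/2) ^ j = 1 / t" by (auto simp: t_def power_one_over)
      define G where "G = M / (2 * t)"
      have G: "0 < G" using M t by (simp add: G_def)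
      have kS: "k j + G = k (Suc j)" using t by (simp add: k_def G_def field_simps)
      have k0: "0 \<le> k j" using M half[of j] by (simp add: k_def)
      have bj: "b j - b (Suc j) = eps / (2 * t)" using t by (simp add: b_def field_simps)
      have bb: "R1 < b (Suc j)" "b (Suc j) < b j" "b j \<le> R"
      proof -
        show "R1 < b (Suc j)" using eps half[of "Suc j"] by (simp add: b_def add_pos_pos)
        have "0 < eps / (2 * t)" using eps t by simp
        then show "b (Suc j) < b j" using bj by linarith
        have "eps * (1 + (1/2) ^ j) \<le> eps * 2" using eps half[of j] by (intro mult_left_mono) auto
        then show "b j \<le> R" by (simp add: b_def R)
      qed
      have kap: "(1 + 3 * k j / G) powr r \<le> 7 powr r * t powr r"
      proof -
        have "3 * k j / G = 6 * t * (1 - 1 / t)" using M t by (simp add: k_def G_def)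
        also have "\<dots> \<le> 6 * t" using t by (simp add: algebra_simps)
        finally have "1 + 3 * k j / G \<le> 7 * t" using t by linarith
        moreover have "0 \<le> 3 * k j / G" using k0 G by simp
        ultimately have "(1 + 3 * k j / G) powr r \<le> (7 * t) powr r" using q0 by (intro powr_mono2) auto
        then show ?thesis by (simp add: powr_mult)
      qed
      have rad: "(R\<^sup>2 / ((b j)\<^sup>2 - (b (Suc j))\<^sup>2)) powr (real m * r) \<le> D powr (real m * r) * t powr (real m * r)"
      proof -
        have "(eps / (2 * t)) * (2 * R1) \<le> (b j - b (Suc j)) * (b j + b (Suc j))"
          unfolding bj using eps t bb R1 by (intro mult_left_mono) auto
        also have "\<dots> = (b j)\<^sup>2 - (b (Suc j))\<^sup>2" by (simp add: power2_eq_square algebra_simps)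
        finally have low: "eps * R1 / t \<le> (b j)\<^sup>2 - (b (Suc j))\<^sup>2" by simp
        have pos: "0 < eps * R1 / t" using eps R1 t by simp
        have "R\<^sup>2 / ((b j)\<^sup>2 - (b (Suc j))\<^sup>2) \<le> R\<^sup>2 / (eps * R1 / t)"
          using low pos by (intro divide_left_mono mult_pos_pos) auto
        also have "\<dots> = D * t" by (simp add: D_def)
        finally have "R\<^sup>2 / ((b j)\<^sup>2 - (b (Suc j))\<^sup>2) \<le> D * t" .
        moreover have "0 \<le> R\<^sup>2 / ((b j)\<^sup>2 - (b (Suc j))\<^sup>2)" using low pos by simp
        ultimately have "(R\<^sup>2 / ((b j)\<^sup>2 - (b (Suc j))\<^sup>2)) powr (real m * r) \<le> (D * t) powr (real m * r)"
          using q0 by (intro powr_mono2) auto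
        then show ?thesis by (simp add: powr_mult)
      qed
      have Gp: "G powr (q - r) = M powr (q - r) * (2 powr (r - q) * t powr (r - q))"
      proof -
        have "G powr (q - r) = M powr (q - r) * (1 / (2 * t)) powr (q - r)"
          by (simp add: G_def flip: powr_mult)
        also have "(1 / (2 * t)) powr (q - r) = (2 * t) powr (r - q)"
          using powr_minus_divide[of "2 * t" "q - r"] by (simp add: powr_divide)
        finally show ?thesis by (simp add: powr_mult)
      qed
      define wj where "wj = om ^ j"
      have wj: "0 < wj" "wj = t powr (- bet / gam)"
      proof -
        show "0 < wj" using om by (simp add: wj_def)
        have "wj = om powr real j" using om by (simp add: wj_def powr_realpow)
        also have "\<dots> = (2 powr real j) powr (- bet / gam)" by (simp add: om_def powr_powr mult.commute)
        also have "2 powr real j = t" by (simp add: t_def powr_realpow)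
        finally show "wj = t powr (- bet / gam)" .
      qed
      have Yp: "Y j powr (r / q) = M powr r * (z0 * z0 powr gam) * (wj * wj powr gam)"
      proof -
        have "Y j powr (r / q) = (M powr q) powr (r / q) * z0 powr (r / q) * wj powr (r / q)"
          by (simp add: Y_def wj_def powr_mult)
        also have "(M powr q) powr (r / q) = M powr r" using q0 by (simp add: powr_powr)
        also have "z0 powr (r / q) = z0 * z0 powr gam" using z0 by (simp add: gam powr_add)
        also have "wj powr (r / q) = wj * wj powr gam" using wj by (simp add: gam powr_add)
        finally show ?thesis .
      qed
      \<comment> \<open>The induction closes here: the powers of \<open>t\<close> collected from the
        step sum to \<open>bet\<close>, and \<open>wj powr gam\<close> is
        \<open>t powr (- bet)\<close>.\<close>
      have cancel: "t powr r * t powr (real m * r) * t powr (r - q) * wj powr gam = 1"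
      proof -
        have "wj powr gam = t powr (- bet)" using wj gam t by (simp add: powr_powr)
        then have "t powr r * t powr (real m * r) * t powr (r - q) * wj powr gam = t powr (r + real m * r + (r - q) + - bet)"
          by (simp only: powr_add)
        also have "r + real m * r + (r - q) + - bet = 0" by (simp add: bet_def)
        finally show ?thesis using t by simp
      qed
      have "(\<integral>\<^sup>+x\<in>annulus R1 (ereal (b (Suc j))). ennreal (max 0 (u x - k (Suc j)) powr q) \<partial>lebesgue)
        \<le> ennreal (C * (1 + 3 * k j / G) powr r * (R\<^sup>2 / ((b j)\<^sup>2 - (b (Suc j))\<^sup>2)) powr (real m * r) * G powr (q - r) * Y j powr (r / q))"
        using step[OF sol k0 G bb Y Suc.IH] by (simp add: kS)
      also have "\<dots> \<le> ennreal (Y (Suc j))"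
      proof (rule ennreal_leI)
        have "C * (1 + 3 * k j / G) powr r * (R\<^sup>2 / ((b j)\<^sup>2 - (b (Suc j))\<^sup>2)) powr (real m * r) * G powr (q - r) * Y j powr (r / q)
          \<le> C * (7 powr r * t powr r) * (D powr (real m * r) * t powr (real m * r)) * G powr (q - r) * Y j powr (r / q)"
          using C kap rad by (intro mult_right_mono mult_mono) auto
        also have "\<dots> = (C' * z0 powr gam) * (M powr (q - r) * M powr r) * z0 * wj * (t powr r * t powr (real m * r) * t powr (r - q) * wj powr gam)"
          unfolding Gp Yp C'_def by (simp only: mult_ac)
        also have "\<dots> = Y (Suc j)"
          unfolding cancel z0(2) by (simp add: Y_def wj_def flip: powr_add)
        finally show "C * (1 + 3 * k j / G) powr r * (R\<^sup>2 / ((b j)\<^sup>2 - (b (Suc j))\<^sup>2)) powr (real m * r) * G powr (q - r) * Y j powr (r / q) \<le> Y (Suc j)" .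
      qed
      finally show ?case .
    qed
    \<comment> \<open>All levels stay below \<open>M\<close> and all radii above
      \<open>R1 + eps\<close>, so this limiting integral lies below every \<open>Y j\<close> and
      must vanish.\<close>
    define N where "N = (\<integral>\<^sup>+x\<in>annulus R1 (ereal (R1 + eps)). ennreal (max 0 (u x - M) powr q) \<partial>lebesgue)"
    have "N \<le> ennreal (Y j)" for j
    proof -
      have "N \<le> (\<integral>\<^sup>+x\<in>annulus R1 (ereal (b j)). ennreal (max 0 (u x - k j) powr q) \<partial>lebesgue)"
        unfolding N_def
      proof (rule nn_integral_mono)
        fix x
        have "k j \<le> M" using M half[of j] by (simp add: k_def algebra_simps)
        then have 1: "max 0 (u x - M) powr q \<le> max 0 (u x - k j) powr q" using q0 by (intro powr_mono2) auto
        have "R1 + eps \<le> b j" using eps half[of j] by (simp add: b_def algebra_simps)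
        then have 2: "indicator (annulus R1 (ereal (R1 + eps))) x \<le> (indicator (annulus R1 (ereal (b j))) x :: ennreal)"
          by (auto simp: indicator_def annulus_def)
        show "ennreal (max 0 (u x - M) powr q) * indicator (annulus R1 (ereal (R1 + eps))) x
          \<le> ennreal (max 0 (u x - k j) powr q) * indicator (annulus R1 (ereal (b j))) x"
          using 1 2 by (intro mult_mono ennreal_leI) auto
      qed
      then show ?thesis using P[of j] by (rule order.trans)
    qed
    moreover have "(\<lambda>j. ennreal (Y j)) \<longlonglongrightarrow> ennreal 0"
    proof (rule tendsto_ennrealI)
      have "(\<lambda>j. om ^ j) \<longlonglongrightarrow> 0" using om by (intro LIMSEQ_power_zero) auto
      then show "Y \<longlonglongrightarrow> 0" unfolding Y_def[abs_def] by (rule tendsto_mult_right_zero)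
    qed
    ultimately have "N \<le> ennreal 0" by (intro tendsto_lowerbound[of "\<lambda>j. ennreal (Y j)"]) auto
    then have "N = 0" by simp
    then have "AE x in lebesgue. ennreal (max 0 (u x - M) powr q) * indicator (annulus R1 (ereal (R1 + eps))) x = 0"
      unfolding N_def by (subst (asm) nn_integral_0_iff_AE) measurable
    then show ?thesis
    proof eventually_elim
      fix x assume x: "ennreal (max 0 (u x - M) powr q) * indicator (annulus R1 (ereal (R1 + eps))) x = 0"
      show "x \<in> annulus R1 (ereal (R1 + eps)) \<longrightarrow> u x \<le> c * (1 + I powr (1 / q))"
      proof
        assume "x \<in> annulus R1 (ereal (R1 + eps))"
        then have "max 0 (u x - M) powr q \<le> 0" using x by (simp add: ennreal_eq_0_iff)
        then have "max 0 (u x - M) = 0" using powr_gt_zero[of "max 0 (u x - M)" q] by linarith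
        then show "u x \<le> c * (1 + I powr (1 / q))" by (simp add: M_def)
      qed
    qed
  qed
  with c show ?thesis by blast
qed

end

text \<open>The condition on \<open>r\<close> means that \<open>r\<close> is still below the Sobolev
  conjugate of \<open>a\<close>, in a form without division by \<open>N - a\<close>. Strictness of
  the hypothesis on \<open>q\<close> leaves an interval of such exponents above
  \<open>q\<close>.\<close>

lemma sob_conj_exponent:
  fixes N :: nat and a q :: real
  assumes N: "0 < N" and a: "0 < a" and aq: "a \<le> q" and lt: "ereal q < sob_conj N a"
  obtains r where "q < r" "real N * (1 / a - 1 / r) < 1"
proof (cases "a < real N")
  case True
  then have "q < real N * a / (real N - a)" using lt by (simp add: sob_conj_def)
  then obtain r where r: "q < r" "r < real N * a / (real N - a)" using dense by blast
  have r0: "0 < r" using r a aq by linarith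
  have "r * (real N - a) < real N * a" using r True by (simp add: pos_less_divide_eq)
  then have "real N * (r - a) < a * r" by (simp add: algebra_simps)
  moreover have "1 / a - 1 / r = (r - a) / (a * r)" using a r0 by (simp add: field_simps)
  ultimately have "real N * (1 / a - 1 / r) < 1" using a r0 by (simp add: pos_divide_less_eq)
  with r(1) show ?thesis by (rule that)
next
  case False
  have "real N * (1 / a) \<le> 1" using False a by (simp add: field_simps)
  moreover have "0 < real N * (1 / (q + 1))" using N a aq by simp
  ultimately have "real N * (1 / a - 1 / (q + 1)) < 1" by (simp add: right_diff_distrib)
  \<comment> \<open>For \<open>a\<close> at least the dimension every larger exponent is
    subcritical; \<open>q + 1\<close> is an arbitrary choice.\<close>
  then show ?thesis by (intro that[of "q + 1"]) auto
qed

text \<open>The parameter \<open>lam\<close> is fixed before \<open>C\<close>, since the energy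
  estimate is proportional to it in the term with \<open>K\<close>; the solution comes after both
  constants.\<close>

theorem theorem1p3:
  fixes L K :: "'a::euclidean_space \<Rightarrow> real" and p R1 eps s q :: real and R2 :: ereal
  assumes "2 \<le> DIM('a)" and "1 < p" and "0 < R1" and "ereal R1 < R2"
    and "L \<in> borel_measurable lebesgue"
    and "AE x in lebesgue. x \<in> annulus R1 R2 \<longrightarrow> 0 < L x"
    and "\<forall>S. compact S \<and> S \<subseteq> annulus R1 R2 \<longrightarrow> set_integrable lebesgue S L"
    and "K \<in> borel_measurable lebesgue"
    and "0 < emeasure lebesgue {x \<in> annulus R1 R2. 0 < K x}"
    and "condA p R1 R2 L K"
    and "0 < eps" and "ereal (R1 + 2 * eps) < R2"
    and "real DIM('a) / p < s" and "1 / (p - 1) \<le> s"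
    and "p \<le> q" and "ereal q < sob_conj DIM('a) (p * s / (s + 1))"
    and "set_integrable lebesgue (annulus R1 (ereal (R1 + 2 * eps))) (\<lambda>x. L x powr (- s))"
    and "exp_int p q (annulus R1 (ereal (R1 + 2 * eps))) L"
    and "exp_int p q (annulus R1 (ereal (R1 + 2 * eps))) K"
  shows "\<forall>lam > 0. \<exists>C mu. 0 < C \<and> 0 < mu \<and>
           (\<forall>u. weak_solution p L K (annulus R1 R2) lam u \<longrightarrow>
              set_integrable lebesgue (annulus R1 (ereal (R1 + 2 * eps))) (\<lambda>x. \<bar>u x\<bar> powr q) \<and>
              (\<exists>M. AE x in lebesgue. x \<in> annulus R1 (ereal (R1 + eps)) \<longrightarrow> \<bar>u x\<bar> \<le> M) \<and>
              (AE x in lebesgue. x \<in> annulus R1 (ereal (R1 + eps)) \<longrightarrow>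
                 \<bar>u x\<bar> \<le> C * (1 + (\<integral>y\<in>annulus R1 (ereal (R1 + 2 * eps)). \<bar>u y\<bar> powr q \<partial>lebesgue) powr mu)))"
proof (intro allI impI)
  fix lam :: real assume lam: "0 < lam"
  interpret weighted_annulus L p R1 "R1 + 2 * eps" s R2
    using assms by unfold_locales auto
  obtain r where r: "q < r" "real DIM('a) * (1 / a - 1 / r) < 1"
    using sob_conj_exponent[of "DIM('a)" a q] a_ge_1 a_less_p assms by (auto simp: a_def)
  have q0: "0 < q" using p assms(15) by linarith
  have rexp: "sobolev_exponent r" using r assms(15) by (simp add: sobolev_exponent_def)
  \<comment> \<open>Subcriticality passes from \<open>r\<close> down to \<open>q\<close>, so the
    Sobolev inequality is available for both exponents; the one for \<open>q\<close> yields that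
    \<open>u\<close> belongs to \<open>L^q(E)\<close>.\<close>
  have "1 / r \<le> 1 / q" using r q0 by (simp add: frac_le)
  then have "real DIM('a) * (1 / a - 1 / q) \<le> real DIM('a) * (1 / a - 1 / r)"
    by (intro mult_left_mono) auto
  then have qexp: "sobolev_exponent q" unfolding sobolev_exponent_def using r(2) assms(15) by linarith
  obtain C where C: "0 < C" and bound: "\<And>u I. weak_solution p L K A lam u \<Longrightarrow> 0 \<le> I \<Longrightarrow>
     (\<integral>\<^sup>+x\<in>E. ennreal (\<bar>u x\<bar> powr q) \<partial>lebesgue) \<le> ennreal I \<Longrightarrow>
     (AE x in lebesgue. x \<in> annulus R1 (ereal (R1 + eps)) \<longrightarrow> u x \<le> C * (1 + I powr (1 / q)))"
    using degiorgi_upper_bound[OF qexp rexp r(1) assms(18,19,8) lam assms(11) refl] by blast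
  have main: "set_integrable lebesgue E (\<lambda>x. \<bar>u x\<bar> powr q) \<and>
     (AE x in lebesgue. x \<in> annulus R1 (ereal (R1 + eps)) \<longrightarrow>
        \<bar>u x\<bar> \<le> C * (1 + (\<integral>y\<in>E. \<bar>u y\<bar> powr q \<partial>lebesgue) powr (1 / q)))"
    (is "?int u \<and> ?bd u") if sol: "weak_solution p L K A lam u" for u
  proof -
    obtain g where g: "inD0 p L A u g" using sol unfolding weak_solution_def by blast
    have [measurable]: "u \<in> borel_measurable lebesgue" using g by (simp add: inD0_def)
    have "(\<integral>\<^sup>+x\<in>E. ennreal (L x * norm (g x) powr p) \<partial>lebesgue) \<le> (\<integral>\<^sup>+x\<in>A. ennreal (L x * norm (g x) powr p) \<partial>lebesgue)"
      using E_subset_A by (intro nn_integral_mono) (auto simp: indicator_def)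
    also have "\<dots> < \<infinity>" by (rule inD0_energy_finite[OF g])
    finally obtain X where X: "0 \<le> X" "(\<integral>\<^sup>+x\<in>E. ennreal (L x * norm (g x) powr p) \<partial>lebesgue) = ennreal X"
      by (cases "\<integral>\<^sup>+x\<in>E. ennreal (L x * norm (g x) powr p) \<partial>lebesgue") auto
    then have "(\<integral>\<^sup>+x\<in>E. ennreal (L x * norm (g x) powr p) \<partial>lebesgue) \<le> ennreal (X + 1)" by (simp add: ennreal_leI)
    moreover have "0 < X + 1" using X(1) by simp
    ultimately obtain Z where "(\<integral>\<^sup>+x\<in>E. ennreal (\<bar>u x\<bar> powr q) \<partial>lebesgue) \<le> ennreal Z"
      using inD0_sobolev[OF qexp] g by blast
    then have fin: "(\<integral>\<^sup>+x\<in>E. ennreal (\<bar>u x\<bar> powr q) \<partial>lebesgue) < \<infinity>"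
      by (rule le_less_trans) simp
    have eq: "(\<integral>\<^sup>+x. ennreal (indicator E x *\<^sub>R \<bar>u x\<bar> powr q) \<partial>lebesgue) = (\<integral>\<^sup>+x\<in>E. ennreal (\<bar>u x\<bar> powr q) \<partial>lebesgue)"
      by (intro nn_integral_cong) (auto simp: indicator_def)
    have int: "set_integrable lebesgue E (\<lambda>x. \<bar>u x\<bar> powr q)"
      unfolding set_integrable_def using fin eq by (intro integrableI_nonneg) auto
    \<comment> \<open>Integrability identifies this Bochner integral with the extended nonnegative
      one; otherwise it would be 0 by convention and could not serve as a majorant.\<close>
    define I where "I = (\<integral>y\<in>E. \<bar>u y\<bar> powr q \<partial>lebesgue)"
    have "(\<integral>\<^sup>+x. ennreal (indicator E x *\<^sub>R \<bar>u x\<bar> powr q) \<partial>lebesgue) = ennreal I"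
      unfolding I_def set_lebesgue_integral_def
      by (rule nn_integral_eq_integral) (use int in \<open>auto simp: set_integrable_def\<close>)
    then have le: "(\<integral>\<^sup>+x\<in>E. ennreal (\<bar>u x\<bar> powr q) \<partial>lebesgue) \<le> ennreal I" using eq by simp
    have I: "0 \<le> I" unfolding I_def set_lebesgue_integral_def by (intro integral_nonneg_AE) auto
    have "AE x in lebesgue. x \<in> annulus R1 (ereal (R1 + eps)) \<longrightarrow> u x \<le> C * (1 + I powr (1 / q))"
      by (rule bound[OF sol I le])
    moreover have "AE x in lebesgue. x \<in> annulus R1 (ereal (R1 + eps)) \<longrightarrow> - u x \<le> C * (1 + I powr (1 / q))"
      using le by (intro bound[OF weak_solution_uminus[OF sol] I]) simp
    ultimately have "AE x in lebesgue. x \<in> annulus R1 (ereal (R1 + eps)) \<longrightarrow> \<bar>u x\<bar> \<le> C * (1 + I powr (1 / q))"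
      by eventually_elim auto
    then show ?thesis using int by (simp add: I_def)
  qed
  show "\<exists>C mu. 0 < C \<and> 0 < mu \<and>
           (\<forall>u. weak_solution p L K A lam u \<longrightarrow>
              set_integrable lebesgue E (\<lambda>x. \<bar>u x\<bar> powr q) \<and>
              (\<exists>M. AE x in lebesgue. x \<in> annulus R1 (ereal (R1 + eps)) \<longrightarrow> \<bar>u x\<bar> \<le> M) \<and>
              (AE x in lebesgue. x \<in> annulus R1 (ereal (R1 + eps)) \<longrightarrow>
                 \<bar>u x\<bar> \<le> C * (1 + (\<integral>y\<in>E. \<bar>u y\<bar> powr q \<partial>lebesgue) powr mu)))"
  proof (rule exI[of _ C], rule exI[of _ "1 / q"], intro conjI allI impI)
    fix u assume sol: "weak_solution p L K A lam u"
    show "?int u" using main[OF sol] by (rule conjunct1)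
    show "?bd u" using main[OF sol] by (rule conjunct2)
    then show "\<exists>M. AE x in lebesgue. x \<in> annulus R1 (ereal (R1 + eps)) \<longrightarrow> \<bar>u x\<bar> \<le> M" by (rule exI)
  qed (use C q0 in auto)
qed

end
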